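(* Let $r\ge1$, let $\mu,\nu\in\mathcal P^r(\mathbb{R})$ be in convex order ($\mu\le_c\nu$), and let $C:\mathbb{R}\times\mathcal P^r(\mathbb{R})\to\mathbb{R}$ be a measurable cost function, continuous in the second argument, and such that there exists a finite constant $K$ with $$\forall(x,p)\in\mathbb{R}\times\mathcal P^r(\mathbb{R}),\quad C(x,p)\le K\left(1+|x|^r+\int_{\mathbb{R}}|y|^r\,p(dy)\right).$$ Let $\Gamma$ be a martingale $C$-monotone set and let $\pi\in\Pi_M(\mu,\nu)$ be such that $(x,\pi_x)\in\Gamma$ for $\mu(dx)$-almost every $x$. Then $\pi$ is optimal for the weak martingale optimal transport problem, i.e. $$\int_{\mathbb{R}}C(x,\pi_x)\,\mu(dx)=\inf_{\pi'\in\Pi_M(\mu,\nu)}\int_{\mathbb{R}}C(x,\pi'_x)\,\mu(dx).$$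
   Context: $\mathcal P^r(\mathbb{R})$ is the set of probability measures on $\mathbb{R}$ with finite $r$-th moment with the $r$-Wasserstein topology. $\mu\le_c\nu$ means $\int\varphi\,d\mu\le\int\varphi\,d\nu$ for all convex $\varphi:\mathbb{R}\to\mathbb{R}$. $\Pi_M(\mu,\nu)$ is the set of martingale couplings: probability measures $\pi(dx,dy)=\mu(dx)\pi_x(dy)$ on $\mathbb{R}^2$ with marginals $\mu,\nu$ and $\int_{\mathbb{R}}y\,\pi_x(dy)=x$ for $\mu$-a.e. $x$. Martingale $C$-monotonicity: a Borel set $\Gamma\subset\mathbb{R}\times\mathcal P^r(\mathbb{R})$ is martingale $C$-monotone if for any $N\in\mathbb{N}$, any collection $(x_1,p_1),\ldots,(x_N,p_N)\in\Gamma$, and any $q_1,\ldots,q_N\in\mathcal P^1(\mathbb{R})$ such that $\sum_{i=1}^Np_i=\sum_{i=1}^Nq_i$ and $\int_{\mathbb{R}}y\,p_i(dy)=\int_{\mathbb{R}}y\,q_i(dy)$ for each $i$, one has $\sum_{i=1}^NC(x_i,p_i)\le\sum_{i=1}^NC(x_i,q_i)$ (the condition $\sum p_i=\sum q_i$ forces $q_i\in\mathcal P^r(\mathbb{R})$). Integrals $\int C(x,\pi_x)\mu(dx)$ take values in $[-\infty,+\infty)$ thanks to the upper bound on $C$. *)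

theory Defs
  imports "HOL-Probability.Probability"
begin

definition prob_moment :: "real \<Rightarrow> real measure set" where
  "prob_moment r = {p. real_distribution p \<and> integrable p (\<lambda>y. \<bar>y\<bar> powr r)}"

definition couplings :: "real measure \<Rightarrow> real measure \<Rightarrow> (real \<times> real) measure set" where
  "couplings p q = {\<gamma>. prob_space \<gamma> \<and> sets \<gamma> = sets borel \<and>
     distr \<gamma> borel fst = p \<and> distr \<gamma> borel snd = q}"

definition wasserstein :: "real \<Rightarrow> real measure \<Rightarrow> real measure \<Rightarrow> real" where
  "wasserstein r p q =
     (INF \<gamma>\<in>couplings p q. LINT z|\<gamma>. \<bar>fst z - snd z\<bar> powr r) powr (1 / r)"

text \<open>
  The topology induced by the metric \<^term>\<open>wasserstein r\<close> on \<^term>\<open>prob_moment r\<close>. This is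
  \<^term>\<open>Metric_space.mtopology\<close> written out: the characterisation of the latter is only available
  once the triangle inequality has been established.
\<close>

definition wasserstein_open :: "real \<Rightarrow> real measure set \<Rightarrow> bool" where
  "wasserstein_open r U \<longleftrightarrow> U \<subseteq> prob_moment r \<and>
     (\<forall>p\<in>U. \<exists>e>0. \<forall>q\<in>prob_moment r. wasserstein r p q < e \<longrightarrow> q \<in> U)"

definition wasserstein_topology :: "real \<Rightarrow> real measure topology" where
  "wasserstein_topology r = topology (wasserstein_open r)"

lemma istopology_wasserstein_open: "istopology (wasserstein_open r)"
  unfolding istopology_def
proof (intro conjI allI impI)
  fix S T assume S: "wasserstein_open r S" and T: "wasserstein_open r T"
  show "wasserstein_open r (S \<inter> T)"
    unfolding wasserstein_open_def
  proof (intro conjI ballI)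
    show "S \<inter> T \<subseteq> prob_moment r"
      using S by (auto simp: wasserstein_open_def)
    fix p assume p: "p \<in> S \<inter> T"
    obtain d where d: "d > 0" "\<And>q. q \<in> prob_moment r \<Longrightarrow> wasserstein r p q < d \<Longrightarrow> q \<in> S"
      using S p unfolding wasserstein_open_def by blast
    obtain e where e: "e > 0" "\<And>q. q \<in> prob_moment r \<Longrightarrow> wasserstein r p q < e \<Longrightarrow> q \<in> T"
      using T p unfolding wasserstein_open_def by blast
    show "\<exists>e>0. \<forall>q\<in>prob_moment r. wasserstein r p q < e \<longrightarrow> q \<in> S \<inter> T"
      using d e by (intro exI[of _ "min d e"]) auto
  qed
next
  fix \<K> assume "\<forall>K\<in>\<K>. wasserstein_open r K"
  then show "wasserstein_open r (\<Union>\<K>)"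
    unfolding wasserstein_open_def by (simp add: Sup_le_iff) (meson Union_iff)
qed

lemma openin_wasserstein_topology:
  "openin (wasserstein_topology r) U \<longleftrightarrow> wasserstein_open r U"
  unfolding wasserstein_topology_def
  by (simp add: topology_inverse'[OF istopology_wasserstein_open])

lemma topspace_wasserstein_topology: "topspace (wasserstein_topology r) = prob_moment r"
proof -
  have "wasserstein_open r (prob_moment r)"
    by (auto simp: wasserstein_open_def intro: exI[of _ 1])
  then show ?thesis
    unfolding topspace_def openin_wasserstein_topology
    by (auto simp: wasserstein_open_def)
qed

definition borel_of :: "'a topology \<Rightarrow> 'a measure" where
  "borel_of X = sigma (topspace X) {U. openin X U}"

text \<open>
  Only \<^term>\<open>\<infinity> - \<infinity>\<close> would be meaningless here; the integrals below always have a finite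
  positive or a finite negative part.
\<close>

definition ext_integral :: "'a measure \<Rightarrow> ('a \<Rightarrow> real) \<Rightarrow> ereal" where
  "ext_integral M f = enn2ereal (\<integral>\<^sup>+x. ennreal (f x) \<partial>M) - enn2ereal (\<integral>\<^sup>+x. ennreal (- f x) \<partial>M)"

definition convex_order :: "real measure \<Rightarrow> real measure \<Rightarrow> bool" where
  "convex_order \<mu> \<nu> \<longleftrightarrow>
     (\<forall>\<phi>::real \<Rightarrow> real. convex_on UNIV \<phi> \<longrightarrow> ext_integral \<mu> \<phi> \<le> ext_integral \<nu> \<phi>)"

text \<open>
  \<open>\<pi>(dx,dy) = \<mu>(dx) k\<^sub>x(dy)\<close>; rectangles determine a finite measure on the plane. The kernel is
  determined by \<open>\<pi>\<close> up to \<open>\<mu>\<close>-null sets.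
\<close>

definition disintegration ::
    "real measure \<Rightarrow> (real \<Rightarrow> real measure) \<Rightarrow> (real \<times> real) measure \<Rightarrow> bool" where
  "disintegration \<mu> k \<pi> \<longleftrightarrow> k \<in> measurable borel (prob_algebra borel) \<and> sets \<pi> = sets borel \<and>
     (\<forall>A\<in>sets borel. \<forall>B\<in>sets borel.
        emeasure \<pi> (A \<times> B) = (\<integral>\<^sup>+x\<in>A. emeasure (k x) B \<partial>\<mu>))"

definition martingale_couplings ::
    "real measure \<Rightarrow> real measure \<Rightarrow> (real \<times> real) measure set" where
  "martingale_couplings \<mu> \<nu> = {\<pi> \<in> couplings \<mu> \<nu>.
     \<exists>k. disintegration \<mu> k \<pi> \<and> (AE x in \<mu>. has_bochner_integral (k x) (\<lambda>y. y) x)}"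

text \<open>
  The equality of the sums of measures is stated setwise. All measures are finite, so
  \<^const>\<open>measure\<close> loses nothing.
\<close>

definition martingale_C_monotone ::
    "real \<Rightarrow> (real \<Rightarrow> real measure \<Rightarrow> real) \<Rightarrow> (real \<times> real measure) set \<Rightarrow> bool" where
  "martingale_C_monotone r C \<Gamma> \<longleftrightarrow>
     \<Gamma> \<in> sets (borel_of (prod_topology euclidean (wasserstein_topology r))) \<and>
     (\<forall>(N::nat) x p q.
        (\<forall>i<N. (x i, p i) \<in> \<Gamma>) \<longrightarrow> (\<forall>i<N. q i \<in> prob_moment 1) \<longrightarrow>
        (\<forall>A\<in>sets borel. (\<Sum>i<N. measure (p i) A) = (\<Sum>i<N. measure (q i) A)) \<longrightarrow>
        (\<forall>i<N. (LINT y|p i. y) = (LINT y|q i. y)) \<longrightarrow>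
        (\<Sum>i<N. C (x i) (p i)) \<le> (\<Sum>i<N. C (x i) (q i)))"

text \<open>
  \<open>\<integral> C(x, k\<^sub>x) \<mu>(dx)\<close>. Values of \<open>C\<close> outside \<^term>\<open>prob_moment r\<close> do not matter: for a coupling
  with second marginal in \<^term>\<open>prob_moment r\<close>, \<open>k\<^sub>x\<close> lies in that set for \<open>\<mu>\<close>-almost every \<open>x\<close>.
\<close>

definition weak_cost ::
    "(real \<Rightarrow> real measure \<Rightarrow> real) \<Rightarrow> real measure \<Rightarrow> (real \<Rightarrow> real measure) \<Rightarrow> ereal" where
  "weak_cost C \<mu> k = ext_integral \<mu> (\<lambda>x. C x (k x))"

end

theory Submission
  imports Defs
begin

text \<open>
  Let \<open>k'\<close> be the kernel of a competing martingale coupling whose cost is smaller. Contract each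
  \<open>k'\<^sub>x\<close> slightly: average over the cells of a finite partition and shrink towards \<open>x\<close>. The
  contracted measures have finite support, and the potential of their mixture lies strictly below
  that of \<open>\<nu>\<close> on a compact set and agrees with the potential of \<open>\<mu>\<close> off this set. Both facts
  survive the passage to a suitable finite sample \<open>x\<^sub>1, \<dots>, x\<^sub>N\<close> from \<open>\<mu>\<close>, because only finitely many
  averages have to be controlled. Hence the averaged contracted measures are dominated in convex
  order by the average of the \<open>k\<^bsub>x\<^sub>i\<^esub>\<close>, and a martingale coupling between these two averages turns the
  contracted measures into measures \<open>q\<^sub>i\<close> with barycentres \<open>x\<^sub>i\<close> and the same sum as the \<open>k\<^bsub>x\<^sub>i\<^esub>\<close>.
  A Bregman divergence shows that this coupling moves little mass, so that most \<open>q\<^sub>i\<close> are close to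
  \<open>k'\<^bsub>x\<^sub>i\<^esub>\<close>, and the \<open>q\<^sub>i\<close> violate \<open>C\<close>-monotonicity.
\<close>

section \<open>Martingale couplings of a finitely supported measure with a quantile function\<close>

text \<open>Replacing \<mu> by finitely many points perturbs both averages, and convex order, a
  comparison at every level \<open>t\<close>, survives a perturbation only if it is strict.
  Contraction supplies strictness: every potential gap shrinks by the factor
  \<open>1 - \<epsilon>\<close>, which leaves a margin proportional to the gap between the
  potentials of \<nu> and \<mu>. Where that gap vanishes no margin is possible, but there
  \<mu>-almost every kernel has no gap either, so the comparison holds point by point. The pull
  towards \<open>x\<close>, beyond the averaging over cells, keeps the atoms away from the ends of
  the intervals on which the gap is positive; hence the compact set. Finite support makes the
  martingale coupling explicit: intervals are cut out of a quantile function, one per atom. The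
  divergence is that of a Huber function rather than of the square, since for r < 2 second moments
  may be infinite. The cost is only continuous in the measure, with no lower bound and no uniform
  modulus; hence a truncation from below, and sample points taken, outside a set of small measure,
  from a possibly non-measurable set on which one radius serves.\<close>

lemma set_integral_split_interval:
  fixes f :: "real \<Rightarrow> real"
  assumes "set_integrable lborel {a<..<c} f" "a \<le> b" "b \<le> c"
  shows "(LINT v:{a<..<c}|lborel. f v) = (LINT v:{a<..<b}|lborel. f v) + (LINT v:{b<..<c}|lborel. f v)"
proof -
  have i: "set_integrable lborel {a<..<b} f" "set_integrable lborel {b<..<c} f"
    by (rule set_integrable_subset[OF assms(1)]; use assms in auto)+
  have "(LINT v:{a<..<b}|lborel. f v) + (LINT v:{b<..<c}|lborel. f v)
      = (LINT v|lborel. indicator {a<..<b} v *\<^sub>R f v + indicator {b<..<c} v *\<^sub>R f v)"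
    using i unfolding set_integrable_def set_lebesgue_integral_def by simp
  also have "\<dots> = (LINT v:{a<..<c}|lborel. f v)"
    unfolding set_lebesgue_integral_def
    apply (rule integral_cong_AE)
    subgoal using i unfolding set_integrable_def by (intro borel_measurable_add borel_measurable_integrable)
    subgoal using assms(1) unfolding set_integrable_def by (intro borel_measurable_integrable)
    subgoal using AE_lborel_singleton[of b]
      by eventually_elim (use assms in \<open>auto simp: indicator_def\<close>)
    done
  finally show ?thesis by simp
qed

lemma set_integrable_glue_interval:
  fixes f :: "real \<Rightarrow> real"
  assumes "set_integrable lborel {a<..<b} f" "set_integrable lborel {b<..<c} f" "a \<le> b" "b \<le> c"
  shows "set_integrable lborel {a<..<c} f"
proof -
  have "integrable lborel (\<lambda>v. indicator {a<..<b} v *\<^sub>R f v + indicator {b<..<c} v *\<^sub>R f v + indicator {b} v *\<^sub>R f b)"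
    using assms(1,2) integrable_real_indicator[of "{b}" lborel] unfolding set_integrable_def
    by (intro Bochner_Integration.integrable_add) (auto intro!: integrable_scaleR_left)
  also have "(\<lambda>v. indicator {a<..<b} v *\<^sub>R f v + indicator {b<..<c} v *\<^sub>R f v + indicator {b} v *\<^sub>R f b)
     = (\<lambda>v. indicator ({a<..<b}\<union>{b<..<c}\<union>{b}) v *\<^sub>R f v)"
    by (auto simp: indicator_def fun_eq_iff)
  finally have "set_integrable lborel ({a<..<b}\<union>{b<..<c}\<union>{b}) f" unfolding set_integrable_def .
  then show ?thesis by (rule set_integrable_subset) auto
qed

lemma set_integral_shift_interval:
  fixes f :: "real \<Rightarrow> real"
  shows "(LINT v:{b<..<c}|lborel. f (v + a)) = (LINT v:{b+a<..<c+a}|lborel. f v)"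
    and "set_integrable lborel {b<..<c} (\<lambda>v. f (v + a)) \<longleftrightarrow> set_integrable lborel {b+a<..<c+a} f"
proof -
  have *: "indicator {b+a<..<c+a} (a + 1 * v) = (indicator {b<..<c} v :: real)" for v
    by (auto simp: indicator_def)
  show "(LINT v:{b<..<c}|lborel. f (v + a)) = (LINT v:{b+a<..<c+a}|lborel. f v)"
    unfolding set_lebesgue_integral_def
    by (subst lborel_integral_real_affine[of 1 _ a]) (auto simp: indicator_def algebra_simps intro!: Bochner_Integration.integral_cong)
  show "set_integrable lborel {b<..<c} (\<lambda>v. f (v + a)) \<longleftrightarrow> set_integrable lborel {b+a<..<c+a} f"
    unfolding set_integrable_def
    by (subst lborel_integrable_real_affine_iff[of 1 _ a, symmetric])
      (auto simp: indicator_def algebra_simps intro!: Bochner_Integration.integrable_cong)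
qed

text \<open>Deleting the stretch from \<open>s\<close> to \<open>s + a\<close> and closing the gap:
  \<open>g\<close> runs through the remaining values of \<open>f\<close>. The same bookkeeping
  serves \<open>Q\<close>, its positive parts \<open>max 0 (Q v - t)\<close> and the indicators of
  labels.\<close>

lemma set_integral_remove_interval:
  fixes f g :: "real \<Rightarrow> real"
  assumes f: "set_integrable lborel {0<..<m + a} f" and s: "0 \<le> s" "0 \<le> a" "s \<le> m"
    and g: "\<And>v. 0 < v \<Longrightarrow> v < s \<Longrightarrow> g v = f v" "\<And>v. s < v \<Longrightarrow> v < m \<Longrightarrow> g v = f (v + a)"
  shows "set_integrable lborel {0<..<m} g"
    and "(LINT v:{0<..<m + a}|lborel. f v) = (LINT v:{s<..<s + a}|lborel. f v) + (LINT v:{0<..<m}|lborel. g v)"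
proof -
  have f1: "set_integrable lborel {0<..<s} f" "set_integrable lborel {s+a<..<m+a} f"
    "set_integrable lborel {s<..<m + a} f"
    by (rule set_integrable_subset[OF f]; use s in auto)+
  have g1: "set_integrable lborel {0<..<s} g"
    using f1(1) g(1) by (subst set_integrable_cong[OF refl refl, where f'=f]) auto
  have "set_integrable lborel {s<..<m} (\<lambda>v. f (v+a))"
    using f1(2) by (simp add: set_integral_shift_interval)
  then have g2: "set_integrable lborel {s<..<m} g"
    using g(2) by (subst set_integrable_cong[OF refl refl, where f'="\<lambda>v. f (v+a)"]) auto
  show g3: "set_integrable lborel {0<..<m} g"
    by (rule set_integrable_glue_interval[OF g1 g2]) (use s in auto)
  have "(LINT v:{0<..<m + a}|lborel. f v) = (LINT v:{0<..<s}|lborel. f v) + (LINT v:{s<..<s+a}|lborel. f v)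
     + (LINT v:{s+a<..<m+a}|lborel. f v)"
    using set_integral_split_interval[OF f, of s] set_integral_split_interval[OF f1(3), of "s+a"] s by simp
  also have "(LINT v:{s+a<..<m+a}|lborel. f v) = (LINT v:{s<..<m}|lborel. f (v+a))"
    by (simp add: set_integral_shift_interval)
  also have "\<dots> = (LINT v:{s<..<m}|lborel. g v)"
    using g(2) by (intro set_lebesgue_integral_cong) auto
  also have "(LINT v:{0<..<s}|lborel. f v) = (LINT v:{0<..<s}|lborel. g v)"
    using g(1) by (intro set_lebesgue_integral_cong) auto
  finally show "(LINT v:{0<..<m + a}|lborel. f v) = (LINT v:{s<..<s + a}|lborel. f v) + (LINT v:{0<..<m}|lborel. g v)"
    using set_integral_split_interval[OF g3, of s] s by simp
qed

lemma continuous_on_set_integral_upper: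
  fixes f :: "real \<Rightarrow> real"
  assumes "set_integrable lborel {0<..<m} f"
  shows "continuous_on {0..m} (\<lambda>s. LINT v:{0<..<s}|lborel. f v)"
proof -
  have "set_integrable lborel {0<..<m} f \<Longrightarrow> f integrable_on {0..m}"
    using set_borel_integral_eq_integral(1)[of "{0<..<m}" f]
    by (simp add: integrable_on_open_interval_real)
  then have c: "continuous_on {0..m} (\<lambda>s. integral {0..s} f)"
    using assms by (intro indefinite_integral_continuous_1)
  show ?thesis
  proof (rule continuous_on_eq[OF c])
    fix s assume s: "s \<in> {0..m}"
    have "set_integrable lborel {0<..<s} f"
      by (rule set_integrable_subset[OF assms]) (use s in auto)
    then show "integral {0..s} f = (LINT v:{0<..<s}|lborel. f v)"
      by (simp add: set_borel_integral_eq_integral(2) integral_open_interval_real)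
  qed
qed

lemma set_integral_const_interval:
  "a \<le> b \<Longrightarrow> (LINT v:{a<..<b}|lborel. (c::real)) = (b - a) * c"
  by (simp add: set_lebesgue_integral_def)

lemma set_integrable_const_interval:
  "set_integrable lborel {a<..<b::real} (\<lambda>_. c::real)"
proof -
  have "integrable lborel (indicator {a<..<b} :: real \<Rightarrow> real)"
    by (rule integrable_real_indicator) (cases "a \<le> b"; simp)+
  then show ?thesis unfolding set_integrable_def by simp
qed

text \<open>The left side is convex in \<open>t\<close> and the right side affine, so the inequality
  at \<open>l\<close> and at \<open>u\<close> passes to every level between them.\<close>

lemma sum_max0_le_affine:
  fixes a z :: "'i \<Rightarrow> real"
  assumes a: "\<And>j. j \<in> I \<Longrightarrow> 0 \<le> a j"
    and l: "(\<Sum>j\<in>I. a j * max 0 (z j - l)) \<le> S - M * l"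
    and u: "(\<Sum>j\<in>I. a j * max 0 (z j - u)) \<le> S - M * u"
    and t: "l < t" "t < u"
  shows "(\<Sum>j\<in>I. a j * max 0 (z j - t)) \<le> S - M * t"
proof -
  define w where "w = (u - t) / (u - l)"
  have w: "0 \<le> w" "w \<le> 1" "t = w * l + (1 - w) * u"
  proof -
    show "0 \<le> w" "w \<le> 1" using t by (auto simp: w_def field_simps)
    have "w * (u - l) = u - t" using t by (simp add: w_def)
    then show "t = w * l + (1 - w) * u" by (simp add: algebra_simps)
  qed
  have cx: "max 0 (x - t) \<le> w * max 0 (x - l) + (1 - w) * max 0 (x - u)" for x
  proof -
    have "0 \<le> w * max 0 (x - l) + (1 - w) * max 0 (x - u)" using w by auto
    moreover have "x - t = w * (x - l) + (1 - w) * (x - u)" using w(3) by (simp add: algebra_simps)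
    moreover have "w * (x - l) \<le> w * max 0 (x - l)" "(1-w) * (x - u) \<le> (1-w) * max 0 (x - u)"
      using w by (auto intro!: mult_left_mono)
    ultimately show ?thesis by linarith
  qed
  have "(\<Sum>j\<in>I. a j * max 0 (z j - t)) \<le> (\<Sum>j\<in>I. a j * (w * max 0 (z j - l) + (1 - w) * max 0 (z j - u)))"
    using a cx by (intro sum_mono mult_left_mono) auto
  also have "\<dots> = w * (\<Sum>j\<in>I. a j * max 0 (z j - l)) + (1 - w) * (\<Sum>j\<in>I. a j * max 0 (z j - u))"
    by (simp add: sum_distrib_left sum.distrib[symmetric] algebra_simps)
  also have "\<dots> \<le> w * (S - M * l) + (1 - w) * (S - M * u)"
    using l u w by (intro add_mono mult_left_mono) auto
  also have "\<dots> = S - M * (w * l + (1 - w) * u)" by (simp add: algebra_simps)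
  also have "\<dots> = S - M * t" using w(3) by simp
  finally show ?thesis .
qed


text \<open>Convex order between the discrete measure with masses \<open>a j\<close> at
  \<open>z j\<close> and the image of Lebesgue measure on \<open>{0<..<m}\<close> under the
  nondecreasing \<open>Q\<close>, expressed by mass, mean and call functions. The mass
  \<open>m\<close> is not normalised because atoms are removed one at a time.\<close>

definition potential_dominated :: "('i \<Rightarrow> real) \<Rightarrow> ('i \<Rightarrow> real) \<Rightarrow> 'i set \<Rightarrow> (real \<Rightarrow> real) \<Rightarrow> real \<Rightarrow> bool" where
  "potential_dominated a z I Q m \<longleftrightarrow>
     mono_on {0<..<m} Q \<and> set_integrable lborel {0<..<m} Q \<and> (\<Sum>j\<in>I. a j) = m \<and>
     (\<Sum>j\<in>I. a j * z j) = (LINT v:{0<..<m}|lborel. Q v) \<and>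
     (\<forall>t. (\<Sum>j\<in>I. a j * max 0 (z j - t)) \<le> (LINT v:{0<..<m}|lborel. max 0 (Q v - t)))"

lemma set_integrable_max0:
  fixes Q :: "real \<Rightarrow> real"
  assumes "set_integrable lborel {a<..<b} Q"
  shows "set_integrable lborel {a<..<b} (\<lambda>v. max 0 (Q v - t))"
proof (cases "a \<le> b")
  case True
  have "set_integrable lborel {a<..<b} (\<lambda>v. Q v - t)"
    using assms set_integrable_const_interval[of a b t] by (rule set_integral_diff)
  from integrable_max[OF integrable_zero this[unfolded set_integrable_def]]
  show ?thesis unfolding set_integrable_def
    by (rule Bochner_Integration.integrable_cong[THEN iffD1, rotated 2]) (auto simp: indicator_def)
qed (auto simp: set_integrable_def)

text \<open>Put-call parity: with equal masses and equal means, ordered call functions give ordered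
  put functions.\<close>

lemma potential_dominated_below:
  assumes "potential_dominated a z I Q m" "0 \<le> m"
  shows "(\<Sum>j\<in>I. a j * max 0 (t - z j)) \<le> (LINT v:{0<..<m}|lborel. max 0 (t - Q v))"
proof -
  have Q: "set_integrable lborel {0<..<m} Q" using assms by (auto simp: potential_dominated_def)
  have e: "max 0 (t - x) = max 0 (x - t) + t - x" for x :: real by auto
  have "(\<Sum>j\<in>I. a j * max 0 (t - z j)) = (\<Sum>j\<in>I. a j * max 0 (z j - t)) + t * (\<Sum>j\<in>I. a j) - (\<Sum>j\<in>I. a j * z j)"
    by (simp add: e sum.distrib sum_subtractf sum_distrib_left algebra_simps)
  also have "\<dots> \<le> (LINT v:{0<..<m}|lborel. max 0 (Q v - t)) + m * t - (LINT v:{0<..<m}|lborel. Q v)"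
    using assms by (simp add: potential_dominated_def mult.commute)
  also have "m * t = (LINT v:{0<..<m}|lborel. t)" using set_integral_const_interval[of 0 m t] assms by simp
  also have "(LINT v:{0<..<m}|lborel. max 0 (Q v - t)) + (LINT v:{0<..<m}|lborel. t) - (LINT v:{0<..<m}|lborel. Q v)
     = (LINT v:{0<..<m}|lborel. max 0 (Q v - t) + t - Q v)"
    using set_integrable_max0[OF Q, of t] set_integrable_const_interval[of 0 m t] Q
    by (subst set_integral_diff; (subst set_integral_add)?; (intro set_integral_add)?; simp)
  also have "(\<lambda>v. max 0 (Q v - t) + t - Q v) = (\<lambda>v. max 0 (t - Q v))" by (simp add: e)
  finally show ?thesis .
qed

text \<open>The integral of \<open>Q\<close> over a window of length \<open>a j\<close> depends
  continuously on the left end of the window. Domination makes it at most \<open>a j * z j\<close>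
  for the leftmost window and at least that for the rightmost one, so the intermediate value theorem
  applies.\<close>

lemma exists_quantile_interval:
  assumes pd: "potential_dominated a z (insert j I) Q m"
    and fin: "finite I" "I \<noteq> {}" "j \<notin> I" and pos: "\<And>i. i \<in> insert j I \<Longrightarrow> 0 < a i"
  obtains s where "0 \<le> s" "s \<le> m - a j" "(LINT v:{s<..<s + a j}|lborel. Q v) = a j * z j"
proof -
  have mono: "mono_on {0<..<m} Q" and int: "set_integrable lborel {0<..<m} Q"
    and sum: "a j + (\<Sum>i\<in>I. a i) = m"
    using pd fin by (auto simp: potential_dominated_def)
  have aj: "0 < a j" using pos by auto
  have a0: "0 \<le> a i" if "i \<in> insert j I" for i using pos[OF that] by simp
  have m': "0 < (\<Sum>i\<in>I. a i)" using fin pos by (intro sum_pos) auto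
  have m: "a j < m" "0 \<le> m" using sum m' aj by auto
  have sub: "set_integrable lborel {x<..<y} Q" if "0 \<le> x" "y \<le> m" for x y
    by (rule set_integrable_subset[OF int]) (use that in auto)
  define F where "F s = (LINT v:{0<..<s}|lborel. Q v)" for s
  have F: "F (s + a j) - F s = (LINT v:{s<..<s + a j}|lborel. Q v)" if "0 \<le> s" "s \<le> m - a j" for s
    using set_integral_split_interval[OF sub[of 0 "s + a j"], of s] that aj by (simp add: F_def)
  have Fc: "continuous_on {0..m} F" unfolding F_def by (rule continuous_on_set_integral_upper[OF int])
  have c: "continuous_on {0..m - a j} (\<lambda>s. F (s + a j) - F s)"
    by (intro continuous_intros continuous_on_compose2[OF Fc] continuous_on_subset[OF Fc]) (use aj m in auto)
  have lo: "F (0 + a j) - F 0 \<le> a j * z j"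
  proof -
    \<comment> \<open>The value at the right end of the leftmost window: by monotonicity
      \<open>max 0 (t - Q v)\<close> is \<open>t - Q v\<close> inside the window and zero beyond it,
      while the atom \<open>j\<close> alone already bounds the put sum from below.\<close>
    define t where "t = Q (a j)"
    have "a j * max 0 (t - z j) \<le> (\<Sum>i\<in>insert j I. a i * max 0 (t - z i))"
      using fin a0 by (intro member_le_sum mult_nonneg_nonneg) auto
    also have "\<dots> \<le> (LINT v:{0<..<m}|lborel. max 0 (t - Q v))"
      by (rule potential_dominated_below[OF pd m(2)])
    also have "\<dots> = (LINT v:{0<..<a j}|lborel. max 0 (t - Q v)) + (LINT v:{a j<..<m}|lborel. max 0 (t - Q v))"
    proof (rule set_integral_split_interval)
      have "max 0 (t - x) = max 0 (x - t) + t - x" for x :: real by auto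
      then show "set_integrable lborel {0<..<m} (\<lambda>v. max 0 (t - Q v))"
        using set_integrable_max0[OF int, of t] set_integrable_const_interval[of 0 m t] int by simp
    qed (use m aj in auto)
    also have "(LINT v:{0<..<a j}|lborel. max 0 (t - Q v)) = (LINT v:{0<..<a j}|lborel. t - Q v)"
      using m aj by (intro set_lebesgue_integral_cong) (auto simp: t_def intro!: max.absorb2 mono_onD[OF mono])
    also have "(LINT v:{a j<..<m}|lborel. max 0 (t - Q v)) = (LINT v:{a j<..<m}|lborel. 0)"
      using m aj by (intro set_lebesgue_integral_cong) (auto simp: t_def max_def intro!: antisym mono_onD[OF mono])
    also have "(LINT v:{0<..<a j}|lborel. t - Q v) = a j * t - F (a j)"
      using aj m sub[of 0 "a j"] set_integrable_const_interval[of 0 "a j" t]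
      by (simp add: F_def set_integral_const_interval)
    finally have "a j * max 0 (t - z j) \<le> a j * t - F (a j)" by simp
    moreover have "a j * (t - z j) \<le> a j * max 0 (t - z j)" using aj by (intro mult_left_mono) auto
    ultimately show ?thesis by (simp add: F_def set_lebesgue_integral_def algebra_simps)
  qed
  have hi: "a j * z j \<le> F (m - a j + a j) - F (m - a j)"
  proof -
    \<comment> \<open>The mirror image, with the value at the left end of the rightmost
      window.\<close>
    define t where "t = Q (m - a j)"
    have "a j * max 0 (z j - t) \<le> (\<Sum>i\<in>insert j I. a i * max 0 (z i - t))"
      using fin a0 by (intro member_le_sum mult_nonneg_nonneg) auto
    also have "\<dots> \<le> (LINT v:{0<..<m}|lborel. max 0 (Q v - t))"
      using pd by (simp add: potential_dominated_def)
    also have "\<dots> = (LINT v:{0<..<m - a j}|lborel. max 0 (Q v - t)) + (LINT v:{m - a j<..<m}|lborel. max 0 (Q v - t))"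
      by (rule set_integral_split_interval[OF set_integrable_max0[OF int]]) (use m aj in auto)
    also have "(LINT v:{m - a j<..<m}|lborel. max 0 (Q v - t)) = (LINT v:{m - a j<..<m}|lborel. Q v - t)"
      using m aj by (intro set_lebesgue_integral_cong) (auto simp: t_def intro!: max.absorb2 mono_onD[OF mono])
    also have "(LINT v:{0<..<m - a j}|lborel. max 0 (Q v - t)) = (LINT v:{0<..<m - a j}|lborel. 0)"
      using m aj by (intro set_lebesgue_integral_cong) (auto simp: t_def max_def intro!: antisym mono_onD[OF mono])
    also have "(LINT v:{m - a j<..<m}|lborel. Q v - t) = (LINT v:{m - a j<..<m}|lborel. Q v) - a j * t"
      using aj m sub[of "m - a j" m] set_integrable_const_interval[of "m - a j" m t]
      by (simp add: set_integral_const_interval)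
    also have "(LINT v:{m - a j<..<m}|lborel. Q v) = F (m - a j + a j) - F (m - a j)"
      using F[of "m - a j"] m aj by simp
    finally have "a j * max 0 (z j - t) \<le> F (m - a j + a j) - F (m - a j) - a j * t" by simp
    moreover have "a j * (z j - t) \<le> a j * max 0 (z j - t)" using aj by (intro mult_left_mono) auto
    ultimately show ?thesis by (simp add: algebra_simps)
  qed
  from IVT'[OF lo hi _ c] m obtain s where "0 \<le> s" "s \<le> m - a j" "F (s + a j) - F s = a j * z j" by auto
  then show ?thesis using F that by metis
qed

text \<open>After the quantile interval is cut out, the potential of the rest is affine on the range of
  values of the removed piece, so that convexity of the potential of the remaining atoms suffices.\<close>

lemma potential_dominated_remove:
  assumes pd: "potential_dominated a z (insert j I) Q m"
    and fin: "finite I" "I \<noteq> {}" "j \<notin> I" and pos: "\<And>i. i \<in> insert j I \<Longrightarrow> 0 < a i"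
    and s: "0 \<le> s" "s \<le> m - a j" "(LINT v:{s<..<s + a j}|lborel. Q v) = a j * z j"
  shows "potential_dominated a z I (\<lambda>v. if v < s then Q v else Q (v + a j)) (m - a j)"
proof -
  define Q' where "Q' v = (if v < s then Q v else Q (v + a j))" for v
  have mono: "mono_on {0<..<m} Q" and int: "set_integrable lborel {0<..<m} Q"
    and sum: "a j + (\<Sum>i\<in>I. a i) = m" and mean: "a j * z j + (\<Sum>i\<in>I. a i * z i) = (LINT v:{0<..<m}|lborel. Q v)"
    and pot: "\<And>t. a j * max 0 (z j - t) + (\<Sum>i\<in>I. a i * max 0 (z i - t)) \<le> (LINT v:{0<..<m}|lborel. max 0 (Q v - t))"
    using pd fin by (auto simp: potential_dominated_def)
  have aj: "0 < a j" using pos by auto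
  have a0: "0 \<le> a i" if "i \<in> I" for i using pos[of i] that by simp
  have m': "0 < (\<Sum>i\<in>I. a i)" using fin pos by (intro sum_pos) auto
  have int_max: "set_integrable lborel {0<..<m} (\<lambda>v. max 0 (Q v - t))" for t by (rule set_integrable_max0[OF int])
  have Q'mono: "mono_on {0<..<m - a j} Q'"
    using s aj by (auto simp: mono_on_def Q'_def intro!: mono_onD[OF mono])
  note r = set_integral_remove_interval[where a="a j" and m="m - a j" and s=s, simplified, OF _ s(1) less_imp_le[OF aj] s(2)]
  have Q'int: "set_integrable lborel {0<..<m - a j} Q'"
    by (rule r(1)[OF int]) (auto simp: Q'_def)
  have Q'lint: "(LINT v:{0<..<m}|lborel. Q v) = a j * z j + (LINT v:{0<..<m - a j}|lborel. Q' v)"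
    unfolding s(3)[symmetric] by (rule r(2)[OF int]) (auto simp: Q'_def)
  define R where "R t = (LINT v:{0<..<m - a j}|lborel. max 0 (Q' v - t))" for t
  have R: "(LINT v:{0<..<m}|lborel. max 0 (Q v - t)) = (LINT v:{s<..<s + a j}|lborel. max 0 (Q v - t)) + R t" for t
    unfolding R_def by (rule r(2)[OF int_max]) (auto simp: Q'_def)
  have ints: "set_integrable lborel {s<..<s + a j} Q"
    by (rule set_integrable_subset[OF int]) (use s aj in auto)
  define P where "P t = (\<Sum>i\<in>I. a i * max 0 (z i - t))" for t
  \<comment> \<open>At a level below the removed values the removed piece contributes
    \<open>a j * (z j - t)\<close>, at most the share of the removed atom; at a level above them
    (\<open>above\<close>) it contributes nothing. In both cases subtraction preserves the
    inequality.\<close>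
  have below: "P t \<le> R t" if "\<And>v. s < v \<Longrightarrow> v < s + a j \<Longrightarrow> t \<le> Q v" for t
  proof -
    have "(LINT v:{s<..<s + a j}|lborel. max 0 (Q v - t)) = (LINT v:{s<..<s + a j}|lborel. Q v - t)"
      using that by (intro set_lebesgue_integral_cong) auto
    also have "\<dots> = a j * (z j - t)"
      using ints set_integrable_const_interval[of s "s + a j" t] s(3) aj
      by (simp add: set_integral_const_interval algebra_simps)
    also have "\<dots> \<le> a j * max 0 (z j - t)" using aj by (intro mult_left_mono) auto
    finally show ?thesis using pot[of t] R[of t] by (simp add: P_def)
  qed
  have above: "P t \<le> R t" if "\<And>v. s < v \<Longrightarrow> v < s + a j \<Longrightarrow> Q v \<le> t" for t
  proof -
    have "(LINT v:{s<..<s + a j}|lborel. max 0 (Q v - t)) = (LINT v:{s<..<s + a j}|lborel. 0)"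
      using that by (intro set_lebesgue_integral_cong) auto
    also have "\<dots> \<le> a j * max 0 (z j - t)" using aj by simp
    finally show ?thesis using pot[of t] R[of t] by (simp add: P_def)
  qed
  define S where "S = (LINT v:{s<..<m - a j}|lborel. Q' v)"
  \<comment> \<open>At a level between the values kept on the left and those kept on the right, the
    positive part picks out exactly the right-hand piece.\<close>
  have affine: "R t = S - (m - a j - s) * t"
    if "\<And>v. 0 < v \<Longrightarrow> v < s \<Longrightarrow> Q v \<le> t" "\<And>v. s + a j < v \<Longrightarrow> v < m \<Longrightarrow> t \<le> Q v" for t
  proof -
    have "R t = (LINT v:{0<..<s}|lborel. max 0 (Q' v - t)) + (LINT v:{s<..<m - a j}|lborel. max 0 (Q' v - t))"
      unfolding R_def by (rule set_integral_split_interval[OF set_integrable_max0[OF Q'int]]) (use s in auto)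
    also have "(LINT v:{0<..<s}|lborel. max 0 (Q' v - t)) = (LINT v:{0<..<s}|lborel. 0)"
      using that by (intro set_lebesgue_integral_cong) (auto simp: Q'_def)
    also have "(LINT v:{s<..<m - a j}|lborel. max 0 (Q' v - t)) = (LINT v:{s<..<m - a j}|lborel. Q' v - t)"
      using that by (intro set_lebesgue_integral_cong) (auto simp: Q'_def)
    also have "\<dots> = S - (m - a j - s) * t"
    proof -
      have "set_integrable lborel {s<..<m - a j} Q'"
        by (rule set_integrable_subset[OF Q'int]) (use s in auto)
      then show ?thesis using set_integrable_const_interval[of s "m - a j" t] s
        by (simp add: S_def set_integral_const_interval algebra_simps)
    qed
    finally show ?thesis by simp
  qed
  have main: "P t \<le> R t" for t
  proof (cases "(\<forall>v. s < v \<and> v < s + a j \<longrightarrow> t \<le> Q v) \<or> (\<forall>v. s < v \<and> v < s + a j \<longrightarrow> Q v \<le> t)")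
    case True then show ?thesis using below above by blast
  next
    \<comment> \<open>Now \<open>t\<close> lies strictly between two removed values, so
      \<open>affine\<close> applies at \<open>t\<close>. Where the levels \<open>Q s\<close> and
      \<open>Q (s + a j)\<close> exist, \<open>below\<close> and \<open>above\<close> give the
      inequality there, and both levels lie in the affine range.\<close>
    case False
    then obtain v1 v2 where v: "s < v1" "v1 < s + a j" "Q v1 < t" "s < v2" "v2 < s + a j" "t < Q v2" by force
    have Rt: "R t = S - (m - a j - s) * t"
    proof (rule affine)
      fix v assume "0 < v" "v < s"
      then have "Q v \<le> Q v1" using v s aj by (intro mono_onD[OF mono]) auto
      then show "Q v \<le> t" using v by simp
    next
      fix v assume "s + a j < v" "v < m"
      then have "Q v2 \<le> Q v" using v s aj by (intro mono_onD[OF mono]) auto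
      then show "t \<le> Q v" using v by simp
    qed
    have lower: "P (Q s) \<le> S - (m - a j - s) * Q s \<and> Q s < t" if "0 < s"
    proof
      have "P (Q s) \<le> R (Q s)" using that s aj by (intro below mono_onD[OF mono]) auto
      also have "R (Q s) = S - (m - a j - s) * Q s" using that s aj by (intro affine mono_onD[OF mono]) auto
      finally show "P (Q s) \<le> S - (m - a j - s) * Q s" .
      have "Q s \<le> Q v1" using that v s aj by (intro mono_onD[OF mono]) auto
      then show "Q s < t" using v by simp
    qed
    have upper: "P (Q (s + a j)) \<le> S - (m - a j - s) * Q (s + a j) \<and> t < Q (s + a j)" if "s + a j < m"
    proof
      have "P (Q (s + a j)) \<le> R (Q (s + a j))" using that s aj by (intro above mono_onD[OF mono]) auto
      also have "R (Q (s + a j)) = S - (m - a j - s) * Q (s + a j)"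
        using that s aj by (intro affine mono_onD[OF mono]) auto
      finally show "P (Q (s + a j)) \<le> S - (m - a j - s) * Q (s + a j)" .
      have "Q v2 \<le> Q (s + a j)" using that v s aj by (intro mono_onD[OF mono]) auto
      then show "t < Q (s + a j)" using v by simp
    qed
    \<comment> \<open>The remaining mass is positive, which excludes \<open>s = 0\<close> together
      with \<open>s + a j = m\<close>; so at least one of the two comparison levels exists.\<close>
    have "(0 < s \<and> s + a j < m) \<or> (s = 0 \<and> s + a j < m) \<or> (s + a j = m \<and> 0 < s)"
      using s(1,2) sum m' by arith
    then consider "0 < s" "s + a j < m" | "s = 0" "s + a j < m" | "s + a j = m" "0 < s" by blast
    then show ?thesis
    proof cases
      case 1
      show ?thesis unfolding Rt P_def
        by (rule sum_max0_le_affine[where l="Q s" and u="Q (s + a j)"])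
          (use lower[OF 1(1)] upper[OF 1(2)] a0 in \<open>simp_all add: P_def\<close>)
    next
      \<comment> \<open>There is no level below \<open>t\<close>. The remaining atoms and the
        remaining quantiles have the same mean, so by parity the defect is a sum of put functions:
        it is at most zero at \<open>u\<close> and can only decrease down to
        \<open>t\<close>.\<close>
      case 2
      define u where "u = Q (s + a j)"
      have S: "S = (\<Sum>i\<in>I. a i * z i)" using 2 Q'lint mean by (simp add: S_def)
      have eq: "P x = S - (m - a j - s) * x + (\<Sum>i\<in>I. a i * max 0 (x - z i))" for x
      proof -
        have e: "max 0 (y - x) = y - x + max 0 (x - y)" for y by auto
        show ?thesis unfolding P_def using sum[symmetric] 2
          by (simp add: e S sum.distrib sum_subtractf algebra_simps sum_distrib_left)
      qed
      have "(\<Sum>i\<in>I. a i * max 0 (u - z i)) \<le> 0"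
        using upper[OF 2(2)] eq[of u] by (simp add: u_def)
      moreover have "(\<Sum>i\<in>I. a i * max 0 (t - z i)) \<le> (\<Sum>i\<in>I. a i * max 0 (u - z i))"
        using a0 upper[OF 2(2)] by (intro sum_mono mult_left_mono) (auto simp: u_def)
      ultimately show ?thesis using Rt eq[of t] by simp
    next
      \<comment> \<open>Nothing is kept on the right, so \<open>S = 0\<close> and the call sum of
        the remaining atoms is at most zero at \<open>Q s\<close>; it can only decrease from there
        up to \<open>t\<close>.\<close>
      case 3
      have "S = 0" using 3 by (simp add: S_def set_lebesgue_integral_def)
      then have "P (Q s) \<le> 0" "Q s < t" using lower 3 by auto
      moreover have "P t \<le> P (Q s)" unfolding P_def
        using a0 lower[OF 3(2)] by (intro sum_mono mult_left_mono) auto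
      moreover have "m - a j - s = 0" using 3 by simp
      ultimately show ?thesis using Rt \<open>S = 0\<close> by simp
    qed
  qed
  have "potential_dominated a z I Q' (m - a j)"
    using Q'mono Q'int sum mean Q'lint main by (auto simp: potential_dominated_def P_def R_def)
  then show ?thesis unfolding Q'_def[abs_def] .
qed

text \<open>Induction on the atoms: one atom takes an interval of quantiles with the right mean, and
  the others label what is left. The map \<open>J\<close> is a martingale coupling in label form:
  the event \<open>J v = i\<close> has mass \<open>a i\<close>, and \<open>Q\<close> has mean
  \<open>z i\<close> on it.\<close>

lemma quantile_labelling:
  assumes "finite I" "I \<noteq> {}" "\<And>i. i \<in> I \<Longrightarrow> 0 < a i" "potential_dominated a z I Q m"
  shows "\<exists>J. J \<in> borel \<rightarrow>\<^sub>M count_space UNIV \<and> (\<forall>v. J v \<in> I) \<and>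
    (\<forall>i\<in>I. (LINT v:{0<..<m}|lborel. indicator {i} (J v)) = a i \<and>
           (LINT v:{0<..<m}|lborel. indicator {i} (J v) * Q v) = a i * z i)"
  using assms
proof (induction I arbitrary: Q m rule: finite_ne_induct)
  case (singleton j)
  then show ?case
    by (intro exI[of _ "\<lambda>_. j"]) (auto simp: potential_dominated_def set_integral_const_interval)
next
  case (insert j I)
  note fin = \<open>finite I\<close> \<open>I \<noteq> {}\<close> \<open>j \<notin> I\<close>
  have aj: "0 < a j" using insert.prems by auto
  have int: "set_integrable lborel {0<..<m} Q" using insert.prems by (simp add: potential_dominated_def)
  obtain s where s: "0 \<le> s" "s \<le> m - a j" "(LINT v:{s<..<s + a j}|lborel. Q v) = a j * z j"
    using exists_quantile_interval[OF insert.prems(2) fin insert.prems(1)] by auto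
  define Q' where "Q' v = (if v < s then Q v else Q (v + a j))" for v
  have "potential_dominated a z I Q' (m - a j)"
    unfolding Q'_def[abs_def] by (rule potential_dominated_remove[OF insert.prems(2) fin insert.prems(1) s])
  from insert.IH[OF _ this] insert.prems(1) obtain J' where J':
    "J' \<in> borel \<rightarrow>\<^sub>M count_space UNIV" "\<And>v. J' v \<in> I"
    "\<And>i. i \<in> I \<Longrightarrow> (LINT v:{0<..<m - a j}|lborel. indicator {i} (J' v)) = a i"
    "\<And>i. i \<in> I \<Longrightarrow> (LINT v:{0<..<m - a j}|lborel. indicator {i} (J' v) * Q' v) = a i * z i"
    by auto
  note [measurable] = J'(1)
  \<comment> \<open>The labelling of the shortened quantile function is pulled back across the
    cut-out interval, which itself receives the label \<open>j\<close>.\<close>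
  define J where "J v = (if v < s then J' v else if v < s + a j then j else J' (v - a j))" for v
  have J[measurable]: "J \<in> borel \<rightarrow>\<^sub>M count_space UNIV" unfolding J_def[abs_def] by measurable
  have bnd: "set_integrable lborel {0<..<m} (\<lambda>v. indicator {i} (J v) :: real)" for i
    by (rule set_integrable_bound[OF set_integrable_const_interval[of 0 m 1]])
      (auto simp: set_borel_measurable_def indicator_def)
  have bndQ: "set_integrable lborel {0<..<m} (\<lambda>v. indicator {i} (J v) * Q v :: real)" for i
  proof (rule set_integrable_bound[OF int])
    have [measurable]: "(\<lambda>v. indicator {0<..<m} v *\<^sub>R Q v) \<in> borel_measurable borel"
      using int unfolding set_integrable_def by (auto dest: borel_measurable_integrable)
    have [measurable]: "(\<lambda>v. indicator {i} (J v) :: real) \<in> borel_measurable borel"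
      by (rule measurable_compose[OF J]) simp
    have "(\<lambda>v. indicator {i} (J v) * (indicator {0<..<m} v *\<^sub>R Q v)) \<in> borel_measurable borel" by measurable
    then show "set_borel_measurable lborel {0<..<m} (\<lambda>v. indicator {i} (J v) * Q v)"
      by (simp add: set_borel_measurable_def mult_ac)
  qed (auto simp: indicator_def)
  note r = set_integral_remove_interval(2)[where a="a j" and m="m - a j" and s=s, simplified, OF _ s(1) less_imp_le[OF aj] s(2)]
  have 1: "(LINT v:{0<..<m}|lborel. indicator {i} (J v)) = (LINT v:{s<..<s + a j}|lborel. indicator {i} j)
      + (LINT v:{0<..<m - a j}|lborel. indicator {i} (J' v) :: real)" for i
  proof -
    have "(LINT v:{s<..<s + a j}|lborel. indicator {i} (J v) :: real) = (LINT v:{s<..<s + a j}|lborel. indicator {i} j)"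
      by (intro set_lebesgue_integral_cong) (auto simp: J_def)
    moreover have "indicator {i} (J' v) = (indicator {i} (J v) :: real)" if "v < s" for v
      using that by (simp add: J_def)
    moreover have "indicator {i} (J' v) = (indicator {i} (J (v + a j)) :: real)" if "s < v" for v
      using that aj by (simp add: J_def)
    ultimately show ?thesis using r[OF bnd[of i], of "\<lambda>v. indicator {i} (J' v)"] by presburger
  qed
  have 2: "(LINT v:{0<..<m}|lborel. indicator {i} (J v) * Q v) = (LINT v:{s<..<s + a j}|lborel. indicator {i} j * Q v)
      + (LINT v:{0<..<m - a j}|lborel. indicator {i} (J' v) * Q' v :: real)" for i
  proof -
    have "(LINT v:{s<..<s + a j}|lborel. indicator {i} (J v) * Q v :: real) = (LINT v:{s<..<s + a j}|lborel. indicator {i} j * Q v)"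
      by (intro set_lebesgue_integral_cong) (auto simp: J_def)
    moreover have "indicator {i} (J' v) * Q' v = (indicator {i} (J v) * Q v :: real)" if "v < s" for v
      using that by (simp add: J_def Q'_def)
    moreover have "indicator {i} (J' v) * Q' v = (indicator {i} (J (v + a j)) * Q (v + a j) :: real)" if "s < v" for v
      using that aj by (simp add: J_def Q'_def)
    ultimately show ?thesis using r[OF bndQ[of i], of "\<lambda>v. indicator {i} (J' v) * Q' v"] by presburger
  qed
  have z: "indicator {j} (J' v) = (0::real)" for v using J'(2)[of v] fin by (auto simp: indicator_def)
  show ?case
  proof (intro exI[of _ J] conjI ballI allI J)
    show "J v \<in> insert j I" for v using J'(2) by (auto simp: J_def)
    fix i assume i: "i \<in> insert j I"
    show "(LINT v:{0<..<m}|lborel. indicator {i} (J v)) = a i"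
      unfolding 1 using i J'(3)[of i] fin aj by (cases "i = j") (auto simp: z set_integral_const_interval)
    show "(LINT v:{0<..<m}|lborel. indicator {i} (J v) * Q v) = a i * z i"
    proof (cases "i = j")
      case True
      then show ?thesis unfolding 2 by (simp add: z s(3))
    next
      case False
      then show ?thesis unfolding 2 using i J'(4)[of i] by simp
    qed
  qed
qed

section \<open>Couplings and the Wasserstein topology\<close>

lemma prob_momentD:
  assumes "p \<in> prob_moment r"
  shows "prob_space p" "sets p = sets borel" "space p = UNIV" "integrable p (\<lambda>y. \<bar>y\<bar> powr r)"
  using assms sets_eq_imp_space_eq[of p borel]
  by (auto simp: prob_moment_def real_distribution_def real_distribution_axioms_def)

lemma prob_momentI:
  assumes "prob_space p" "sets p = sets borel" "integrable p (\<lambda>y. \<bar>y\<bar> powr r)"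
  shows "p \<in> prob_moment r"
  using assms sets_eq_imp_space_eq[OF assms(2)]
  by (auto simp: prob_moment_def real_distribution_def real_distribution_axioms_def)

lemma wasserstein_less:
  assumes "\<gamma> \<in> couplings p q" "r \<ge> 1" "0 < \<delta>" "(LINT z|\<gamma>. \<bar>fst z - snd z\<bar> powr r) < \<delta> powr r"
  shows "wasserstein r p q < \<delta>"
proof -
  let ?I = "INF \<gamma>\<in>couplings p q. LINT z|\<gamma>. \<bar>fst z - snd z\<bar> powr r"
  have "?I \<le> (LINT z|\<gamma>. \<bar>fst z - snd z\<bar> powr r)"
    using assms(1) by (intro cINF_lower) (auto intro!: bdd_belowI2[of _ 0])
  moreover have "0 \<le> ?I" using assms(1) by (intro cINF_greatest) auto
  ultimately have "?I powr (1 / r) < (\<delta> powr r) powr (1 / r)"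
    using assms by (intro powr_less_mono2) auto
  also have "\<dots> = \<delta>" using assms by (simp add: powr_powr)
  finally show ?thesis unfolding wasserstein_def .
qed

text \<open>The preimage of an interval is open, and \<open>wasserstein_open\<close> unfolds to a
  ball around each of its points. Later estimates use continuity only in this form.\<close>

lemma wasserstein_continuous_at:
  assumes "continuous_map (wasserstein_topology r) euclidean F" "p \<in> prob_moment r" "(0::real) < \<epsilon>"
  shows "\<exists>\<delta>>0. \<forall>q\<in>prob_moment r. wasserstein r p q < \<delta> \<longrightarrow> \<bar>F q - F p\<bar> < \<epsilon>"
proof -
  have "openin (wasserstein_topology r) {q \<in> topspace (wasserstein_topology r). F q \<in> {F p - \<epsilon> <..< F p + \<epsilon>}}"
    using assms(1) by (rule openin_continuous_map_preimage) auto
  then have "wasserstein_open r {q \<in> prob_moment r. F q \<in> {F p - \<epsilon> <..< F p + \<epsilon>}}"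
    by (simp add: openin_wasserstein_topology topspace_wasserstein_topology)
  then have "\<exists>e>0. \<forall>q\<in>prob_moment r. wasserstein r p q < e \<longrightarrow> q \<in> {q \<in> prob_moment r. F q \<in> {F p - \<epsilon> <..< F p + \<epsilon>}}"
    unfolding wasserstein_open_def using assms(2,3) by auto
  then show ?thesis by (auto simp: abs_less_iff) (smt (verit))
qed

text \<open>The cost is measurable for the Borel sets of the product topology. Constant sections,
  being continuous, can be fed into it directly; general kernels are reached from them by
  approximation.\<close>

lemma measurable_section_prod_topology:
  assumes "p \<in> topspace X"
  shows "(\<lambda>x::'a::topological_space. (x, p)) \<in> borel \<rightarrow>\<^sub>M borel_of (prod_topology euclidean X)"
  unfolding borel_of_def
proof (rule measurable_measure_of)
  show "{U. openin (prod_topology (euclidean::'a topology) X) U} \<subseteq> Pow (topspace (prod_topology euclidean X))"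
    using openin_subset by blast
  show "(\<lambda>x. (x, p)) \<in> space borel \<rightarrow> topspace (prod_topology euclidean X)" using assms by auto
  fix U assume "U \<in> {U. openin (prod_topology (euclidean::'a topology) X) U}"
  moreover have "continuous_map euclidean (prod_topology euclidean X) (\<lambda>x::'a. (x, p))"
    using assms by (intro continuous_map_pairedI) auto
  ultimately have "openin euclidean {x \<in> topspace euclidean. (x, p) \<in> U}"
    by (intro openin_continuous_map_preimage) auto
  then show "(\<lambda>x. (x, p)) -` U \<inter> space borel \<in> sets borel" by (simp add: vimage_def)
qed

text \<open>An auxiliary uniform variable, kept as a measure on the whole line so that its
  measurable sets are those of \<open>borel\<close>.\<close>

definition U01 :: "real measure" where "U01 = density lborel (indicator {0<..<1})"

lemma sets_U01[simp, measurable_cong]: "sets U01 = sets borel" by (simp add: U01_def)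
lemma space_U01[simp]: "space U01 = UNIV" by (simp add: U01_def)

lemma prob_space_U01: "prob_space U01"
  by (rule prob_spaceI) (simp add: U01_def emeasure_density)

text \<open>Thinning a cell of mass \<open>w\<close> down to mass \<open>b\<close>. The
  multiplicative form avoids division and covers the empty cell \<open>w = 0\<close>.\<close>

lemma measure_U01_scaled_less:
  assumes "0 \<le> b" "b \<le> w"
  shows "w * measure U01 {u. u * w < b} = b"
proof (cases "w = 0")
  case False
  then have w: "0 < w" using assms by simp
  have "emeasure U01 {u. u * w < b} = emeasure lborel {0<..<b / w}"
    unfolding U01_def
  proof (subst emeasure_density)
    have "(\<integral>\<^sup>+ x. indicator {0<..<1} x * indicator {u. u * w < b} x \<partial>lborel) = (\<integral>\<^sup>+ x. indicator {0<..<b / w} x \<partial>lborel)"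
    proof (intro nn_integral_cong)
      fix x :: real
      have "x < 1" if "x * w < b"
      proof (rule ccontr)
        assume "\<not> x < 1"
        then have "1 * w \<le> x * w" using w by (intro mult_right_mono) auto
        then show False using that assms by simp
      qed
      then show "indicator {0<..<1} x * indicator {u. u * w < b} x = (indicator {0<..<b / w} x :: ennreal)"
        using w by (auto simp: indicator_def pos_less_divide_eq)
    qed
    then show "(\<integral>\<^sup>+ x. indicator {0<..<1} x * indicator {u. u * w < b} x \<partial>lborel) = emeasure lborel {0<..<b / w}" by simp
  qed (auto)
  then have "measure U01 {u. u * w < b} = b / w" using w assms by (simp add: measure_def)
  then show ?thesis using w by simp
qed (use assms in auto)

text \<open>The mass at the exempted point \<open>z0\<close> is recovered from the total mass
  1.\<close>

lemma prob_measure_eqI_finite: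
  fixes p q :: "real measure"
  assumes p: "prob_space p" "sets p = sets borel" and q: "prob_space q" "sets q = sets borel"
    and Z: "finite Z" "measure p Z = 1" "measure q Z = 1"
    and eq: "\<And>z. z \<in> Z \<Longrightarrow> z \<noteq> z0 \<Longrightarrow> measure p {z} = measure q {z}"
  shows "p = q"
proof (rule measure_eqI)
  interpret p: prob_space p by fact
  interpret q: prob_space q by fact
  have Zs: "Z \<in> sets borel" using Z(1) by (intro borel_closed finite_imp_closed)
  have single: "{z} \<in> sets p" "{z} \<in> sets q" for z using p q by auto
  have mp: "measure p A = (\<Sum>z\<in>Z \<inter> A. measure p {z})" if "A \<in> sets borel" for A
  proof -
    have "measure p A = measure p (A \<inter> Z)"
      using p.prob_eq_1[of Z] Z(2) Zs that p(2) by (intro p.finite_measure_eq_AE) auto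
    also have "\<dots> = (\<Sum>z\<in>A \<inter> Z. measure p {z})"
      using Z(1) single by (intro p.finite_measure_eq_sum_singleton) auto
    finally show ?thesis by (simp add: Int_commute)
  qed
  have mq: "measure q A = (\<Sum>z\<in>Z \<inter> A. measure q {z})" if "A \<in> sets borel" for A
  proof -
    have "measure q A = measure q (A \<inter> Z)"
      using q.prob_eq_1[of Z] Z(3) Zs that q(2) by (intro q.finite_measure_eq_AE) auto
    also have "\<dots> = (\<Sum>z\<in>A \<inter> Z. measure q {z})"
      using Z(1) single by (intro q.finite_measure_eq_sum_singleton) auto
    finally show ?thesis by (simp add: Int_commute)
  qed
  have "measure p {z} = measure q {z}" if "z \<in> Z" for z
  proof (cases "z = z0")
    case True
    have "(\<Sum>z\<in>Z - {z0}. measure p {z}) = (\<Sum>z\<in>Z - {z0}. measure q {z})"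
      by (intro sum.cong) (auto intro: eq)
    moreover have "(\<Sum>z\<in>Z. measure p {z}) = (\<Sum>z\<in>Z. measure q {z})" using mp[of Z] mq[of Z] Z Zs by simp
    ultimately show ?thesis using Z(1) that True by (simp add: sum.remove)
  qed (use eq that in auto)
  then have "measure p A = measure q A" if "A \<in> sets borel" for A
    using mp[OF that] mq[OF that] by simp
  then show "A \<in> sets p \<Longrightarrow> emeasure p A = emeasure q A" for A
    using p q by (simp add: p.emeasure_eq_measure q.emeasure_eq_measure)
qed (use p q in simp)

section \<open>Measurability of the cost along a kernel\<close>

text \<open>Rounding down to the lattice of mesh \<open>1 / n\<close>. Points outside
  \<open>[-n, n]\<close> go to 0, so the range is finite and a far point is displaced by
  \<open>|y|\<close>, which the tail of the moment controls.\<close>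

definition grid :: "nat \<Rightarrow> real \<Rightarrow> real" where
  "grid n y = (if \<bar>y\<bar> \<le> n then \<lfloor>n * y\<rfloor> / n else 0)"

definition grid_mass :: "nat \<Rightarrow> real measure \<Rightarrow> real \<Rightarrow> real" where
  "grid_mass n p z = measure p (grid n -` {z})"

definition rounded_mass :: "nat \<Rightarrow> nat \<Rightarrow> real measure \<Rightarrow> real \<Rightarrow> real" where
  "rounded_mass n m p z = \<lfloor>m * grid_mass n p z\<rfloor> / m"

text \<open>The cell masses are rounded down to multiples of \<open>1 / m\<close> and the remainder is sent to \<open>0\<close>;
  for fixed \<open>n\<close> and \<open>m\<close> only finitely many measures arise in this way.\<close>

definition rounding :: "nat \<Rightarrow> nat \<Rightarrow> real measure \<Rightarrow> real \<times> real \<Rightarrow> real" where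
  "rounding n m p = (\<lambda>(y, u). if u * grid_mass n p (grid n y) < rounded_mass n m p (grid n y) then grid n y else 0)"

definition rounded :: "nat \<Rightarrow> nat \<Rightarrow> real measure \<Rightarrow> real measure" where
  "rounded n m p = distr (p \<Otimes>\<^sub>M U01) borel (rounding n m p)"

lemma measurable_grid[measurable]: "grid n \<in> borel_measurable borel"
  unfolding grid_def by measurable

lemma finite_range_grid: "finite (range (grid n))"
proof (rule finite_subset)
  show "range (grid n) \<subseteq> insert 0 ((\<lambda>j. of_int j / n) ` {- int (n * n) .. int (n * n)})"
  proof
    fix z assume "z \<in> range (grid n)"
    then obtain y where y: "z = grid n y" by auto
    show "z \<in> insert 0 ((\<lambda>j. of_int j / n) ` {- int (n * n) .. int (n * n)})"
    proof (cases "\<bar>y\<bar> \<le> n")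
      case True
      then have "real n * y \<le> real n * n" "real n * (- y) \<le> real n * n" by (intro mult_left_mono; simp)+
      then have "- int (n * n) \<le> \<lfloor>n * y\<rfloor>" "\<lfloor>n * y\<rfloor> \<le> int (n * n)"
        by (simp_all add: le_floor_iff floor_le_iff)
      then show ?thesis using y True by (auto simp: grid_def)
    qed (use y in \<open>auto simp: grid_def\<close>)
  qed
qed auto

lemma abs_grid_diff_le: "n \<noteq> 0 \<Longrightarrow> \<bar>y\<bar> \<le> n \<Longrightarrow> \<bar>y - grid n y\<bar> \<le> 1 / n"
proof -
  assume n: "n \<noteq> 0" and y: "\<bar>y\<bar> \<le> n"
  have "y - grid n y = (n * y - \<lfloor>n * y\<rfloor>) / n" using n y by (simp add: grid_def field_simps)
  moreover have "0 \<le> n * y - \<lfloor>n * y\<rfloor>" "n * y - \<lfloor>n * y\<rfloor> \<le> 1" by linarith+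
  ultimately show ?thesis using n by (simp add: divide_right_mono)
qed

lemma (in pair_prob_space) integral_pair_fst:
  fixes h :: "'a \<Rightarrow> real"
  assumes [measurable]: "h \<in> borel_measurable M1"
  shows "integrable (M1 \<Otimes>\<^sub>M M2) (\<lambda>x. h (fst x)) \<longleftrightarrow> integrable M1 h"
    and "(LINT x|(M1 \<Otimes>\<^sub>M M2). h (fst x)) = (LINT x|M1. h x)"
proof -
  have "distr (M1 \<Otimes>\<^sub>M M2) M1 fst = M1" by (rule M2.distr_pair_fst)
  then show "integrable (M1 \<Otimes>\<^sub>M M2) (\<lambda>x. h (fst x)) \<longleftrightarrow> integrable M1 h"
    "(LINT x|(M1 \<Otimes>\<^sub>M M2). h (fst x)) = (LINT x|M1. h x)"
    using integrable_distr_eq[of fst "M1 \<Otimes>\<^sub>M M2" M1 h] integral_distr[of fst "M1 \<Otimes>\<^sub>M M2" M1 h] by auto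
qed

context
  fixes p :: "real measure" and n m :: nat
  assumes p: "prob_space p" "sets p = sets borel" and n: "n \<noteq> 0" and m: "m \<noteq> 0"
begin

interpretation prob_space p by (rule p)
interpretation U: prob_space U01 by (rule prob_space_U01)
interpretation PU: pair_prob_space p U01 by unfold_locales

lemma sets_p[measurable_cong]: "sets p = sets borel" by (rule p(2))

lemma space_p: "space p = UNIV" using sets_eq_imp_space_eq[OF p(2)] by simp

lemma rounded_mass_bounds:
  "0 \<le> rounded_mass n m p z" "rounded_mass n m p z \<le> grid_mass n p z"
  "grid_mass n p z - rounded_mass n m p z \<le> 1 / m"
proof -
  have "0 \<le> m * grid_mass n p z" by (simp add: grid_mass_def)
  then show "0 \<le> rounded_mass n m p z" by (simp add: rounded_mass_def)
  show "rounded_mass n m p z \<le> grid_mass n p z" using m by (simp add: rounded_mass_def field_simps)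
  have "m * grid_mass n p z - \<lfloor>m * grid_mass n p z\<rfloor> \<le> 1" by linarith
  then have "(m * grid_mass n p z - \<lfloor>m * grid_mass n p z\<rfloor>) / m \<le> 1 / m" by (intro divide_right_mono) auto
  then show "grid_mass n p z - rounded_mass n m p z \<le> 1 / m"
    using m by (simp add: rounded_mass_def diff_divide_distrib)
qed

text \<open>The finite range of \<open>grid n\<close> makes every function of it measurable,
  whatever \<open>f\<close> is.\<close>

lemma measurable_grid_fun: "(\<lambda>y. f (grid n y)) \<in> borel_measurable borel" for f :: "real \<Rightarrow> real"
proof -
  have "(\<lambda>y. f (grid n y)) = (\<lambda>y. \<Sum>z\<in>range (grid n). f z * indicator {z} (grid n y))"
  proof
    fix y
    have "(\<Sum>z\<in>range (grid n). f z * indicator {z} (grid n y)) = (\<Sum>z\<in>{grid n y}. f z * indicator {z} (grid n y))"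
      using finite_range_grid by (intro sum.mono_neutral_right) (auto simp: indicator_def)
    then show "f (grid n y) = (\<Sum>z\<in>range (grid n). f z * indicator {z} (grid n y))" by simp
  qed
  then show ?thesis by simp
qed

lemmas [measurable] = measurable_grid_fun[of "grid_mass n p"] measurable_grid_fun[of "rounded_mass n m p"]

lemma measurable_rounding[measurable]: "rounding n m p \<in> borel_measurable (borel \<Otimes>\<^sub>M borel)"
  unfolding rounding_def by measurable

lemma sets_rounding_ok:
  "{(y, u). grid n y = z \<and> u * grid_mass n p (grid n y) < rounded_mass n m p (grid n y)} \<in> sets (borel \<Otimes>\<^sub>M borel)"
  "{(y, u). \<not> u * grid_mass n p (grid n y) < rounded_mass n m p (grid n y)} \<in> sets (borel \<Otimes>\<^sub>M borel)"
proof -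
  have "{x \<in> space (borel \<Otimes>\<^sub>M borel). grid n (fst x) = z \<and> snd x * grid_mass n p (grid n (fst x)) < rounded_mass n m p (grid n (fst x))}
    \<in> sets (borel \<Otimes>\<^sub>M borel)" by measurable
  also have "{x \<in> space (borel \<Otimes>\<^sub>M borel). grid n (fst x) = z \<and> snd x * grid_mass n p (grid n (fst x)) < rounded_mass n m p (grid n (fst x))}
    = {(y, u). grid n y = z \<and> u * grid_mass n p (grid n y) < rounded_mass n m p (grid n y)}"
    by (auto simp: space_pair_measure)
  finally show "\<dots> \<in> sets (borel \<Otimes>\<^sub>M borel)" .
  have "{x \<in> space (borel \<Otimes>\<^sub>M borel). \<not> snd x * grid_mass n p (grid n (fst x)) < rounded_mass n m p (grid n (fst x))}
    \<in> sets (borel \<Otimes>\<^sub>M borel)" by measurable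
  also have "{x \<in> space (borel \<Otimes>\<^sub>M borel). \<not> snd x * grid_mass n p (grid n (fst x)) < rounded_mass n m p (grid n (fst x))}
    = {(y, u). \<not> u * grid_mass n p (grid n y) < rounded_mass n m p (grid n y)}"
    by (auto simp: space_pair_measure)
  finally show "\<dots> \<in> sets (borel \<Otimes>\<^sub>M borel)" .
qed

lemma measure_times_U01:
  "A \<in> sets borel \<Longrightarrow> B \<in> sets borel \<Longrightarrow> PU.P.prob (A \<times> B) = prob A * U.prob B"
  using U.emeasure_pair_measure_Times[of A p B] p(2) by (simp add: measure_def enn2real_mult)

lemma prob_rounding_cell:
  "PU.P.prob {(y, u). grid n y = z \<and> u * grid_mass n p (grid n y) < rounded_mass n m p (grid n y)} = rounded_mass n m p z"
proof -
  have "{(y, u). grid n y = z \<and> u * grid_mass n p (grid n y) < rounded_mass n m p (grid n y)}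
      = (grid n -` {z}) \<times> {u. u * grid_mass n p z < rounded_mass n m p z}" by auto
  also have "PU.P.prob \<dots> = prob (grid n -` {z}) * U.prob {u. u * grid_mass n p z < rounded_mass n m p z}"
    using measurable_sets[OF measurable_grid, of "{z}" n]
    by (intro measure_times_U01) auto
  also have "\<dots> = rounded_mass n m p z"
    unfolding grid_mass_def[symmetric] using rounded_mass_bounds by (intro measure_U01_scaled_less)
  finally show ?thesis .
qed

text \<open>Rounding a cell mass down loses at most \<open>1 / m\<close>, once for each
  cell.\<close>

lemma prob_rounding_fail:
  "PU.P.prob {(y, u). \<not> u * grid_mass n p (grid n y) < rounded_mass n m p (grid n y)} \<le> card (range (grid n)) / m"
proof -
  let ?B = "\<lambda>z. {(y, u). grid n y = z \<and> \<not> u * grid_mass n p (grid n y) < rounded_mass n m p (grid n y)}"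
  let ?A = "\<lambda>z. {(y, u). grid n y = z \<and> u * grid_mass n p (grid n y) < rounded_mass n m p (grid n y)}"
  have [measurable]: "?A z \<in> sets (borel \<Otimes>\<^sub>M borel)" for z by (rule sets_rounding_ok)
  have Bs: "?B z \<in> sets (borel \<Otimes>\<^sub>M borel)" for z
  proof -
    have "?B z = (grid n -` {z}) \<times> UNIV - ?A z" by auto
    then show ?thesis using measurable_sets[OF measurable_grid, of "{z}" n] by auto
  qed
  have sb: "sets (p \<Otimes>\<^sub>M U01) = sets (borel \<Otimes>\<^sub>M borel)" by (intro sets_pair_measure_cong p) simp
  have 1: "PU.P.prob (?B z) \<le> 1 / m" for z
  proof -
    have "?B z = (grid n -` {z}) \<times> UNIV - ?A z" by auto
    moreover have "PU.P.prob ((grid n -` {z}) \<times> UNIV) = grid_mass n p z"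
      using measurable_sets[OF measurable_grid, of "{z}" n] U.prob_space
      by (subst measure_times_U01) (auto simp: grid_mass_def)
    moreover have "PU.P.prob ((grid n -` {z}) \<times> UNIV - ?A z) = PU.P.prob ((grid n -` {z}) \<times> UNIV) - PU.P.prob (?A z)"
      using measurable_sets[OF measurable_grid, of "{z}" n]
      by (intro PU.P.finite_measure_Diff) (auto simp: sb)
    ultimately show ?thesis using rounded_mass_bounds(3)[of z] prob_rounding_cell[of z] by simp
  qed
  have "{(y, u). \<not> u * grid_mass n p (grid n y) < rounded_mass n m p (grid n y)} = (\<Union>z\<in>range (grid n). ?B z)" by auto
  also have "PU.P.prob \<dots> \<le> (\<Sum>z\<in>range (grid n). PU.P.prob (?B z))"
    by (rule PU.P.finite_measure_subadditive_finite[OF finite_range_grid]) (use Bs sb in blast)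
  also have "\<dots> \<le> (\<Sum>z\<in>range (grid n). 1 / m)" by (intro sum_mono 1)
  finally show ?thesis by simp
qed

lemma prob_space_rounded: "prob_space (rounded n m p)" "sets (rounded n m p) = sets borel"
  unfolding rounded_def by (auto intro!: PU.P.prob_space_distr)

lemma rounding_range: "rounding n m p x \<in> insert 0 (range (grid n))"
  by (auto simp: rounding_def split: prod.split)

lemma measure_rounded_finite: "measure (rounded n m p) (insert 0 (range (grid n))) = 1"
proof -
  have s: "insert 0 (range (grid n)) \<in> sets borel"
    using finite_range_grid by (intro borel_closed finite_imp_closed) auto
  have "measure (rounded n m p) (insert 0 (range (grid n))) = PU.P.prob (space (p \<Otimes>\<^sub>M U01))"
    unfolding rounded_def using s
    by (subst measure_distr) (use rounding_range in \<open>auto intro!: arg_cong[where f=PU.P.prob]\<close>)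
  then show ?thesis by (simp add: PU.P.prob_space)
qed

lemma measure_rounded_singleton: "z \<noteq> 0 \<Longrightarrow> measure (rounded n m p) {z} = rounded_mass n m p z"
proof -
  assume z: "z \<noteq> 0"
  have "rounding n m p -` {z} \<inter> space (p \<Otimes>\<^sub>M U01)
      = {(y, u). grid n y = z \<and> u * grid_mass n p (grid n y) < rounded_mass n m p (grid n y)}"
  proof (rule set_eqI)
    fix x :: "real \<times> real"
    obtain y u where x: "x = (y, u)" by (cases x)
    show "x \<in> rounding n m p -` {z} \<inter> space (p \<Otimes>\<^sub>M U01) \<longleftrightarrow>
        x \<in> {(y, u). grid n y = z \<and> u * grid_mass n p (grid n y) < rounded_mass n m p (grid n y)}"
      using z by (cases "u * grid_mass n p (grid n y) < rounded_mass n m p (grid n y)")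
        (simp_all add: x rounding_def space_pair_measure space_p)
  qed
  then show ?thesis unfolding rounded_def
    by (subst measure_distr) (simp_all add: prob_rounding_cell)
qed

lemma rounded_in_prob_moment: "rounded n m p \<in> prob_moment r"
proof (rule prob_momentI[OF prob_space_rounded])
  interpret R: prob_space "rounded n m p" by (rule prob_space_rounded)
  define Z where "Z = insert 0 (range (grid n))"
  define B where "B = (\<Sum>z\<in>Z. \<bar>z\<bar> powr r)"
  have Z: "finite Z" using finite_range_grid by (simp add: Z_def)
  have "AE y in rounded n m p. y \<in> Z"
    using measure_rounded_finite Z prob_space_rounded(2)
    by (subst R.prob_eq_1[symmetric]) (auto simp: Z_def[symmetric] intro!: borel_closed finite_imp_closed)
  then have "AE y in rounded n m p. norm (\<bar>y\<bar> powr r) \<le> B"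
  proof (rule AE_mp, intro AE_I2 impI)
    fix y assume "y \<in> Z"
    then show "norm (\<bar>y\<bar> powr r) \<le> B" unfolding B_def using Z member_le_sum[of y Z "\<lambda>z. \<bar>z\<bar> powr r"] by simp
  qed
  moreover have "(\<lambda>y. \<bar>y\<bar> powr r) \<in> borel_measurable (rounded n m p)"
    by (subst measurable_cong_sets[OF prob_space_rounded(2) refl]) measurable
  ultimately show "integrable (rounded n m p) (\<lambda>y. \<bar>y\<bar> powr r)"
    by (rule R.integrable_const_bound)
qed

lemma rounded_coupling: "distr (p \<Otimes>\<^sub>M U01) borel (\<lambda>x. (fst x, rounding n m p x)) \<in> couplings p (rounded n m p)"
proof -
  have [measurable]: "(\<lambda>x. (fst x, rounding n m p x)) \<in> p \<Otimes>\<^sub>M U01 \<rightarrow>\<^sub>M borel"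
    by (subst borel_prod[symmetric]) measurable
  have "distr (distr (p \<Otimes>\<^sub>M U01) borel (\<lambda>x. (fst x, rounding n m p x))) borel fst = distr (p \<Otimes>\<^sub>M U01) borel fst"
    by (subst distr_distr) (auto simp: comp_def borel_prod[symmetric] intro!: distr_cong)
  also have "\<dots> = p" using U.distr_pair_fst[of p] p(2) by (simp cong: distr_cong)
  finally have 1: "distr (distr (p \<Otimes>\<^sub>M U01) borel (\<lambda>x. (fst x, rounding n m p x))) borel fst = p" .
  have 2: "distr (distr (p \<Otimes>\<^sub>M U01) borel (\<lambda>x. (fst x, rounding n m p x))) borel snd = rounded n m p"
    unfolding rounded_def by (subst distr_distr) (auto simp: comp_def borel_prod[symmetric] intro!: distr_cong)
  show ?thesis unfolding couplings_def using 1 2 by (auto intro!: PU.P.prob_space_distr)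
qed

text \<open>Three sources of displacement: the mesh of the grid, the tail sent to 0, and the
  thinned-out points of \<open>[-n, n]\<close>, each of which moves by at most
  \<open>n\<close>.\<close>

lemma rounded_cost:
  assumes r: "r \<ge> 1" and int: "integrable p (\<lambda>y. \<bar>y\<bar> powr r)"
  shows "(LINT z|distr (p \<Otimes>\<^sub>M U01) borel (\<lambda>x. (fst x, rounding n m p x)). \<bar>fst z - snd z\<bar> powr r)
    \<le> (1 / n) powr r + (LINT y|p. indicator {y. n < \<bar>y\<bar>} y * \<bar>y\<bar> powr r) + n powr r * (card (range (grid n)) / m)"
proof -
  let ?F = "{(y, u). \<not> u * grid_mass n p (grid n y) < rounded_mass n m p (grid n y)}"
  have [measurable]: "(\<lambda>x. (fst x, rounding n m p x)) \<in> p \<Otimes>\<^sub>M U01 \<rightarrow>\<^sub>M borel"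
    by (subst borel_prod[symmetric]) measurable
  have [measurable]: "?F \<in> sets (borel \<Otimes>\<^sub>M borel)" by (rule sets_rounding_ok)
  have [measurable]: "(\<lambda>z. \<bar>fst z - snd z\<bar> powr r) \<in> borel_measurable (borel :: (real \<times> real) measure)"
    by (subst borel_prod[symmetric]) measurable
  have i0: "integrable p (\<lambda>y. indicator {y. n < \<bar>y\<bar>} y * \<bar>y\<bar> powr r)"
    by (rule Bochner_Integration.integrable_bound[OF int]) (auto simp: indicator_def)
  have i1: "integrable (p \<Otimes>\<^sub>M U01) (\<lambda>x. indicator {y. n < \<bar>y\<bar>} (fst x) * \<bar>fst x\<bar> powr r)"
    using i0 by (subst PU.integral_pair_fst) auto
  have i2: "integrable (p \<Otimes>\<^sub>M U01) (indicator ?F :: _ \<Rightarrow> real)"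
    by (rule integrable_real_indicator) (auto simp: less_top[symmetric])
  have "(LINT z|distr (p \<Otimes>\<^sub>M U01) borel (\<lambda>x. (fst x, rounding n m p x)). \<bar>fst z - snd z\<bar> powr r)
     = (LINT x|(p \<Otimes>\<^sub>M U01). \<bar>fst x - rounding n m p x\<bar> powr r)"
    by (subst integral_distr) auto
  also have "\<dots> \<le> (LINT x|(p \<Otimes>\<^sub>M U01). (1 / n) powr r + indicator {y. n < \<bar>y\<bar>} (fst x) * \<bar>fst x\<bar> powr r + n powr r * indicator ?F x)"
  proof (rule integral_mono')
    show "integrable (p \<Otimes>\<^sub>M U01) (\<lambda>x::real \<times> real. (1 / n) powr r + indicator {y. n < \<bar>y\<bar>} (fst x) * \<bar>fst x\<bar> powr r + n powr r * indicator ?F x)"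
      using i1 i2 by (intro Bochner_Integration.integrable_add integrable_mult_right) simp_all
    show "0 \<le> (1 / n) powr r + indicator {y. n < \<bar>y\<bar>} (fst x) * \<bar>fst x\<bar> powr r + n powr r * indicator ?F x" for x :: "real \<times> real"
      by simp
    fix x :: "real \<times> real"
    obtain y u where x: "x = (y, u)" by (cases x)
    show "\<bar>fst x - rounding n m p x\<bar> powr r \<le> (1 / n) powr r + indicator {y. n < \<bar>y\<bar>} (fst x) * \<bar>fst x\<bar> powr r + n powr r * indicator ?F x"
    proof (cases "\<bar>y\<bar> \<le> n")
      case True
      show ?thesis
      proof (cases "x \<in> ?F")
        case True
        have "\<bar>y\<bar> powr r \<le> n powr r" using \<open>\<bar>y\<bar> \<le> n\<close> r by (intro powr_mono2) auto
        then show ?thesis using True by (simp add: x rounding_def add_increasing)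
      next
        case False
        have "\<bar>y - grid n y\<bar> powr r \<le> (1 / n) powr r"
          using abs_grid_diff_le[OF n \<open>\<bar>y\<bar> \<le> n\<close>] r by (intro powr_mono2) auto
        then show ?thesis using False \<open>\<bar>y\<bar> \<le> n\<close> by (simp add: x rounding_def)
      qed
    next
      case False
      then have "grid n y = 0" by (simp add: grid_def)
      then show ?thesis using False by (simp add: x rounding_def)
    qed
  qed
  also have "\<dots> = (1 / n) powr r + (LINT y|p. indicator {y. n < \<bar>y\<bar>} y * \<bar>y\<bar> powr r) + n powr r * PU.P.prob ?F"
    using i1 i2 PU.P.prob_space
      PU.integral_pair_fst(2)[where h="\<lambda>y. indicator {y. n < \<bar>y\<bar>} y * \<bar>y\<bar> powr r"] by simp
  also have "\<dots> \<le> (1 / n) powr r + (LINT y|p. indicator {y. n < \<bar>y\<bar>} y * \<bar>y\<bar> powr r) + n powr r * (card (range (grid n)) / m)"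
    using prob_rounding_fail by (intro add_left_mono mult_left_mono) auto
  finally show ?thesis .
qed

end


text \<open>The rounded measure depends only on finitely many integers, the rounded cell masses.
  Hence along a kernel it takes only finitely many values.\<close>

lemma rounded_eqI:
  assumes "prob_space p" "sets p = sets borel" "prob_space q" "sets q = sets borel" "n \<noteq> 0" "m \<noteq> 0"
    and eq: "\<And>z. z \<in> range (grid n) \<Longrightarrow> rounded_mass n m p z = rounded_mass n m q z"
  shows "rounded n m p = rounded n m q"
  using assms finite_range_grid
  by (intro prob_measure_eqI_finite[where Z="insert 0 (range (grid n))" and ?z0.0=0])
    (auto simp: prob_space_rounded measure_rounded_finite measure_rounded_singleton)

lemma tail_moment_tendsto_0:
  fixes h :: "real \<Rightarrow> real"
  assumes "integrable p h" and "sets p = sets borel"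
  shows "(\<lambda>n::nat. LINT y|p. indicator {y. n < \<bar>y\<bar>} y * h y) \<longlonglongrightarrow> 0"
proof -
  have hp: "h \<in> borel_measurable p" using assms by auto
  then have [measurable]: "h \<in> borel_measurable borel"
    by (simp add: measurable_cong_sets[OF assms(2) refl])
  have "(\<lambda>n::nat. LINT y|p. indicator {y. n < \<bar>y\<bar>} y * h y) \<longlonglongrightarrow> (LINT y|p. 0)"
  proof (rule integral_dominated_convergence[where w="\<lambda>y. \<bar>h y\<bar>"])
    show "integrable p (\<lambda>y. \<bar>h y\<bar>)" using assms by auto
    show "AE y in p. (\<lambda>n::nat. indicator {y::real. n < \<bar>y\<bar>} y * h y) \<longlonglongrightarrow> 0"
    proof (intro AE_I2 tendsto_eventually)
      fix y :: real
      have "eventually (\<lambda>n::nat. nat \<lceil>\<bar>y\<bar>\<rceil> \<le> n) sequentially" by (rule eventually_ge_at_top)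
      then show "\<forall>\<^sub>F n::nat in sequentially. indicator {y. n < \<bar>y\<bar>} y * h y = 0"
        by eventually_elim (auto simp: indicator_def; linarith)
    qed
    show "(\<lambda>y. indicator {y::real. n < \<bar>y\<bar>} y * h y) \<in> borel_measurable p" for n :: nat
      by (subst measurable_cong_sets[OF assms(2) refl]) measurable
  qed (use hp in \<open>auto simp: indicator_def\<close>)
  then show ?thesis by simp
qed

text \<open>For the rounded kernels the cost is measurable piece by piece, each piece being a
  constant section; by continuity of \<open>C x\<close> it converges to the cost along
  \<open>\<kappa>\<close>.\<close>

lemma borel_measurable_cost_kernel:
  assumes r: "r \<ge> 1"
    and C: "(\<lambda>(x, p). C x p) \<in> borel_measurable (borel_of (prod_topology euclidean (wasserstein_topology r)))"
    and cont: "\<And>x. continuous_map (wasserstein_topology r) euclidean (C x)"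
    and \<kappa>[measurable]: "\<kappa> \<in> borel \<rightarrow>\<^sub>M prob_algebra borel" and mom: "\<And>x. \<kappa> x \<in> prob_moment r"
  shows "(\<lambda>x::real. C x (\<kappa> x) :: real) \<in> borel_measurable borel"
proof -
  note \<kappa>D = prob_momentD[OF mom]
  \<comment> \<open>Chosen so that the loss by thinning,
    \<open>n powr r * (card (range (grid n)) / m n)\<close>, is at most \<open>1 / n\<close>; the
    added 1 keeps it nonzero.\<close>
  define m where "m n = nat \<lceil>n * (n powr r * card (range (grid n)))\<rceil> + 1" for n :: nat
  define \<rho> where "\<rho> n x = rounded n (m n) (\<kappa> x)" for n :: nat and x
  have m: "m n \<noteq> 0" for n by (simp add: m_def)
  have "(\<lambda>x. C x (\<rho> (Suc n) x)) \<in> borel_measurable borel" for n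
  proof -
    let ?n = "Suc n"
    let ?Z = "range (grid ?n)"
    define g where "g x = restrict (\<lambda>z. \<lfloor>m ?n * grid_mass ?n (\<kappa> x) z\<rfloor>) ?Z" for x
    define I where "I = ?Z \<rightarrow>\<^sub>E {0..int (m ?n)}"
    have fI: "finite I" unfolding I_def by (intro finite_PiE finite_range_grid) auto
    have gI: "g x \<in> I" for x
    proof -
      have b: "0 \<le> m ?n * grid_mass ?n (\<kappa> x) z" "m ?n * grid_mass ?n (\<kappa> x) z \<le> m ?n" for z
        using prob_space.prob_le_1[OF \<kappa>D(1)[of x]] by (auto simp: grid_mass_def mult_left_le)
      have "m ?n * grid_mass ?n (\<kappa> x) z < real (m ?n) + 1" for z
        using b(2)[of z] by linarith
      with b show ?thesis by (auto simp: g_def I_def floor_le_iff)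
    qed
    have [measurable]: "(\<lambda>x. grid_mass ?n (\<kappa> x) z) \<in> borel_measurable borel" for z
      unfolding grid_mass_def
      by (rule measurable_compose[OF \<kappa> measurable_measure_prob_algebra]) (use measurable_sets[OF measurable_grid, of "{z}" ?n] in auto)
    have gmeas: "g \<in> borel \<rightarrow>\<^sub>M count_space I"
      unfolding measurable_count_space_eq2[OF fI]
    proof (intro conjI ballI)
      fix b assume b: "b \<in> I"
      have "g -` {b} \<inter> space borel = (\<Inter>z\<in>?Z. {x \<in> space borel. \<lfloor>m ?n * grid_mass ?n (\<kappa> x) z\<rfloor> = b z})"
        using b by (auto simp: g_def I_def fun_eq_iff restrict_def PiE_def extensional_def)
      also have "\<dots> \<in> sets borel" using finite_range_grid by (intro sets.finite_INT) auto
      finally show "g -` {b} \<inter> space borel \<in> sets borel" .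
    qed (use gI in auto)
    \<comment> \<open>Any point with the vector \<open>b\<close> of rounded masses represents all of
      them, by \<open>rounded_eqI\<close>.\<close>
    define R where "R b = \<rho> ?n (SOME x. g x = b)" for b
    have "\<rho> ?n x = R (g x)" for x
    proof -
      have g: "g (SOME y. g y = g x) = g x" by (rule someI[of _ x]) simp
      show ?thesis unfolding R_def \<rho>_def
      proof (rule rounded_eqI)
        fix z assume "z \<in> ?Z"
        then show "rounded_mass ?n (m ?n) (\<kappa> x) z = rounded_mass ?n (m ?n) (\<kappa> (SOME y. g y = g x)) z"
          using fun_cong[OF g, of z] by (simp add: rounded_mass_def g_def)
      qed (use \<kappa>D m in auto)
    qed
    moreover have "(\<lambda>x. C x (R (g x))) \<in> borel_measurable borel"
    proof (rule measurable_compose_countable'[where I=I and f="\<lambda>b x. C x (R b)", OF _ gmeas])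
      fix b
      have "R b \<in> prob_moment r" unfolding R_def \<rho>_def using \<kappa>D m by (intro rounded_in_prob_moment) auto
      then have "(\<lambda>x. (x, R b)) \<in> borel \<rightarrow>\<^sub>M borel_of (prod_topology euclidean (wasserstein_topology r))"
        by (intro measurable_section_prod_topology) (simp add: topspace_wasserstein_topology)
      from measurable_compose[OF this C] show "(\<lambda>x. C x (R b)) \<in> borel_measurable borel" by simp
    qed (use fI in \<open>auto intro: countable_finite\<close>)
    ultimately show ?thesis by simp
  qed
  moreover have "(\<lambda>n. C x (\<rho> (Suc n) x)) \<longlonglongrightarrow> C x (\<kappa> x)" for x
  proof (rule LIMSEQ_I)
    fix \<epsilon> :: real assume "0 < \<epsilon>"
    from wasserstein_continuous_at[OF cont mom this, of x x] obtain \<delta>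
      where \<delta>: "\<delta> > 0" "\<And>q. q \<in> prob_moment r \<Longrightarrow> wasserstein r (\<kappa> x) q < \<delta> \<Longrightarrow> \<bar>C x q - C x (\<kappa> x)\<bar> < \<epsilon>" by auto
    define c where "c n = (1 / n) powr r + (LINT y|\<kappa> x. indicator {y. n < \<bar>y\<bar>} y * \<bar>y\<bar> powr r) + 1 / n" for n :: nat
    have "(\<lambda>n. (1 / real n) powr r) \<longlonglongrightarrow> 0 powr r"
      using lim_1_over_n r by (intro tendsto_powr2) (auto intro!: always_eventually)
    then have "c \<longlonglongrightarrow> 0 + 0 + 0" unfolding c_def
      using tail_moment_tendsto_0[OF \<kappa>D(4)[of x] \<kappa>D(2)] lim_1_over_n by (intro tendsto_add) auto
    then have "(\<lambda>n. c (Suc n)) \<longlonglongrightarrow> 0" by (simp add: LIMSEQ_Suc)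
    moreover have "0 < \<delta> powr r" using \<delta>(1) by simp
    ultimately obtain N where N: "\<And>n. N \<le> n \<Longrightarrow> c (Suc n) < \<delta> powr r"
      using order_tendstoD(2)[of "\<lambda>n. c (Suc n)" 0 sequentially "\<delta> powr r"] by (auto simp: eventually_sequentially)
    show "\<exists>no. \<forall>n\<ge>no. norm (C x (\<rho> (Suc n) x) - C x (\<kappa> x)) < \<epsilon>"
    proof (intro exI[of _ N] allI impI)
      fix n assume n: "N \<le> n"
      let ?n = "Suc n"
      have "?n * (?n powr r * card (range (grid ?n))) \<le> m ?n" unfolding m_def by linarith
      then have le: "?n powr r * (card (range (grid ?n)) / m ?n) \<le> 1 / ?n" using m[of ?n] by (simp add: field_simps)
      have "wasserstein r (\<kappa> x) (\<rho> ?n x) < \<delta>"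
      proof (rule wasserstein_less[OF _ r \<delta>(1)])
        show "distr (\<kappa> x \<Otimes>\<^sub>M U01) borel (\<lambda>y. (fst y, rounding ?n (m ?n) (\<kappa> x) y)) \<in> couplings (\<kappa> x) (\<rho> ?n x)"
          unfolding \<rho>_def using \<kappa>D m by (intro rounded_coupling) auto
        have "(LINT z|distr (\<kappa> x \<Otimes>\<^sub>M U01) borel (\<lambda>y. (fst y, rounding ?n (m ?n) (\<kappa> x) y)). \<bar>fst z - snd z\<bar> powr r)
          \<le> (1 / ?n) powr r + (LINT y|\<kappa> x. indicator {y. ?n < \<bar>y\<bar>} y * \<bar>y\<bar> powr r) + ?n powr r * (card (range (grid ?n)) / m ?n)"
          using \<kappa>D m r by (intro rounded_cost) auto
        also have "\<dots> \<le> c ?n" using le by (simp add: c_def)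
        also have "\<dots> < \<delta> powr r" using N n by simp
        finally show "(LINT z|distr (\<kappa> x \<Otimes>\<^sub>M U01) borel (\<lambda>y. (fst y, rounding ?n (m ?n) (\<kappa> x) y)). \<bar>fst z - snd z\<bar> powr r) < \<delta> powr r" .
      qed
      moreover have "\<rho> ?n x \<in> prob_moment r" unfolding \<rho>_def using \<kappa>D m by (intro rounded_in_prob_moment) auto
      ultimately show "norm (C x (\<rho> ?n x) - C x (\<kappa> x)) < \<epsilon>" using \<delta>(2) by simp
    qed
  qed
  ultimately show ?thesis by (rule borel_measurable_LIMSEQ_real[rotated])
qed

section \<open>Convex functions and displacements\<close>

lemma abs_powr_convex:
  assumes "1 \<le> r" shows "convex_on UNIV (\<lambda>y::real. \<bar>y\<bar> powr r)"
proof (rule convex_onI)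
  fix t x y :: real assume t: "0 < t" "t < 1"
  have "\<bar>(1 - t) * x + t * y\<bar> \<le> (1 - t) * \<bar>x\<bar> + t * \<bar>y\<bar>"
    using t abs_triangle_ineq[of "(1 - t) * x" "t * y"] by (simp add: abs_mult)
  then have "\<bar>(1 - t) * x + t * y\<bar> powr r \<le> ((1 - t) * \<bar>x\<bar> + t * \<bar>y\<bar>) powr r"
    using assms by (intro powr_mono2) auto
  also have "\<dots> \<le> (1 - t) * \<bar>x\<bar> powr r + t * \<bar>y\<bar> powr r"
  proof -
    have le: "u powr r \<le> u" if "0 \<le> u" "u \<le> 1" for u :: real
      using that assms powr_mono'[of 1 r u] by (cases "u = 0") auto
    \<comment> \<open>Convexity of the power function is used at nonzero arguments; if one of them
      vanishes, \<open>u powr r \<le> u\<close> on the unit interval suffices.\<close>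
    consider "x = 0" | "y = 0" | "x \<noteq> 0" "y \<noteq> 0" by blast
    then show ?thesis
    proof cases
      case 1 then show ?thesis using t le[of t] by (simp add: powr_mult mult_right_mono)
    next
      case 2 then show ?thesis using t le[of "1 - t"] by (simp add: powr_mult mult_right_mono)
    next
      case 3 then show ?thesis using convex_onD[OF powr_convex[OF assms], of t "\<bar>x\<bar>" "\<bar>y\<bar>"] t by simp
    qed
  qed
  finally show "\<bar>(1 - t) *\<^sub>R x + t *\<^sub>R y\<bar> powr r \<le> (1 - t) * \<bar>x\<bar> powr r + t * \<bar>y\<bar> powr r" by simp
qed auto

lemma abs_powr_subgradient:
  assumes "1 \<le> r" obtains s :: "real \<Rightarrow> real" where "\<And>m y. \<bar>m\<bar> powr r + s m * (y - m) \<le> \<bar>y\<bar> powr r"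
  by (rule that, rule convex_le_Inf_differential[OF abs_powr_convex[OF assms]]) auto

lemma abs_add_powr_le:
  fixes a b :: real
  assumes "0 \<le> r" shows "\<bar>a + b\<bar> powr r \<le> 2 powr r * (\<bar>a\<bar> powr r + \<bar>b\<bar> powr r)"
proof -
  have "\<bar>a + b\<bar> powr r \<le> (2 * max \<bar>a\<bar> \<bar>b\<bar>) powr r" using assms by (intro powr_mono2) auto
  also have "\<dots> = 2 powr r * max \<bar>a\<bar> \<bar>b\<bar> powr r" by (simp add: powr_mult)
  also have "\<dots> \<le> 2 powr r * (\<bar>a\<bar> powr r + \<bar>b\<bar> powr r)" by (intro mult_left_mono) (auto simp: max_def)
  finally show ?thesis .
qed

text \<open>The Huber function: the square on \<open>[-R, R]\<close>, continued linearly with slope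
  \<open>2 * R\<close>. It is convex and Lipschitz, hence integrable against every measure with a
  finite first moment, yet strictly convex on the bulk.\<close>

definition huber :: "real \<Rightarrow> real \<Rightarrow> real" where
  "huber R y = (if \<bar>y\<bar> \<le> R then y\<^sup>2 else 2 * R * \<bar>y\<bar> - R\<^sup>2)"

text \<open>\<open>2 * clamp_to R y\<close> is the derivative of \<open>huber R\<close> at
  \<open>y\<close>.\<close>

definition clamp_to :: "real \<Rightarrow> real \<Rightarrow> real" where
  "clamp_to R y = max (- R) (min R y)"

lemma measurable_huber[measurable]: "huber R \<in> borel_measurable borel"
  unfolding huber_def by measurable

lemma clamp_to_bound: "0 \<le> R \<Longrightarrow> \<bar>clamp_to R y\<bar> \<le> R"
  by (auto simp: clamp_to_def)

text \<open>The supporting lines of \<open>huber R\<close> are the tangents to the square at the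
  points \<open>s\<close>; the line at \<open>s = clamp_to R y\<close> touches at \<open>y\<close>,
  as \<open>huber_eq_clamp\<close> shows.\<close>

lemma huber_ge: "\<bar>s\<bar> \<le> R \<Longrightarrow> 2 * s * y - s\<^sup>2 \<le> huber R y"
proof (cases "\<bar>y\<bar> \<le> R")
  case True
  then show ?thesis using zero_le_power2[of "y - s"] by (simp add: huber_def power2_diff algebra_simps)
next
  case False
  assume s: "\<bar>s\<bar> \<le> R"
  have "s * y \<le> \<bar>s\<bar> * \<bar>y\<bar>" by (metis abs_ge_self abs_mult)
  moreover have "0 \<le> (R - \<bar>s\<bar>) * (2 * \<bar>y\<bar> - R - \<bar>s\<bar>)" using s False by (intro mult_nonneg_nonneg) auto
  ultimately show ?thesis using False by (simp add: huber_def power2_eq_square algebra_simps abs_mult_self_eq)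
qed

lemma huber_eq_clamp: "0 \<le> R \<Longrightarrow> huber R y = 2 * clamp_to R y * y - (clamp_to R y)\<^sup>2"
  by (auto simp: huber_def clamp_to_def max_def min_def power2_eq_square)

lemma huber_lipschitz: assumes "0 \<le> R" shows "\<bar>huber R y - huber R z\<bar> \<le> 2 * R * \<bar>y - z\<bar>"
proof -
  have *: "huber R z - huber R y \<le> 2 * R * \<bar>y - z\<bar>" for y z
  proof -
    have "huber R z - huber R y \<le> 2 * clamp_to R z * (z - y)"
      using huber_ge[OF clamp_to_bound[OF assms], of z y] huber_eq_clamp[OF assms, of z] by (simp add: algebra_simps)
    also have "\<dots> \<le> 2 * (\<bar>clamp_to R z\<bar> * \<bar>z - y\<bar>)" by (metis abs_ge_self abs_mult mult.assoc mult_left_mono zero_le_numeral)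
    also have "\<dots> \<le> 2 * (R * \<bar>z - y\<bar>)" using clamp_to_bound[OF assms, of z] by (intro mult_left_mono mult_right_mono) auto
    finally show ?thesis by (simp add: abs_minus_commute)
  qed
  show ?thesis using *[of y z] *[of z y] by (simp add: abs_le_iff abs_minus_commute)
qed

text \<open>A convex substitute for the tail of \<open>|y| powr r\<close>: it vanishes while
  \<open>|y| powr r \<le> R powr r / 2\<close> and is at least half of \<open>|y| powr r\<close>
  once \<open>|y| > R\<close>. Convexity, which a cut-off by an indicator would destroy, lets
  conditional means pass through it.\<close>

definition tail_powr :: "real \<Rightarrow> real \<Rightarrow> real \<Rightarrow> real" where
  "tail_powr r R y = max 0 (\<bar>y\<bar> powr r - R powr r / 2)"

lemma measurable_tail_powr[measurable]: "tail_powr r R \<in> borel_measurable borel"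
  unfolding tail_powr_def by measurable

lemma tail_powr_bounds: "0 \<le> tail_powr r R y" "tail_powr r R y \<le> \<bar>y\<bar> powr r"
  by (auto simp: tail_powr_def)

lemma tail_powr_subgradient:
  assumes "1 \<le> r" obtains s :: "real \<Rightarrow> real" where "\<And>m y. tail_powr r R m + s m * (y - m) \<le> tail_powr r R y"
proof -
  obtain s where s: "\<And>m y. \<bar>m\<bar> powr r + s m * (y - m) \<le> \<bar>y\<bar> powr r" using abs_powr_subgradient[OF assms] by blast
  have "tail_powr r R m + (if \<bar>m\<bar> powr r > R powr r / 2 then s m else 0) * (y - m) \<le> tail_powr r R y" for m y
    using s[of m y] by (auto simp: tail_powr_def)
  then show thesis by (rule that)
qed

text \<open>The middle bracket is the Bregman divergence of \<open>huber R\<close> between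
  \<open>y\<close> and \<open>z\<close>. If both points lie in \<open>[-R, R]\<close> it is the
  squared distance, which exceeds \<open>\<epsilon> powr (2 / r)\<close> as soon as the r-th power
  of the distance exceeds \<open>\<epsilon>\<close>; then the crude bound
  \<open>(2 * R) powr r\<close> times the quotient suffices. Otherwise the tail terms
  dominate.\<close>

lemma displacement_le:
  assumes r: "1 \<le> r" and R: "0 < R" and e: "0 < \<epsilon>"
  shows "\<bar>z - y\<bar> powr r \<le> \<epsilon> + (2 * R) powr r / \<epsilon> powr (2 / r) * (huber R y + (clamp_to R z)\<^sup>2 - 2 * clamp_to R z * y)
           + 2 powr (r + 1) * (tail_powr r R y + tail_powr r R z)"
proof -
  let ?B = "huber R y + (clamp_to R z)\<^sup>2 - 2 * clamp_to R z * y"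
  let ?c = "(2 * R) powr r / \<epsilon> powr (2 / r)"
  have B0: "0 \<le> ?B" using huber_ge[OF clamp_to_bound, of R z y] R by simp
  have c0: "0 \<le> ?c" by simp
  have t0: "0 \<le> tail_powr r R y + tail_powr r R z" using tail_powr_bounds by (simp add: add_nonneg_nonneg)
  show ?thesis
  proof (cases "\<bar>y\<bar> \<le> R \<and> \<bar>z\<bar> \<le> R")
    case True
    then have B: "?B = (z - y)\<^sup>2" by (auto simp: huber_def clamp_to_def power2_eq_square algebra_simps max_def min_def)
    have "\<bar>z - y\<bar> powr r \<le> \<epsilon> + ?c * (z - y)\<^sup>2"
    proof (cases "\<bar>z - y\<bar> powr r \<le> \<epsilon>")
      case True then show ?thesis using c0 by (smt (verit) mult_nonneg_nonneg zero_le_power2)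
    next
      case False
      have "\<epsilon> powr (2 / r) \<le> (\<bar>z - y\<bar> powr r) powr (2 / r)" using False e r by (intro powr_mono2) auto
      also have "\<dots> = (z - y)\<^sup>2" using r False e by (cases "z = y") (auto simp: powr_powr)
      finally have 1: "1 \<le> (z - y)\<^sup>2 / \<epsilon> powr (2 / r)" using e by simp
      have "\<bar>z - y\<bar> powr r \<le> (2 * R) powr r" using \<open>\<bar>y\<bar> \<le> R \<and> \<bar>z\<bar> \<le> R\<close> r by (intro powr_mono2) auto
      also have "\<dots> \<le> (2 * R) powr r * ((z - y)\<^sup>2 / \<epsilon> powr (2 / r))" using 1 by (intro mult_le_cancel_left1[THEN iffD2]) auto
      finally show ?thesis using e by simp
    qed
    then show ?thesis unfolding B using t0 by (smt (verit) mult_nonneg_nonneg powr_ge_zero)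
  next
    case False
    have tl: "R < \<bar>x\<bar> \<Longrightarrow> \<bar>x\<bar> powr r \<le> 2 * tail_powr r R x" for x
    proof -
      assume "R < \<bar>x\<bar>"
      then have "R powr r \<le> \<bar>x\<bar> powr r" using R r by (intro powr_mono2) auto
      then have "\<bar>x\<bar> powr r \<le> 2 * (\<bar>x\<bar> powr r - R powr r / 2)" by (simp add: right_diff_distrib)
      also have "\<dots> \<le> 2 * tail_powr r R x" unfolding tail_powr_def by (intro mult_left_mono max.cobounded2) simp
      finally show ?thesis .
    qed
    have "\<bar>z - y\<bar> powr r \<le> (2 * max \<bar>y\<bar> \<bar>z\<bar>) powr r" using r by (intro powr_mono2) auto
    also have "\<dots> = 2 powr r * max \<bar>y\<bar> \<bar>z\<bar> powr r" by (simp add: powr_mult)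
    also have "max \<bar>y\<bar> \<bar>z\<bar> powr r \<le> 2 * tail_powr r R (if \<bar>y\<bar> \<le> \<bar>z\<bar> then z else y)"
      using False tl[of y] tl[of z] by (auto simp: max_def)
    also have "\<dots> \<le> 2 * (tail_powr r R y + tail_powr r R z)"
      using tail_powr_bounds(1)[of r R y] tail_powr_bounds(1)[of r R z] by auto
    finally have "\<bar>z - y\<bar> powr r \<le> 2 powr r * (2 * (tail_powr r R y + tail_powr r R z))" by simp
    then have "\<bar>z - y\<bar> powr r \<le> 2 powr (r + 1) * (tail_powr r R y + tail_powr r R z)" by (simp add: powr_add algebra_simps)
    then show ?thesis using B0 c0 e by (smt (verit) mult_nonneg_nonneg)
  qed
qed

section \<open>Integration against the mixture of measures along a kernel\<close>

lemma integral_bind_kernel: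
  fixes h :: "'b \<Rightarrow> real"
  assumes K: "K \<in> M \<rightarrow>\<^sub>M subprob_algebra B" and ne: "space M \<noteq> {}" and h: "integrable (M \<bind> K) h"
  shows "AE x in M. integrable (K x) h" "integrable M (\<lambda>x. LINT y|K x. h y)"
    "(LINT y|(M \<bind> K). h y) = (LINT x|M. LINT y|K x. h y)"
proof -
  have sB: "sets (M \<bind> K) = sets B" using K ne by (rule sets_bind_measurable)
  have hB[measurable]: "h \<in> borel_measurable B"
    using borel_measurable_integrable[OF h] by (simp add: measurable_cong_sets[OF sB refl])
  have sK: "sets (K x) = sets B" if "x \<in> space M" for x using K that by (rule sets_kernel)
  have mK: "g \<in> borel_measurable (K x)" if "x \<in> space M" "g \<in> borel_measurable B" for g :: "'b \<Rightarrow> real" and x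
    using that(2) by (simp add: measurable_cong_sets[OF sK[OF that(1)] refl])
  have nonneg: "(AE x in M. integrable (K x) g) \<and> integrable M (\<lambda>x. LINT y|K x. g y) \<and>
      (LINT y|(M \<bind> K). g y) = (LINT x|M. LINT y|K x. g y)"
    if g: "integrable (M \<bind> K) g" and g0: "\<And>y. 0 \<le> g y" for g :: "'b \<Rightarrow> real"
  proof -
    have gB[measurable]: "g \<in> borel_measurable B"
      using borel_measurable_integrable[OF g] by (simp add: measurable_cong_sets[OF sB refl])
    have nn: "(\<integral>\<^sup>+x. \<integral>\<^sup>+y. g y \<partial>K x \<partial>M) = ennreal (LINT y|(M \<bind> K). g y)"
      using nn_integral_bind[OF _ K, of "\<lambda>y. ennreal (g y)"] nn_integral_eq_integral[OF g] g0 by simp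
    have m1[measurable]: "(\<lambda>x. \<integral>\<^sup>+y. g y \<partial>K x) \<in> borel_measurable M"
      by (rule measurable_compose[OF K nn_integral_measurable_subprob_algebra]) simp
    have "AE x in M. (\<integral>\<^sup>+y. g y \<partial>K x) \<noteq> \<infinity>"
      by (rule nn_integral_PInf_AE) (use nn in auto)
    then have 1: "AE x in M. integrable (K x) g"
      using AE_space by eventually_elim (auto intro!: integrableI_nonneg mK g0 simp: less_top)
    have m2[measurable]: "(\<lambda>x. LINT y|K x. g y) \<in> borel_measurable M"
      by (rule measurable_compose[OF K integral_measurable_subprob_algebra]) simp
    have "AE x in M. (\<integral>\<^sup>+y. g y \<partial>K x) = ennreal (LINT y|K x. g y)"
      using 1 by eventually_elim (intro nn_integral_eq_integral, auto simp: g0)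
    then have eq: "(\<integral>\<^sup>+x. ennreal (LINT y|K x. g y) \<partial>M) = ennreal (LINT y|(M \<bind> K). g y)"
      using nn by (subst (asm) nn_integral_cong_AE) auto
    have 2: "integrable M (\<lambda>x. LINT y|K x. g y)"
      by (rule integrableI_nonneg) (use eq g0 in auto)
    have "ennreal (LINT x|M. LINT y|K x. g y) = ennreal (LINT y|(M \<bind> K). g y)"
      unfolding eq[symmetric] using 2 g0 by (intro nn_integral_eq_integral[symmetric]) auto
    then show ?thesis using 1 2 g0 by (auto simp: ennreal_inj)
  qed
  have p: "integrable (M \<bind> K) (\<lambda>y. max 0 (h y))" "integrable (M \<bind> K) (\<lambda>y. max 0 (- h y))" using h by auto
  note P = nonneg[OF p(1)] and Q = nonneg[OF p(2)]
  have d: "h = (\<lambda>y. max 0 (h y) - max 0 (- h y))" by (auto simp: fun_eq_iff)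
  have AE: "AE x in M. integrable (K x) (\<lambda>y. max 0 (h y)) \<and> integrable (K x) (\<lambda>y. max 0 (- h y))" using P Q by auto
  then show "AE x in M. integrable (K x) h"
    by eventually_elim (subst d, auto)
  have eqK: "AE x in M. (LINT y|K x. h y) = (LINT y|K x. max 0 (h y)) - (LINT y|K x. max 0 (- h y))"
    using AE by eventually_elim (subst d, subst Bochner_Integration.integral_diff, auto)
  have m2[measurable]: "(\<lambda>x. LINT y|K x. h y) \<in> borel_measurable M"
    by (rule measurable_compose[OF K integral_measurable_subprob_algebra]) simp
  have i: "integrable M (\<lambda>x. (LINT y|K x. max 0 (h y)) - (LINT y|K x. max 0 (- h y)))" using P Q by auto
  show "integrable M (\<lambda>x. LINT y|K x. h y)"
    by (rule integrable_cong_AE_imp[OF i m2]) (use eqK in auto)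
  have "(LINT y|(M \<bind> K). h y) = (LINT y|(M \<bind> K). max 0 (h y)) - (LINT y|(M \<bind> K). max 0 (- h y))"
    by (subst (1) d) (subst Bochner_Integration.integral_diff, use p in auto)
  also have "\<dots> = (LINT x|M. (LINT y|K x. max 0 (h y)) - (LINT y|K x. max 0 (- h y)))"
    using P Q by (simp add: Bochner_Integration.integral_diff)
  also have "\<dots> = (LINT x|M. LINT y|K x. h y)"
    by (rule integral_cong_AE) (use eqK i m2 in auto)
  finally show "(LINT y|(M \<bind> K). h y) = (LINT x|M. LINT y|K x. h y)" .
qed

lemma integrable_bind_kernel:
  fixes h :: "'b \<Rightarrow> real"
  assumes K: "K \<in> M \<rightarrow>\<^sub>M subprob_algebra B" and ne: "space M \<noteq> {}" and h: "h \<in> borel_measurable B"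
    and fin: "(\<integral>\<^sup>+x. \<integral>\<^sup>+y. ennreal \<bar>h y\<bar> \<partial>K x \<partial>M) < \<infinity>"
  shows "integrable (M \<bind> K) h"
proof (rule integrableI_bounded)
  show "h \<in> borel_measurable (M \<bind> K)" using h by (simp add: measurable_cong_sets[OF sets_bind_measurable[OF K ne] refl])
  show "(\<integral>\<^sup>+y. ennreal (norm (h y)) \<partial>(M \<bind> K)) < \<infinity>"
    using fin h by (subst nn_integral_bind[OF _ K]) auto
qed

section \<open>Competitors for finitely many kernels\<close>

lemma measurable_U01_iff[simp]: "f \<in> U01 \<rightarrow>\<^sub>M N \<longleftrightarrow> f \<in> borel \<rightarrow>\<^sub>M N"
  by (rule arg_cong[OF measurable_cong_sets]) auto

lemma U01_alt: "U01 = density lborel (\<lambda>v. ennreal (indicator {0<..<1} v))"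
  by (simp add: U01_def ennreal_indicator)

lemma integral_U01: "(LINT v|U01. f v) = (LINT v:{0<..<1}|lborel. f v :: real)" if "f \<in> borel_measurable borel"
  unfolding U01_alt set_lebesgue_integral_def using that by (subst integral_density) auto

lemma integrable_U01: "integrable U01 f \<longleftrightarrow> set_integrable lborel {0<..<1} (f :: real \<Rightarrow> real)" if "f \<in> borel_measurable borel"
  unfolding U01_alt set_integrable_def using that by (subst integrable_density) auto

text \<open>The pseudo-inverse of the distribution function, extended by zero from
  \<open>{0<..<1}\<close> to a Borel function on the line.\<close>

lemma (in real_distribution) quantile_function_U01:
  obtains Q where "Q \<in> borel_measurable borel" "distr U01 borel Q = M" "mono_on {0<..<1} Q"
proof -
  interpret cdf_distribution M by unfold_locales
  define Q where "Q v = (if v \<in> {0<..<1} then I v else 0)" for v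
  have [measurable]: "Q \<in> borel_measurable borel"
    unfolding Q_def[abs_def] using measurable_CI
    by (subst measurable_restrict_space_iff[symmetric, where c=0]) auto
  have "distr U01 borel Q = distr (restrict_space lborel {0<..<1}) borel I"
  proof (rule measure_eqI)
    fix A assume "A \<in> sets (distr U01 borel Q)"
    then have [measurable]: "A \<in> sets borel" by simp
    have "emeasure (distr U01 borel Q) A = emeasure U01 (Q -` A)" by (subst emeasure_distr) auto
    also have "\<dots> = (\<integral>\<^sup>+v. indicator ({0<..<1} \<inter> Q -` A) v \<partial>lborel)"
      using measurable_sets[of Q borel borel A] unfolding U01_def
      by (subst emeasure_density) (simp_all flip: indicator_inter_arith)
    also have "\<dots> = emeasure lborel ({0<..<1} \<inter> Q -` A)"
      using measurable_sets[of Q borel borel A] by (subst nn_integral_indicator) auto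
    also have "{0<..<1} \<inter> Q -` A = I -` A \<inter> {0<..<1}" by (auto simp: Q_def)
    also have "emeasure lborel \<dots> = emeasure (restrict_space lborel {0<..<1}) (I -` A \<inter> {0<..<1})"
      by (subst emeasure_restrict_space) auto
    also have "\<dots> = emeasure (distr (restrict_space lborel {0<..<1}) borel I) A"
    proof (subst emeasure_distr)
      show "I \<in> borel_measurable (restrict_space lborel {0<..<1})"
        using measurable_CI by (simp add: measurable_def sets_restrict_space space_restrict_space)
    qed (auto simp: space_restrict_space)
    finally show "emeasure (distr U01 borel Q) A = emeasure (distr (restrict_space lborel {0<..<1}) borel I) A" .
  qed simp
  moreover have "mono_on {0<..<1} Q" using mono_I by (auto simp: mono_on_def Q_def)
  ultimately show thesis using distr_I_eq_M that by (metis \<open>Q \<in> borel_measurable borel\<close>)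
qed

text \<open>Strassen's theorem on the line for a finitely supported first marginal, in label form:
  \<open>\<beta>\<close> is the law of \<open>Q\<close> under \<open>U01\<close>, and
  \<open>(z (J v), Q v)\<close> is the martingale coupling.\<close>

lemma finite_martingale_labelling:
  assumes \<beta>: "real_distribution \<beta>" and int: "integrable \<beta> (\<lambda>y. y)"
    and I: "finite I" "\<And>i. i \<in> I \<Longrightarrow> 0 < a i" "(\<Sum>i\<in>I. a i) = 1"
    and mean: "(\<Sum>i\<in>I. a i * z i) = (LINT y|\<beta>. y)"
    and pot: "\<And>t. (\<Sum>i\<in>I. a i * max 0 (z i - t)) \<le> (LINT y|\<beta>. max 0 (y - t))"
  obtains Q J where "Q \<in> borel_measurable borel" "distr U01 borel Q = \<beta>"
    "J \<in> borel \<rightarrow>\<^sub>M count_space UNIV" "\<And>v. J v \<in> I"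
    "\<And>i. i \<in> I \<Longrightarrow> (LINT v|U01. indicator {i} (J v)) = a i"
    "\<And>i. i \<in> I \<Longrightarrow> (LINT v|U01. indicator {i} (J v) * Q v) = a i * z i"
proof -
  interpret real_distribution \<beta> by fact
  obtain Q where Q[measurable]: "Q \<in> borel_measurable borel" "distr U01 borel Q = \<beta>" "mono_on {0<..<1} Q"
    by (rule quantile_function_U01)
  have "integrable U01 Q" using int unfolding Q(2)[symmetric] by (subst (asm) integrable_distr_eq) auto
  then have iQ: "set_integrable lborel {0<..<1} Q" by (simp add: integrable_U01)
  have push: "(LINT y|\<beta>. h y) = (LINT v:{0<..<1}|lborel. h (Q v))" if [measurable]: "h \<in> borel_measurable borel" for h :: "real \<Rightarrow> real"
    unfolding Q(2)[symmetric] by (subst integral_distr) (auto simp: integral_U01)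
  have "potential_dominated a z I Q 1"
    using Q(3) iQ I(3) mean pot by (auto simp: potential_dominated_def push)
  moreover have "I \<noteq> {}" using I(3) by auto
  ultimately obtain J where J: "J \<in> borel \<rightarrow>\<^sub>M count_space UNIV" "\<And>v. J v \<in> I"
    "\<And>i. i \<in> I \<Longrightarrow> (LINT v:{0<..<1}|lborel. indicator {i} (J v)) = a i"
    "\<And>i. i \<in> I \<Longrightarrow> (LINT v:{0<..<1}|lborel. indicator {i} (J v) * Q v) = a i * z i"
    using quantile_labelling[where I=I and a=a and z=z and Q=Q and m=1] I(1,2) by blast
  have [measurable]: "(\<lambda>v. indicator {i} (J v) :: real) \<in> borel_measurable borel" for i
    by (rule measurable_compose[OF J(1)]) simp
  show thesis by (rule that[OF Q(1,2) J(1,2)]) (use J in \<open>auto simp: integral_U01\<close>)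
qed


lemma prob_moment_integrable:
  fixes h :: "real \<Rightarrow> real"
  assumes p: "p \<in> prob_moment r" and h: "h \<in> borel_measurable borel" and le: "\<And>y. \<bar>h y\<bar> \<le> A + B * \<bar>y\<bar> powr r"
  shows "integrable p h"
proof -
  note pD = prob_momentD[OF p]
  interpret prob_space p by (rule pD)
  have "integrable p (\<lambda>y. A + B * \<bar>y\<bar> powr r)" using pD(4) by simp
  then show ?thesis
  proof (rule Bochner_Integration.integrable_bound)
    show "h \<in> borel_measurable p" using h by (simp add: measurable_cong_sets[OF pD(2) refl])
    show "AE y in p. norm (h y) \<le> norm (A + B * \<bar>y\<bar> powr r)" using le by (auto intro!: AE_I2 order_trans[OF _ abs_ge_self])
  qed
qed

lemma abs_le_one_plus_powr:
  fixes y :: real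
  assumes "1 \<le> r" shows "\<bar>y\<bar> \<le> 1 + \<bar>y\<bar> powr r"
proof (cases "\<bar>y\<bar> \<le> 1")
  case False
  then have "\<bar>y\<bar> powr 1 \<le> \<bar>y\<bar> powr r" using assms by (intro powr_mono) auto
  then show ?thesis using False by simp
qed (simp add: add_increasing2)

lemma prob_moment_integrable_id:
  assumes "p \<in> prob_moment r" "1 \<le> r" shows "integrable p (\<lambda>y. y)"
  by (rule prob_moment_integrable[OF assms(1), where A=1 and B=1]) (use abs_le_one_plus_powr[OF assms(2)] in auto)

lemma prob_moment_integrable_pos_part:
  assumes "p \<in> prob_moment r" "1 \<le> r" shows "integrable p (\<lambda>y. max 0 (y - t))"
proof (rule prob_moment_integrable[OF assms(1), where A="1 + \<bar>t\<bar>" and B=1])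
  show "\<bar>max 0 (y - t)\<bar> \<le> 1 + \<bar>t\<bar> + 1 * \<bar>y\<bar> powr r" for y
    using abs_le_one_plus_powr[OF assms(2), of y] by (auto simp: max_def)
qed auto

lemma prob_moment_integrable_huber:
  assumes "p \<in> prob_moment r" "1 \<le> r" "0 \<le> R" shows "integrable p (huber R)"
proof (rule prob_moment_integrable[OF assms(1), where A="2 * R" and B="2 * R"])
  show "\<bar>huber R y\<bar> \<le> 2 * R + 2 * R * \<bar>y\<bar> powr r" for y
    using huber_lipschitz[OF assms(3), of y 0] assms(3) abs_le_one_plus_powr[OF assms(2), of y]
      mult_left_mono[of "\<bar>y\<bar>" "1 + \<bar>y\<bar> powr r" "2 * R"]
    by (simp add: huber_def[of R 0] algebra_simps)
qed auto

lemma prob_moment_integrable_tail_powr: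
  assumes "p \<in> prob_moment r" shows "integrable p (tail_powr r R)"
  by (rule prob_moment_integrable[OF assms(1), where A=0 and B=1])
    (use tail_powr_bounds in \<open>auto simp: abs_of_nonneg\<close>)

lemma prob_moment_integrable_diff_powr:
  assumes "p \<in> prob_moment r" "1 \<le> r" shows "integrable p (\<lambda>y. \<bar>y - z\<bar> powr r)"
proof (rule prob_moment_integrable[OF assms(1), where A="2 powr r * \<bar>z\<bar> powr r" and B="2 powr r"])
  show "\<bar>\<bar>y - z\<bar> powr r\<bar> \<le> 2 powr r * \<bar>z\<bar> powr r + 2 powr r * \<bar>y\<bar> powr r" for y
    using abs_add_powr_le[of r y "- z"] assms(2) by (simp add: algebra_simps)
qed auto

lemma integral_finite_cells:
  fixes F :: "nat \<Rightarrow> real" and p :: "real measure"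
  assumes p: "prob_space p" "sets p = sets borel"
    and c: "c \<in> borel \<rightarrow>\<^sub>M count_space UNIV" and cL: "\<And>y. c y < (L::nat)"
    and h: "integrable p h"
  shows "integrable p (\<lambda>y. F (c y) * h y)"
    "(LINT y|p. F (c y) * h y) = (\<Sum>l<L. F l * (LINT y|p. of_bool (c y = l) * h y))"
proof -
  have e: "F (c y) * h y = (\<Sum>l<L. F l * (of_bool (c y = l) * h y))" for y
  proof -
    have "(\<Sum>l<L. F l * (of_bool (c y = l) * h y)) = (\<Sum>l\<in>{c y}. F l * (of_bool (c y = l) * h y))"
      using cL[of y] by (intro sum.mono_neutral_right) auto
    then show ?thesis by simp
  qed
  have [measurable]: "(\<lambda>y. of_bool (c y = l) :: real) \<in> borel_measurable p" for l
    by (subst measurable_cong_sets[OF p(2) refl], rule measurable_compose[OF c, of "\<lambda>l'. of_bool (l' = l)"]) simp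
  have [measurable]: "h \<in> borel_measurable p" using h by simp
  have "integrable p (\<lambda>y. of_bool (c y = l) * h y)" for l
    by (rule Bochner_Integration.integrable_bound[OF h]) auto
  then have i: "integrable p (\<lambda>y. F l * (of_bool (c y = l) * h y))" for l by (rule integrable_mult_right)
  show "integrable p (\<lambda>y. F (c y) * h y)" by (subst e, rule Bochner_Integration.integrable_sum, rule i)
  have "(LINT y|p. F (c y) * h y) = (\<Sum>l<L. LINT y|p. F l * (of_bool (c y = l) * h y))"
    by (subst e, rule Bochner_Integration.integral_sum, rule i)
  then show "(LINT y|p. F (c y) * h y) = (\<Sum>l<L. F l * (LINT y|p. of_bool (c y = l) * h y))" by simp
qed

lemma integral_finite_cells_const:
  fixes F :: "nat \<Rightarrow> real" and p :: "real measure"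
  assumes p: "prob_space p" "sets p = sets borel"
    and c: "c \<in> borel \<rightarrow>\<^sub>M count_space UNIV" and cL: "\<And>y. c y < (L::nat)"
  shows "integrable p (\<lambda>y. F (c y))" "(LINT y|p. F (c y)) = (\<Sum>l<L. measure p {y. c y = l} * F l)"
proof -
  have "{y. c y = l} \<in> sets borel" for l using measurable_sets[OF c, of "{l}"] by (simp add: vimage_def)
  moreover have "(\<lambda>y. of_bool (c y = l) :: real) = indicator {y. c y = l}" for l by (auto simp: indicator_def fun_eq_iff)
  ultimately have 1: "(LINT y|p. of_bool (c y = l)) = measure p {y. c y = l}" for l
    using sets_eq_imp_space_eq[OF p(2)] by simp
  have "integrable p (\<lambda>_. 1 :: real)" by (rule finite_measure.integrable_const[OF prob_space.finite_measure[OF p(1)]])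
  from integral_finite_cells[OF p c cL this, of F]
  show "integrable p (\<lambda>y. F (c y))" "(LINT y|p. F (c y)) = (\<Sum>l<L. measure p {y. c y = l} * F l)"
    by (simp_all add: 1 mult.commute)
qed

text \<open>There are finitely many cells, so the union of those of measure zero is a null
  set.\<close>

lemma AE_finite_cells_pos:
  fixes p :: "real measure"
  assumes p: "prob_space p" "sets p = sets borel"
    and c: "c \<in> borel \<rightarrow>\<^sub>M count_space UNIV" and cL: "\<And>y. c y < (L::nat)"
  shows "AE y in p. 0 < measure p {y'. c y' = c y}"
proof -
  interpret P: prob_space p by (rule p)
  have "AE y in p. \<forall>l\<in>{..<L}. measure p {y'. c y' = l} = 0 \<longrightarrow> c y \<noteq> l"
  proof (rule AE_finite_allI, simp)
    fix l
    have "{y. c y = l} \<in> sets borel" using measurable_sets[OF c, of "{l}"] by (simp add: vimage_def)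
    then show "AE y in p. measure p {y'. c y' = l} = 0 \<longrightarrow> c y \<noteq> l"
      using p(2) P.prob_eq_0[of "{y. c y = l}"] by auto
  qed
  then show ?thesis
    by eventually_elim (use cL in \<open>auto simp: zero_less_measure_iff\<close>)
qed

section \<open>Splitting the average of the \<open>p i\<close> into blocks with prescribed
  barycentres\<close>

context
  fixes r :: real and N L :: nat and p p' :: "nat \<Rightarrow> real measure" and c :: "real \<Rightarrow> nat" and \<zeta> :: "nat \<Rightarrow> nat \<Rightarrow> real"
  assumes r: "1 \<le> r" and N: "0 < N"
    and p: "\<And>i. p i \<in> prob_moment r" and p': "\<And>i. p' i \<in> prob_moment r"
    and c: "c \<in> borel \<rightarrow>\<^sub>M count_space UNIV" and cL: "\<And>y. c y < L"
    and mean: "(\<Sum>i<N. LINT y|p' i. \<zeta> i (c y)) = (\<Sum>i<N. LINT y|p i. y)"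
    and pot: "\<And>t. (\<Sum>i<N. LINT y|p' i. max 0 (\<zeta> i (c y) - t)) \<le> (\<Sum>i<N. LINT y|p i. max 0 (y - t))"
begin

definition "cell_weight i l = measure (p' i) {y. c y = l}"
text \<open>Atoms are indexed by pairs instead of their positions, so that each remembers its block
  \<open>i\<close> even if positions \<open>\<zeta> i l\<close> coincide. Cells of weight zero are
  left out because the labelling asks for positive masses.\<close>

definition "atom_index = {(i, l). i < N \<and> l < L \<and> 0 < cell_weight i l}"
definition "atom_mass = (\<lambda>(i, l). cell_weight i l / N)"
definition "mixture = measure_pmf (pmf_of_set {..<N}) \<bind> p"

lemma integral_cells:
  fixes F :: "nat \<Rightarrow> real"
  shows "(LINT y|p' i. F (c y)) = (\<Sum>l<L. cell_weight i l * F l)" "integrable (p' i) (\<lambda>y. F (c y))"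
  using integral_finite_cells_const[OF prob_momentD(1,2)[OF p'[of i]] c cL, of F] by (simp_all add: cell_weight_def)

lemma cell_weight_nonneg: "0 \<le> cell_weight i l" by (simp add: cell_weight_def)

lemma finite_atom_index: "finite atom_index"
  by (rule finite_subset[of _ "{..<N} \<times> {..<L}"]) (auto simp: atom_index_def)

lemma sum_atoms: "(\<Sum>j\<in>atom_index. atom_mass j * F (fst j) (snd j)) = (\<Sum>i<N. LINT y|p' i. F i (c y)) / N"
  for F :: "nat \<Rightarrow> nat \<Rightarrow> real"
proof -
  have "(\<Sum>j\<in>atom_index. atom_mass j * F (fst j) (snd j)) = (\<Sum>j\<in>{..<N} \<times> {..<L}. atom_mass j * F (fst j) (snd j))"
    using cell_weight_nonneg
    by (intro sum.mono_neutral_left) (auto simp: atom_index_def atom_mass_def less_le)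
  also have "\<dots> = (\<Sum>i<N. \<Sum>l<L. cell_weight i l * F i l) / N"
    by (simp add: sum.cartesian_product atom_mass_def sum_divide_distrib case_prod_beta)
  finally show ?thesis by (simp add: integral_cells)
qed

lemma measurable_p: "p \<in> measure_pmf M \<rightarrow>\<^sub>M subprob_algebra borel"
  using prob_momentD[OF p] by (auto simp: measurable_def space_subprob_algebra intro: prob_space_imp_subprob_space)

lemma mixture_integral:
  fixes h :: "real \<Rightarrow> real"
  assumes h: "h \<in> borel_measurable borel" and int: "\<And>i. integrable (p i) h"
  shows "integrable mixture h" "(LINT y|mixture. h y) = (\<Sum>i<N. LINT y|p i. h y) / N"
proof -
  have fin: "(\<integral>\<^sup>+y. ennreal \<bar>h y\<bar> \<partial>p i) < top" for i using int[of i] by (simp add: integrable_iff_bounded)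
  then have "(\<Sum>i<N. \<integral>\<^sup>+y. ennreal \<bar>h y\<bar> \<partial>p i) < top" by (induction N) auto
  then have "(\<integral>\<^sup>+i. \<integral>\<^sup>+y. ennreal \<bar>h y\<bar> \<partial>p i \<partial>measure_pmf (pmf_of_set {..<N})) < \<infinity>"
    using N by (subst nn_integral_pmf_of_set) (auto simp: lessThan_empty_iff ennreal_divide_eq_top_iff less_top[symmetric])
  then show i: "integrable mixture h"
    unfolding mixture_def by (intro integrable_bind_kernel[OF measurable_p _ h]) auto
  show "(LINT y|mixture. h y) = (\<Sum>i<N. LINT y|p i. h y) / N"
    unfolding mixture_def using N integral_bind_kernel(3)[OF measurable_p _ i[unfolded mixture_def]]
    by (simp add: integral_pmf_of_set lessThan_empty_iff)
qed

lemma measure_mixture: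
  assumes "A \<in> sets borel" shows "measure mixture A = (\<Sum>i<N. measure (p i) A) / N"
proof -
  have "integrable (p i) (indicator A :: real \<Rightarrow> real)" for i
    using assms prob_momentD[OF p, of i] by (intro integrable_real_indicator) (auto simp: less_top[symmetric] prob_space.emeasure_le_1 
      intro!: finite_measure.emeasure_finite prob_space.finite_measure)
  from mixture_integral(2)[OF _ this] assms prob_momentD[OF p]
  show ?thesis by (simp add: mixture_def sets_bind_measurable[OF measurable_p])
qed

lemma sets_mixture: "sets mixture = sets borel"
  unfolding mixture_def by (rule sets_bind_measurable[OF measurable_p]) simp

lemma real_distribution_mixture: "real_distribution mixture"
proof -
  have "prob_space mixture" unfolding mixture_def
    by (rule prob_space.prob_space_bind[OF prob_space_measure_pmf _ measurable_p]) (auto intro!: AE_I2 prob_momentD[OF p])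
  then show ?thesis using sets_mixture sets_eq_imp_space_eq[OF sets_mixture]
    by (auto simp: real_distribution_def real_distribution_axioms_def)
qed

lemma mixture_labelling:
  obtains Q J where "Q \<in> borel_measurable borel" "distr U01 borel Q = mixture"
    "J \<in> borel \<rightarrow>\<^sub>M count_space UNIV" "\<And>v. J v \<in> atom_index"
    "\<And>i. i \<in> atom_index \<Longrightarrow> (LINT v|U01. indicator {i} (J v)) = atom_mass i"
    "\<And>i. i \<in> atom_index \<Longrightarrow> (LINT v|U01. indicator {i} (J v) * Q v) = atom_mass i * \<zeta> (fst i) (snd i)"
proof (rule finite_martingale_labelling[OF real_distribution_mixture _ finite_atom_index])
  note id = prob_moment_integrable_id[OF p r]
  show "integrable mixture (\<lambda>y. y)" by (rule mixture_integral(1)[OF _ id]) simp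
  show "0 < atom_mass j" if "j \<in> atom_index" for j using that N by (auto simp: atom_index_def atom_mass_def)
  show "(\<Sum>j\<in>atom_index. atom_mass j) = 1"
    using sum_atoms[of "\<lambda>_ _. 1"] N prob_space.prob_space[OF prob_momentD(1)[OF p']] by simp
  show "(\<Sum>j\<in>atom_index. atom_mass j * \<zeta> (fst j) (snd j)) = (LINT y|mixture. y)"
    using sum_atoms[of \<zeta>] mean mixture_integral(2)[OF _ id] by simp
  show "(\<Sum>j\<in>atom_index. atom_mass j * max 0 (\<zeta> (fst j) (snd j) - t)) \<le> (LINT y|mixture. max 0 (y - t))" for t
    using sum_atoms[of "\<lambda>i l. max 0 (\<zeta> i l - t)"] pot[of t]
      mixture_integral(2)[OF _ prob_moment_integrable_pos_part[OF p r], of t]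
    by (simp add: divide_right_mono)
qed (rule that)

context
  fixes Q :: "real \<Rightarrow> real" and J :: "real \<Rightarrow> nat \<times> nat"
  assumes Q[measurable]: "Q \<in> borel_measurable borel" and distr_Q: "distr U01 borel Q = mixture"
    and J[measurable]: "J \<in> borel \<rightarrow>\<^sub>M count_space UNIV" and J_in: "\<And>v. J v \<in> atom_index"
    and J_mass: "\<And>i. i \<in> atom_index \<Longrightarrow> (LINT v|U01. indicator {i} (J v)) = atom_mass i"
    and J_mean: "\<And>i. i \<in> atom_index \<Longrightarrow> (LINT v|U01. indicator {i} (J v) * Q v) = atom_mass i * \<zeta> (fst i) (snd i)"
begin

interpretation U: prob_space U01 by (rule prob_space_U01)

lemma measurable_label[measurable]: "(\<lambda>v. F (J v)) \<in> borel_measurable borel" for F :: "nat \<times> nat \<Rightarrow> 'a::topological_space"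
  by (rule measurable_compose[OF J]) simp

lemma integral_Q:
  fixes h :: "real \<Rightarrow> real"
  assumes "h \<in> borel_measurable borel" "integrable mixture h"
  shows "integrable U01 (\<lambda>v. h (Q v))" "(LINT v|U01. h (Q v)) = (LINT y|mixture. h y)"
  using assms unfolding distr_Q[symmetric] by (auto simp: integrable_distr_eq integral_distr)

lemma Q_integrable: "integrable U01 Q"
  by (rule integral_Q(1)[OF _ mixture_integral(1)[OF _ prob_moment_integrable_id[OF p r]]]) auto

lemma label_integral:
  fixes F :: "nat \<times> nat \<Rightarrow> real"
  shows "integrable U01 (\<lambda>v. F (J v))" "(LINT v|U01. F (J v)) = (\<Sum>j\<in>atom_index. atom_mass j * F j)"
    "integrable U01 (\<lambda>v. F (J v) * Q v)"
    "(LINT v|U01. F (J v) * Q v) = (\<Sum>j\<in>atom_index. atom_mass j * (F j * \<zeta> (fst j) (snd j)))"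
proof -
  have e: "F (J v) = (\<Sum>j\<in>atom_index. F j * indicator {j} (J v))" for v
  proof -
    have "(\<Sum>j\<in>atom_index. F j * indicator {j} (J v)) = (\<Sum>j\<in>{J v}. F j * indicator {j} (J v))"
      using J_in[of v] finite_atom_index by (intro sum.mono_neutral_right) (auto simp: indicator_def)
    then show ?thesis by simp
  qed
  have i1: "integrable U01 (\<lambda>v. indicator {j} (J v) :: real)" for j
    by (rule U.integrable_const_bound[where B=1]) (auto simp: indicator_def)
  have i2: "integrable U01 (\<lambda>v. indicator {j} (J v) * Q v)" for j
    by (rule Bochner_Integration.integrable_bound[OF Q_integrable]) (auto simp: indicator_def)
  have i1': "integrable U01 (\<lambda>v. F j * indicator {j} (J v))" for j using i1 by (rule integrable_mult_right)
  have i2': "integrable U01 (\<lambda>v. F j * (indicator {j} (J v) * Q v))" for j using i2 by (rule integrable_mult_right)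
  have e2: "F (J v) * Q v = (\<Sum>j\<in>atom_index. F j * (indicator {j} (J v) * Q v))" for v
    by (subst e) (simp only: sum_distrib_right mult.assoc)
  show "integrable U01 (\<lambda>v. F (J v))" by (subst e, rule Bochner_Integration.integrable_sum, rule i1')
  show "integrable U01 (\<lambda>v. F (J v) * Q v)" by (subst e2, rule Bochner_Integration.integrable_sum, rule i2')
  have "(LINT v|U01. F (J v)) = (\<Sum>j\<in>atom_index. LINT v|U01. F j * indicator {j} (J v))"
    by (subst e, rule Bochner_Integration.integral_sum, rule i1')
  also have "\<dots> = (\<Sum>j\<in>atom_index. atom_mass j * F j)"
    by (intro sum.cong refl) (simp add: J_mass mult.commute)
  finally show "(LINT v|U01. F (J v)) = (\<Sum>j\<in>atom_index. atom_mass j * F j)" .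
  have "(LINT v|U01. F (J v) * Q v) = (\<Sum>j\<in>atom_index. LINT v|U01. F j * (indicator {j} (J v) * Q v))"
    by (subst e2, rule Bochner_Integration.integral_sum, rule i2')
  also have "\<dots> = (\<Sum>j\<in>atom_index. atom_mass j * (F j * \<zeta> (fst j) (snd j)))"
    by (intro sum.cong refl) (simp add: J_mean)
  finally show "(LINT v|U01. F (J v) * Q v) = (\<Sum>j\<in>atom_index. atom_mass j * (F j * \<zeta> (fst j) (snd j)))" .
qed

text \<open>The labels of one block have total mass \<open>1 / N\<close>, distributed over the cells
  in the proportions of \<open>p' i\<close>.\<close>

lemma label_block:
  assumes "i < N"
  shows "(LINT v|U01. of_bool (fst (J v) = i) * F (snd (J v))) = (LINT y|p' i. F (c y)) / N" (is ?A)
    "(LINT v|U01. of_bool (fst (J v) = i) * Q v) = (LINT y|p' i. \<zeta> i (c y)) / N" (is ?B)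
proof -
  have s: "(\<Sum>i'<N. LINT y|p' i'. of_bool (i' = i) * G i' (c y)) = (LINT y|p' i. G i (c y))" for G :: "nat \<Rightarrow> nat \<Rightarrow> real"
  proof -
    have "(\<Sum>i'<N. LINT y|p' i'. of_bool (i' = i) * G i' (c y)) = (\<Sum>i'\<in>{i}. LINT y|p' i'. of_bool (i' = i) * G i' (c y))"
      using assms by (intro sum.mono_neutral_right) auto
    then show ?thesis by simp
  qed
  show ?A using label_integral(2)[of "\<lambda>j. of_bool (fst j = i) * F (snd j)"]
      sum_atoms[of "\<lambda>i' l. of_bool (i' = i) * F l"] s[of "\<lambda>_. F"] by simp
  show ?B using label_integral(4)[of "\<lambda>j. of_bool (fst j = i)"]
      sum_atoms[of "\<lambda>i' l. of_bool (i' = i) * \<zeta> i' l"] s[of \<zeta>] by simp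
qed

text \<open>The conditional law of \<open>Q\<close> given that the label lies in block
  \<open>i\<close>; the factor \<open>N\<close> normalises the mass \<open>1 / N\<close> of the
  block. These laws become the competitors.\<close>

definition "component i = distr (density U01 (\<lambda>v. ennreal (N * of_bool (fst (J v) = i)))) borel Q"

lemma component_integral:
  fixes h :: "real \<Rightarrow> real"
  assumes [measurable]: "h \<in> borel_measurable borel"
  shows "integrable (component i) h \<longleftrightarrow> integrable U01 (\<lambda>v. N * of_bool (fst (J v) = i) * h (Q v))"
    "(LINT y|component i. h y) = N * (LINT v|U01. of_bool (fst (J v) = i) * h (Q v))"
proof -
  have [measurable]: "(\<lambda>v. real N * of_bool (fst (J v) = i)) \<in> borel_measurable U01"
    using measurable_label[of "\<lambda>j. real N * of_bool (fst j = i)"] by simp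
  show "integrable (component i) h \<longleftrightarrow> integrable U01 (\<lambda>v. N * of_bool (fst (J v) = i) * h (Q v))"
    unfolding component_def by (subst integrable_distr_eq) (auto simp: integrable_density)
  show "(LINT y|component i. h y) = N * (LINT v|U01. of_bool (fst (J v) = i) * h (Q v))"
    unfolding component_def by (subst integral_distr) (auto simp: integral_density mult.assoc)
qed

lemma integral_pow_Q: "integrable U01 (\<lambda>v. \<bar>Q v\<bar> powr r)"
  by (rule integral_Q(1)[OF _ mixture_integral(1)]) (auto intro: prob_momentD[OF p])

lemma component_mixture_nn:
  assumes "i < N" shows "(\<integral>\<^sup>+v. ennreal (N * of_bool (fst (J v) = i)) \<partial>U01) = 1"
proof -
  have "(LINT v|U01. of_bool (fst (J v) = i)) = 1 / N"
    using label_block(1)[OF assms, of "\<lambda>_. 1"] prob_space.prob_space[OF prob_momentD(1)[OF p'[of i]]] by simp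
  then have "(LINT v|U01. N * of_bool (fst (J v) = i)) = 1" using N by simp
  moreover have "integrable U01 (\<lambda>v. N * of_bool (fst (J v) = i))"
    using label_integral(1)[of "\<lambda>j. N * of_bool (fst j = i)"] by simp
  ultimately show ?thesis by (subst nn_integral_eq_integral) auto
qed

lemma component_in_prob_moment:
  assumes "i < N" shows "component i \<in> prob_moment r"
proof (rule prob_momentI)
  have [measurable]: "(\<lambda>v. real N * of_bool (fst (J v) = i)) \<in> borel_measurable U01"
    using measurable_label[of "\<lambda>j. real N * of_bool (fst j = i)"] by simp
  have "emeasure (density U01 (\<lambda>v. ennreal (N * of_bool (fst (J v) = i)))) UNIV = 1"
    using component_mixture_nn[OF assms] by (subst emeasure_density) auto
  then have "prob_space (density U01 (\<lambda>v. ennreal (N * of_bool (fst (J v) = i))))" by (intro prob_spaceI) simp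
  then show "prob_space (component i)" unfolding component_def by (rule prob_space.prob_space_distr) simp
  show "sets (component i) = sets borel" by (simp add: component_def)
  have "integrable U01 (\<lambda>v. N * \<bar>Q v\<bar> powr r)" using integral_pow_Q by simp
  then have "integrable U01 (\<lambda>v. N * of_bool (fst (J v) = i) * \<bar>Q v\<bar> powr r)"
    by (rule Bochner_Integration.integrable_bound) (auto intro!: borel_measurable_times)
  then show "integrable (component i) (\<lambda>y. \<bar>y\<bar> powr r)" by (subst component_integral) auto
qed

lemma sum_blocks: "(\<Sum>i<N. of_bool (fst (J v) = i)) = (1::real)"
proof -
  have "(\<Sum>i<N. of_bool (fst (J v) = i)) = (\<Sum>i\<in>{fst (J v)}. of_bool (fst (J v) = i) :: real)"
    using J_in[of v] by (intro sum.mono_neutral_right) (auto simp: atom_index_def)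
  then show ?thesis by simp
qed

lemma sum_block_integrals:
  assumes "integrable U01 h" shows "(\<Sum>i<N. LINT v|U01. of_bool (fst (J v) = i) * h v) = (LINT v|U01. h v :: real)"
proof -
  have hm: "h \<in> borel_measurable borel" using borel_measurable_integrable[OF assms] by simp
  have "integrable U01 (\<lambda>v. of_bool (fst (J v) = i) * h v)" for i
    using hm measurable_label[of "\<lambda>j. of_bool (fst j = i) :: real"]
    by (intro Bochner_Integration.integrable_bound[OF assms]) auto
  then have "(\<Sum>i<N. LINT v|U01. of_bool (fst (J v) = i) * h v) = (LINT v|U01. (\<Sum>i<N. of_bool (fst (J v) = i) * h v))"
    by (subst Bochner_Integration.integral_sum) auto
  also have "\<dots> = (LINT v|U01. h v)" by (simp only: sum_distrib_right[symmetric] sum_blocks mult_1)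
  finally show ?thesis .
qed

text \<open>The blocks partition the labels, so the components add up to \<open>N\<close> times the
  law of \<open>Q\<close>, that is, \<open>N\<close> times the mixture of the
  \<open>p i\<close>.\<close>

lemma measure_components:
  assumes A: "A \<in> sets borel" shows "(\<Sum>i<N. measure (component i) A) = (\<Sum>i<N. measure (p i) A)"
proof -
  have [measurable]: "(\<lambda>v. indicator A (Q v) :: real) \<in> borel_measurable borel"
    by (rule measurable_compose[OF Q]) (use A in simp)
  have "integrable U01 (\<lambda>v. indicator A (Q v) :: real)"
  proof (rule U.integrable_const_bound[where B=1])
    show "AE v in U01. norm (indicator A (Q v) :: real) \<le> 1" by (auto simp: indicator_def)
  qed simp
  note s = sum_block_integrals[OF this]
  have "(LINT v|U01. indicator A (Q v) :: real) = (LINT y|mixture. indicator A y)"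
    unfolding distr_Q[symmetric] using A by (subst integral_distr) auto
  also have "\<dots> = measure mixture A" using sets_mixture sets_eq_imp_space_eq[OF sets_mixture] A by simp
  finally have 1: "(LINT v|U01. indicator A (Q v) :: real) = measure mixture A" .
  have "measure (component i) A = (LINT y|component i. indicator A y)" for i
    using A by (simp add: component_def)
  also have "\<dots> i = N * (LINT v|U01. of_bool (fst (J v) = i) * indicator A (Q v))" for i
    using A by (intro component_integral(2)) simp
  finally show ?thesis using s 1 measure_mixture[OF A] N by (simp flip: sum_distrib_left)
qed

text \<open>Given its label, \<open>Q\<close> has mean \<open>\<zeta>\<close>; averaging over the
  labels of block \<open>i\<close> gives the mean of the atoms of that block.\<close>

lemma component_mean:
  assumes "i < N" shows "(LINT y|component i. y) = (LINT y|p' i. \<zeta> i (c y))"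
  using component_integral(2)[of "\<lambda>y. y" i] label_block(2)[OF assms] N by simp

text \<open>The density, with respect to \<open>p' i \<Otimes> U01\<close>, of the gluing of two couplings along the cells.\<close>

definition "glue_weight i y v = (\<Sum>l<L. ennreal (of_bool (c y = l)) * ennreal (of_bool (J v = (i, l)) / atom_mass (i, l)))"

lemma cell_measurable[measurable]: "(\<lambda>y. F (c y)) \<in> borel_measurable borel" for F :: "nat \<Rightarrow> 'a::topological_space"
  by (rule measurable_compose[OF c]) simp

lemma measurable_glue_weight[measurable]:
  "(\<lambda>x. glue_weight i (fst x) (snd x)) \<in> borel_measurable (borel \<Otimes>\<^sub>M borel)"
proof -
  have [measurable]: "(\<lambda>y. ennreal (of_bool (c y = l))) \<in> borel_measurable borel" for l
    using cell_measurable[of "\<lambda>l'. ennreal (of_bool (l' = l))"] by simp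
  have [measurable]: "(\<lambda>v. ennreal (of_bool (J v = (i, l)) / atom_mass (i, l))) \<in> borel_measurable borel" for l
    using measurable_label[of "\<lambda>j. ennreal (of_bool (j = (i, l)) / atom_mass (i, l))"] by simp
  show ?thesis unfolding glue_weight_def by measurable
qed

lemma glue_weight_eq: "glue_weight i y v = ennreal (of_bool (J v = (i, c y)) / atom_mass (i, c y))"
proof -
  have "glue_weight i y v = (\<Sum>l\<in>{c y}. ennreal (of_bool (c y = l)) * ennreal (of_bool (J v = (i, l)) / atom_mass (i, l)))"
    unfolding glue_weight_def using cL[of y] by (intro sum.mono_neutral_right) auto
  then show ?thesis by simp
qed

lemma measurable_glue_weight_label[measurable]: "glue_weight i y \<in> borel_measurable borel"
  using measurable_label[of "\<lambda>j. ennreal (of_bool (j = (i, c y)) / atom_mass (i, c y))"]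
  by (simp add: glue_weight_eq[abs_def])

lemma measurable_glue_weight_cell[measurable]: "(\<lambda>y. glue_weight i y v) \<in> borel_measurable borel"
  using cell_measurable[of "\<lambda>l. ennreal (of_bool (J v = (i, l)) / atom_mass (i, l))"]
  by (simp add: glue_weight_eq)

text \<open>For fixed \<open>y\<close> the weight is the density of \<open>v\<close> conditioned to
  carry the label \<open>(i, c y)\<close>. A cell of weight zero has no label, whence the second
  hypothesis.\<close>

lemma glue_weight_integral_label:
  assumes "i < N" "0 < cell_weight i (c y)"
  shows "(\<integral>\<^sup>+v. glue_weight i y v \<partial>U01) = 1"
proof -
  have j: "(i, c y) \<in> atom_index" using assms cL by (simp add: atom_index_def)
  have pos: "0 < atom_mass (i, c y)" using assms N by (simp add: atom_mass_def)
  have [measurable]: "(\<lambda>v. of_bool (J v = (i, c y)) / atom_mass (i, c y)) \<in> borel_measurable borel"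
    using measurable_label[of "\<lambda>j. of_bool (j = (i, c y)) / atom_mass (i, c y)"] by simp
  have "(LINT v|U01. of_bool (J v = (i, c y)) / atom_mass (i, c y)) = 1"
    using J_mass[OF j] pos by (simp add: indicator_def)
  moreover have "integrable U01 (\<lambda>v. of_bool (J v = (i, c y)) / atom_mass (i, c y))"
    using label_integral(1)[of "\<lambda>j. of_bool (j = (i, c y)) / atom_mass (i, c y)"] by simp
  ultimately show ?thesis unfolding glue_weight_eq using pos by (subst nn_integral_eq_integral) auto
qed

text \<open>For \<open>v\<close> with label \<open>(i, l)\<close> the integral is
  \<open>cell_weight i l / atom_mass (i, l)\<close>, which is \<open>N\<close>; labels of other
  blocks contribute nothing.\<close>

lemma glue_weight_integral_cell:
  assumes "i < N"
  shows "(\<integral>\<^sup>+y. glue_weight i y v \<partial>p' i) = ennreal (N * of_bool (fst (J v) = i))"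
proof -
  interpret P: prob_space "p' i" by (rule prob_momentD[OF p'])
  have eq: "glue_weight i y v = ennreal (of_bool (fst (J v) = i) / atom_mass (J v) * of_bool (c y = snd (J v)))" for y
    unfolding glue_weight_eq by (cases "J v = (i, c y)") auto
  have int: "integrable (p' i) (\<lambda>y. of_bool (fst (J v) = i) / atom_mass (J v) * of_bool (c y = snd (J v)))"
    using integral_cells(2)[of i "\<lambda>l. of_bool (fst (J v) = i) / atom_mass (J v) * of_bool (l = snd (J v))"] by simp
  have "0 < atom_mass (J v)" using J_in[of v] N by (auto simp: atom_index_def atom_mass_def)
  then have "(\<integral>\<^sup>+y. glue_weight i y v \<partial>p' i) = ennreal (LINT y|p' i. of_bool (fst (J v) = i) / atom_mass (J v) * of_bool (c y = snd (J v)))"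
    unfolding eq by (intro nn_integral_eq_integral int) auto
  also have "(LINT y|p' i. of_bool (fst (J v) = i) / atom_mass (J v) * of_bool (c y = snd (J v)))
      = of_bool (fst (J v) = i) / atom_mass (J v) * cell_weight i (snd (J v))"
  proof -
    have "snd (J v) < L" using J_in[of v] by (auto simp: atom_index_def)
    then have "(LINT y|p' i. of_bool (c y = snd (J v))) = cell_weight i (snd (J v))"
      using integral_cells(1)[of i "\<lambda>l. of_bool (l = snd (J v))"]
      by (simp add: of_bool_def if_distrib sum.delta cong: if_cong)
    then show ?thesis by simp
  qed
  also have "\<dots> = N * of_bool (fst (J v) = i)"
    using J_in[of v] N by (auto simp: atom_index_def atom_mass_def)
  finally show ?thesis .
qed

lemma AE_cell_weight_pos: "AE y in p' i. 0 < cell_weight i (c y)"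
  unfolding cell_weight_def by (rule AE_finite_cells_pos[OF prob_momentD(1,2)[OF p'] c cL])

text \<open>Under this law \<open>v\<close> carries the label of the cell of \<open>y\<close>, so
  both \<open>y\<close> and \<open>Q v\<close> can be compared with the same atom
  \<open>\<zeta> i (c y)\<close>.\<close>

definition "glued i = distr (density (p' i \<Otimes>\<^sub>M U01) (\<lambda>x. glue_weight i (fst x) (snd x))) borel (\<lambda>x. (fst x, Q (snd x)))"

text \<open>Sums of a function of \<open>y\<close> and a function of \<open>v\<close> cover every
  later use: with one summand zero they give the two marginals, with both present the cost.\<close>

lemma glued_nn_integral:
  assumes i: "i < N" and [measurable]: "f \<in> borel_measurable borel" "g \<in> borel_measurable borel"
  shows "(\<integral>\<^sup>+x. glue_weight i (fst x) (snd x) * (f (fst x) + g (snd x)) \<partial>(p' i \<Otimes>\<^sub>M U01))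
    = (\<integral>\<^sup>+y. f y \<partial>p' i) + (\<integral>\<^sup>+v. ennreal (N * of_bool (fst (J v) = i)) * g v \<partial>U01)"
proof -
  interpret P: prob_space "p' i" by (rule prob_momentD[OF p'])
  interpret PU: pair_prob_space "p' i" U01 by unfold_locales
  note sp[measurable_cong] = prob_momentD(2)[OF p', of i]
  have [measurable]: "(\<lambda>x. glue_weight i (fst x) (snd x)) \<in> borel_measurable (p' i \<Otimes>\<^sub>M U01)"
    using measurable_glue_weight by (simp add: measurable_cong_sets[OF sets_pair_measure_cong[OF sp sets_U01] refl])
  have fg[measurable]: "(\<lambda>x. f (fst x)) \<in> borel_measurable (p' i \<Otimes>\<^sub>M U01)" "(\<lambda>x. g (snd x)) \<in> borel_measurable (p' i \<Otimes>\<^sub>M U01)"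
    by (simp_all add: measurable_cong_sets[OF sets_pair_measure_cong[OF sp sets_U01] refl])
  have "(\<integral>\<^sup>+x. glue_weight i (fst x) (snd x) * (f (fst x) + g (snd x)) \<partial>(p' i \<Otimes>\<^sub>M U01))
    = (\<integral>\<^sup>+x. glue_weight i (fst x) (snd x) * f (fst x) \<partial>(p' i \<Otimes>\<^sub>M U01)) + (\<integral>\<^sup>+x. glue_weight i (fst x) (snd x) * g (snd x) \<partial>(p' i \<Otimes>\<^sub>M U01))"
    unfolding distrib_left by (rule nn_integral_add) measurable
  also have "(\<integral>\<^sup>+x. glue_weight i (fst x) (snd x) * f (fst x) \<partial>(p' i \<Otimes>\<^sub>M U01)) = (\<integral>\<^sup>+y. \<integral>\<^sup>+v. glue_weight i y v * f y \<partial>U01 \<partial>p' i)"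
    by (subst U.nn_integral_fst[symmetric]) auto
  also have "\<dots> = (\<integral>\<^sup>+y. f y \<partial>p' i)"
  proof (rule nn_integral_cong_AE)
    show "AE y in p' i. (\<integral>\<^sup>+v. glue_weight i y v * f y \<partial>U01) = f y"
      using AE_cell_weight_pos[of i] by eventually_elim
        (subst nn_integral_multc, auto simp: glue_weight_integral_label[OF i])
  qed
  also have "(\<integral>\<^sup>+x. glue_weight i (fst x) (snd x) * g (snd x) \<partial>(p' i \<Otimes>\<^sub>M U01)) = (\<integral>\<^sup>+v. \<integral>\<^sup>+y. glue_weight i y v * g v \<partial>p' i \<partial>U01)"
    by (subst PU.nn_integral_snd[symmetric]) auto
  also have "\<dots> = (\<integral>\<^sup>+v. ennreal (N * of_bool (fst (J v) = i)) * g v \<partial>U01)"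
    by (intro nn_integral_cong, subst nn_integral_multc) (auto simp: glue_weight_integral_cell[OF i] measurable_cong_sets[OF sp refl])
  finally show ?thesis .
qed

lemma measurable_pair_p': "f \<in> (p' i \<Otimes>\<^sub>M U01) \<rightarrow>\<^sub>M M \<longleftrightarrow> f \<in> (borel \<Otimes>\<^sub>M borel) \<rightarrow>\<^sub>M M"
  by (rule arg_cong[OF measurable_cong_sets]) (auto intro!: sets_pair_measure_cong prob_momentD(2)[OF p'])

lemma glue_map_measurable[measurable]: "(\<lambda>x::real \<times> real. (fst x, Q (snd x))) \<in> (borel \<Otimes>\<^sub>M borel) \<rightarrow>\<^sub>M borel"
  by (rule borel_measurable_Pair) measurable

lemma nn_integral_glued:
  assumes [measurable]: "h \<in> borel_measurable borel"
  shows "(\<integral>\<^sup>+z. h z \<partial>glued i) = (\<integral>\<^sup>+x. glue_weight i (fst x) (snd x) * h (fst x, Q (snd x)) \<partial>(p' i \<Otimes>\<^sub>M U01))"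
  unfolding glued_def
  by (subst nn_integral_distr, simp add: measurable_pair_p', simp, subst nn_integral_density)
    (auto simp: measurable_pair_p' intro!: measurable_compose[OF glue_map_measurable])

lemma glued_coupling:
  assumes i: "i < N" shows "glued i \<in> couplings (p' i) (component i)"
proof -
  have sg: "sets (glued i) = sets borel" by (simp add: glued_def)
  have [measurable]: "fst \<in> borel_measurable (borel :: (real \<times> real) measure)" "snd \<in> borel_measurable (borel :: (real \<times> real) measure)"
    by (subst borel_prod[symmetric], measurable)+
  have mg: "f \<in> glued i \<rightarrow>\<^sub>M M \<longleftrightarrow> f \<in> borel \<rightarrow>\<^sub>M M" for f :: "real \<times> real \<Rightarrow> 'z" and M
    by (rule arg_cong[OF measurable_cong_sets]) (auto simp: sg)
  have 1: "distr (glued i) borel fst = p' i"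
  proof (rule measure_eqI)
    fix A assume "A \<in> sets (distr (glued i) borel fst)"
    then have [measurable]: "A \<in> sets borel" by simp
    have "emeasure (distr (glued i) borel fst) A = (\<integral>\<^sup>+z. indicator A z \<partial>distr (glued i) borel fst)" by simp
    also have "\<dots> = (\<integral>\<^sup>+z. indicator A (fst z) \<partial>glued i)" by (subst nn_integral_distr) (auto simp: mg)
    also have "\<dots> = (\<integral>\<^sup>+x. glue_weight i (fst x) (snd x) * (indicator A (fst x) + 0) \<partial>(p' i \<Otimes>\<^sub>M U01))"
      by (subst nn_integral_glued) auto
    also have "\<dots> = (\<integral>\<^sup>+y. indicator A y \<partial>p' i)" using glued_nn_integral[OF i, of "indicator A" "\<lambda>_. 0"] by simp
    finally show "emeasure (distr (glued i) borel fst) A = emeasure (p' i) A" by (simp add: prob_momentD[OF p'])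
  qed (simp add: prob_momentD[OF p'])
  have 2: "distr (glued i) borel snd = component i"
  proof (rule measure_eqI)
    fix A assume "A \<in> sets (distr (glued i) borel snd)"
    then have [measurable]: "A \<in> sets borel" by simp
    have [measurable]: "(\<lambda>v. indicator A (Q v) :: ennreal) \<in> borel_measurable borel" by measurable
    have [measurable]: "(\<lambda>v. ennreal (N * of_bool (fst (J v) = i))) \<in> borel_measurable borel"
      using measurable_label[of "\<lambda>j. ennreal (N * of_bool (fst j = i))"] by simp
    have "emeasure (distr (glued i) borel snd) A = (\<integral>\<^sup>+z. indicator A z \<partial>distr (glued i) borel snd)" by simp
    also have "\<dots> = (\<integral>\<^sup>+z. indicator A (snd z) \<partial>glued i)" by (subst nn_integral_distr) (auto simp: mg)
    also have "\<dots> = (\<integral>\<^sup>+x. glue_weight i (fst x) (snd x) * (0 + indicator A (Q (snd x))) \<partial>(p' i \<Otimes>\<^sub>M U01))"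
      by (subst nn_integral_glued) auto
    also have "\<dots> = (\<integral>\<^sup>+v. ennreal (N * of_bool (fst (J v) = i)) * indicator A (Q v) \<partial>U01)"
      using glued_nn_integral[OF i, of "\<lambda>_. 0" "\<lambda>v. indicator A (Q v)"] by simp
    also have "\<dots> = (\<integral>\<^sup>+y. indicator A y \<partial>component i)"
      unfolding component_def by (subst nn_integral_distr, simp, simp, subst nn_integral_density) auto
    finally show "emeasure (distr (glued i) borel snd) A = emeasure (component i) A" by (simp add: component_def)
  qed (simp add: component_def)
  have "prob_space (distr (glued i) borel fst)" unfolding 1 by (rule prob_momentD[OF p'])
  then have "prob_space (glued i)" by (rule prob_space_distrD[rotated]) (simp add: mg)
  then show ?thesis using 1 2 sg by (simp add: couplings_def)
qed

definition "label_value v = \<zeta> (fst (J v)) (snd (J v))"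

lemma measurable_label_value[measurable]: "label_value \<in> borel_measurable borel"
  using measurable_label[of "\<lambda>j. \<zeta> (fst j) (snd j)"] by (simp add: label_value_def[abs_def])

lemma displacement_integrable: "integrable U01 (\<lambda>v. \<bar>label_value v - Q v\<bar> powr r)"
proof -
  have "integrable U01 (\<lambda>v. 2 powr r * (\<bar>label_value v\<bar> powr r + \<bar>Q v\<bar> powr r))"
    using label_integral(1)[of "\<lambda>j. \<bar>\<zeta> (fst j) (snd j)\<bar> powr r"] integral_pow_Q by (simp add: label_value_def)
  then show ?thesis
    by (rule Bochner_Integration.integrable_bound)
      (use abs_add_powr_le[of r "label_value v" "- Q v" for v] r in auto)
qed

text \<open>The common atom serves as intermediate point: the first term moves \<open>p' i\<close>
  to its atoms, the second moves the atoms to \<open>Q\<close>.\<close>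

lemma glued_cost:
  assumes i: "i < N"
  shows "integrable (glued i) (\<lambda>z. \<bar>fst z - snd z\<bar> powr r)" (is ?int)
    "(LINT z|glued i. \<bar>fst z - snd z\<bar> powr r) \<le> 2 powr r * ((LINT y|p' i. \<bar>y - \<zeta> i (c y)\<bar> powr r)
      + N * (LINT v|U01. of_bool (fst (J v) = i) * \<bar>label_value v - Q v\<bar> powr r))" (is "?d \<le> ?B")
proof -
  have [measurable]: "fst \<in> borel_measurable (borel :: (real \<times> real) measure)" "snd \<in> borel_measurable (borel :: (real \<times> real) measure)"
    by (subst borel_prod[symmetric], measurable)+
  have m\<zeta>[measurable]: "(\<lambda>y. \<zeta> i (c y)) \<in> borel_measurable borel" by (rule cell_measurable)
  define f where "f y = ennreal (2 powr r * \<bar>y - \<zeta> i (c y)\<bar> powr r)" for y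
  define g where "g v = ennreal (2 powr r * \<bar>label_value v - Q v\<bar> powr r)" for v
  have [measurable]: "f \<in> borel_measurable borel" "g \<in> borel_measurable borel" unfolding f_def g_def by measurable
  have int1: "integrable (p' i) (\<lambda>y. 2 powr r * \<bar>y - \<zeta> i (c y)\<bar> powr r)"
  proof -
    have "integrable (p' i) (\<lambda>y. 2 powr r * (\<bar>y\<bar> powr r + \<bar>\<zeta> i (c y)\<bar> powr r))"
      using prob_momentD(4)[OF p', of i] integral_cells(2)[of i "\<lambda>l. \<bar>\<zeta> i l\<bar> powr r"] by simp
    then have "integrable (p' i) (\<lambda>y. \<bar>y - \<zeta> i (c y)\<bar> powr r)"
      using abs_add_powr_le[of r "y" "- \<zeta> i (c y)" for y] r
      by (elim Bochner_Integration.integrable_bound) (auto simp: measurable_cong_sets[OF prob_momentD(2)[OF p'] refl])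
    then show ?thesis by simp
  qed
  have int2: "integrable U01 (\<lambda>v. N * of_bool (fst (J v) = i) * (2 powr r * \<bar>label_value v - Q v\<bar> powr r))"
  proof -
    have "integrable U01 (\<lambda>v. N * 2 powr r * \<bar>label_value v - Q v\<bar> powr r)" using displacement_integrable by simp
    then show ?thesis using measurable_label[of "\<lambda>j. of_bool (fst j = i) :: real"]
      by (elim Bochner_Integration.integrable_bound) (auto)
  qed
  have "(\<integral>\<^sup>+z. ennreal (\<bar>fst z - snd z\<bar> powr r) \<partial>glued i)
      = (\<integral>\<^sup>+x. glue_weight i (fst x) (snd x) * ennreal (\<bar>fst x - Q (snd x)\<bar> powr r) \<partial>(p' i \<Otimes>\<^sub>M U01))"
    by (subst nn_integral_glued) auto
  also have "\<dots> \<le> (\<integral>\<^sup>+x. glue_weight i (fst x) (snd x) * (f (fst x) + g (snd x)) \<partial>(p' i \<Otimes>\<^sub>M U01))"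
  proof (rule nn_integral_mono)
    fix x :: "real \<times> real"
    obtain y v where x: "x = (y, v)" by (cases x)
    show "glue_weight i (fst x) (snd x) * ennreal (\<bar>fst x - Q (snd x)\<bar> powr r)
        \<le> glue_weight i (fst x) (snd x) * (f (fst x) + g (snd x))"
    proof (cases "J v = (i, c y)")
      case True
      have "\<bar>y - Q v\<bar> powr r \<le> 2 powr r * (\<bar>y - \<zeta> i (c y)\<bar> powr r + \<bar>label_value v - Q v\<bar> powr r)"
        using abs_add_powr_le[of r "y - \<zeta> i (c y)" "label_value v - Q v"] r True by (simp add: label_value_def)
      then show ?thesis by (intro mult_left_mono) (auto simp: x f_def g_def distrib_left ennreal_plus[symmetric] simp del: ennreal_plus)
    qed (simp add: x glue_weight_eq)
  qed
  also have "\<dots> = (\<integral>\<^sup>+y. f y \<partial>p' i) + (\<integral>\<^sup>+v. ennreal (N * of_bool (fst (J v) = i)) * g v \<partial>U01)"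
    by (rule glued_nn_integral[OF i]) auto
  also have "(\<integral>\<^sup>+y. f y \<partial>p' i) = ennreal (2 powr r * (LINT y|p' i. \<bar>y - \<zeta> i (c y)\<bar> powr r))"
    unfolding f_def using int1 by (subst nn_integral_eq_integral) auto
  also have "(\<integral>\<^sup>+v. ennreal (N * of_bool (fst (J v) = i)) * g v \<partial>U01)
      = (\<integral>\<^sup>+v. ennreal (N * of_bool (fst (J v) = i) * (2 powr r * \<bar>label_value v - Q v\<bar> powr r)) \<partial>U01)"
    unfolding g_def by (simp add: ennreal_mult[symmetric] del: ennreal_mult)
  also have "\<dots> = ennreal (LINT v|U01. N * of_bool (fst (J v) = i) * (2 powr r * \<bar>label_value v - Q v\<bar> powr r))"
    using int2 by (subst nn_integral_eq_integral) auto
  also have "(LINT v|U01. N * of_bool (fst (J v) = i) * (2 powr r * \<bar>label_value v - Q v\<bar> powr r))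
      = 2 powr r * (N * (LINT v|U01. of_bool (fst (J v) = i) * \<bar>label_value v - Q v\<bar> powr r))"
    by (simp add: mult_ac flip: integral_mult_right_zero)
  finally have nn: "(\<integral>\<^sup>+z. ennreal (\<bar>fst z - snd z\<bar> powr r) \<partial>glued i) \<le> ennreal ?B"
    by (simp add: distrib_left ennreal_plus[symmetric] del: ennreal_plus)
  have mg: "(\<lambda>z. \<bar>fst z - snd z\<bar> powr r) \<in> borel_measurable (glued i)"
    by (subst measurable_cong_sets[of _ borel]) (auto simp: glued_def)
  have B0: "0 \<le> ?B" by (intro mult_nonneg_nonneg add_nonneg_nonneg integral_nonneg_AE AE_I2) auto
  show int: ?int
    by (rule integrableI_nonneg[OF mg]) (simp, rule le_less_trans[OF nn], simp)
  have "ennreal ?d \<le> ennreal ?B" using nn nn_integral_eq_integral[OF int] by simp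
  then show "?d \<le> ?B" using B0 by simp
qed

text \<open>The integrated form of \<open>displacement_le\<close>. Since \<open>label_value\<close>
  is the conditional mean of \<open>Q\<close> given the label, the cross term of the Bregman
  divergence only sees the labels, and the divergence averages to a difference of Huber
  integrals.\<close>

lemma displacement_integral:
  fixes R \<epsilon> :: real
  assumes R: "0 < R" and e: "0 < \<epsilon>"
  shows "N * (LINT v|U01. \<bar>label_value v - Q v\<bar> powr r) \<le> N * \<epsilon>
     + (2 * R) powr r / \<epsilon> powr (2 / r) * (\<Sum>i<N. (LINT y|p i. huber R y) - (LINT y|p' i. huber R (\<zeta> i (c y))))
     + 2 powr (r + 2) * (\<Sum>i<N. LINT y|p i. tail_powr r R y)"
proof -
  define c2 where "c2 = (2 * R) powr r / \<epsilon> powr (2 / r)"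
  define s where "s j = clamp_to R (\<zeta> (fst j) (snd j))" for j
  define t where "t j = tail_powr r R (\<zeta> (fst j) (snd j))" for j
  obtain \<sigma> where \<sigma>: "\<And>m y. tail_powr r R m + \<sigma> m * (y - m) \<le> tail_powr r R y" using tail_powr_subgradient[OF r] by blast
  note iH = mixture_integral[OF measurable_huber prob_moment_integrable_huber[OF p r less_imp_le[OF R]]]
  note iT = mixture_integral[OF measurable_tail_powr[of r R] prob_moment_integrable_tail_powr[OF p, where R=R]]
  note H = integral_Q[OF measurable_huber iH(1)]
  note T = integral_Q[OF measurable_tail_powr iT(1)]
  note S1 = label_integral(1,2)[of "\<lambda>j. (s j)\<^sup>2"] and S2 = label_integral(3,4)[of s] and t = label_integral(1,2)[of t]
  have hz: "huber R (\<zeta> (fst j) (snd j)) = 2 * s j * \<zeta> (fst j) (snd j) - (s j)\<^sup>2" for j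
    unfolding s_def using R by (intro huber_eq_clamp) simp
  have i1: "integrable U01 (\<lambda>v. huber R (Q v) + (s (J v))\<^sup>2 - 2 * (s (J v) * Q v))"
    using H(1) S1(1) S2(1) by simp
  have i2: "integrable U01 (\<lambda>v. tail_powr r R (Q v) + t (J v))" using T(1) t(1) by simp
  have "(LINT v|U01. \<bar>label_value v - Q v\<bar> powr r)
    \<le> (LINT v|U01. \<epsilon> + c2 * (huber R (Q v) + (s (J v))\<^sup>2 - 2 * (s (J v) * Q v)) + 2 powr (r + 1) * (tail_powr r R (Q v) + t (J v)))"
  proof (rule integral_mono[OF displacement_integrable])
    show "integrable U01 (\<lambda>v. \<epsilon> + c2 * (huber R (Q v) + (s (J v))\<^sup>2 - 2 * (s (J v) * Q v)) + 2 powr (r + 1) * (tail_powr r R (Q v) + t (J v)))"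
      using i1 T(1) t(1) by (intro Bochner_Integration.integrable_add integrable_mult_right) auto
    fix v show "\<bar>label_value v - Q v\<bar> powr r \<le> \<epsilon> + c2 * (huber R (Q v) + (s (J v))\<^sup>2 - 2 * (s (J v) * Q v)) + 2 powr (r + 1) * (tail_powr r R (Q v) + t (J v))"
      using displacement_le[OF r R e, of "label_value v" "Q v"] by (simp add: s_def t_def c2_def label_value_def mult.assoc)
  qed
  also have "\<dots> = \<epsilon> + c2 * (LINT v|U01. huber R (Q v) + (s (J v))\<^sup>2 - 2 * (s (J v) * Q v)) + 2 powr (r + 1) * (LINT v|U01. tail_powr r R (Q v) + t (J v))"
    using i1 i2 H(1) S1(1) S2(1) T(1) t(1) U.prob_space by simp
  also have "(LINT v|U01. huber R (Q v) + (s (J v))\<^sup>2 - 2 * (s (J v) * Q v))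
      = (LINT v|U01. huber R (Q v)) + (LINT v|U01. (s (J v))\<^sup>2) - 2 * (LINT v|U01. s (J v) * Q v)"
    using H(1) S1(1) S2(1) by simp
  also have "\<dots> = (\<Sum>i<N. LINT y|p i. huber R y) / N - (\<Sum>j\<in>atom_index. atom_mass j * huber R (\<zeta> (fst j) (snd j)))"
    unfolding H(2) iH(2) S1(2) S2(2) hz
    by (simp add: sum_subtractf sum_distrib_left algebra_simps)
  also have "(\<Sum>j\<in>atom_index. atom_mass j * huber R (\<zeta> (fst j) (snd j))) = (\<Sum>i<N. LINT y|p' i. huber R (\<zeta> i (c y))) / N"
    by (rule sum_atoms)
  also have "(LINT v|U01. tail_powr r R (Q v) + t (J v)) \<le> 2 * ((\<Sum>i<N. LINT y|p i. tail_powr r R y) / N)"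
  proof -
    \<comment> \<open>Conditional Jensen, written with a subgradient whose linear term integrates to
      zero: the tail of the labels is at most the tail of \<open>Q\<close>. The resulting factor 2
      turns \<open>2 powr (r + 1)\<close> into \<open>2 powr (r + 2)\<close>.\<close>
    let ?g = "\<lambda>j. \<sigma> (\<zeta> (fst j) (snd j))"
    note g1 = label_integral(3,4)[of ?g] and g2 = label_integral(1,2)[of "\<lambda>j. ?g j * \<zeta> (fst j) (snd j)"]
    have "(LINT v|U01. t (J v)) = (LINT v|U01. t (J v) + (?g (J v) * Q v - ?g (J v) * \<zeta> (fst (J v)) (snd (J v))))"
      using t(1) g1 g2 by simp
    also have "\<dots> \<le> (LINT v|U01. tail_powr r R (Q v))"
    proof (rule integral_mono[OF _ T(1)])
      show "integrable U01 (\<lambda>v. t (J v) + (?g (J v) * Q v - ?g (J v) * \<zeta> (fst (J v)) (snd (J v))))" using t(1) g1(1) g2(1) by simp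
      fix v show "t (J v) + (?g (J v) * Q v - ?g (J v) * \<zeta> (fst (J v)) (snd (J v))) \<le> tail_powr r R (Q v)"
        using \<sigma>[of "\<zeta> (fst (J v)) (snd (J v))" "Q v"] by (simp add: t_def algebra_simps)
    qed
    finally show ?thesis using T t(1) iT(2) by simp
  qed
  finally have "(LINT v|U01. \<bar>label_value v - Q v\<bar> powr r) \<le> \<epsilon>
     + c2 * ((\<Sum>i<N. LINT y|p i. huber R y) / N - (\<Sum>i<N. LINT y|p' i. huber R (\<zeta> i (c y))) / N)
     + 2 powr (r + 1) * (2 * ((\<Sum>i<N. LINT y|p i. tail_powr r R y) / N))" by simp
  then have "N * (LINT v|U01. \<bar>label_value v - Q v\<bar> powr r) \<le> N * (\<epsilon>
     + c2 * ((\<Sum>i<N. LINT y|p i. huber R y) / N - (\<Sum>i<N. LINT y|p' i. huber R (\<zeta> i (c y))) / N)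
     + 2 powr (r + 1) * (2 * ((\<Sum>i<N. LINT y|p i. tail_powr r R y) / N)))" by (rule mult_left_mono) simp
  also have "\<dots> = N * \<epsilon> + c2 * (\<Sum>i<N. (LINT y|p i. huber R y) - (LINT y|p' i. huber R (\<zeta> i (c y))))
     + 2 powr (r + 2) * (\<Sum>i<N. LINT y|p i. tail_powr r R y)"
    using N by (simp add: sum_subtractf field_simps powr_add)
  finally show ?thesis by (simp add: c2_def)
qed

end

text \<open>The parameters \<open>R\<close> and \<open>\<epsilon>\<close> stay free. In the
  application \<open>\<epsilon>\<close> is fixed first, then \<open>R\<close> to make the tails
  small, and only then the contraction, which makes the displacement of the \<open>p' i\<close> and
  the Huber difference small.\<close>

lemma competitor_exists:
  fixes R \<epsilon> :: real
  assumes R: "0 < R" and e: "0 < \<epsilon>"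
  obtains q \<gamma> where
    "\<And>i. i < N \<Longrightarrow> q i \<in> prob_moment r"
    "\<And>A. A \<in> sets borel \<Longrightarrow> (\<Sum>i<N. measure (q i) A) = (\<Sum>i<N. measure (p i) A)"
    "\<And>i. i < N \<Longrightarrow> (LINT y|q i. y) = (LINT y|p' i. \<zeta> i (c y))"
    "\<And>i. i < N \<Longrightarrow> \<gamma> i \<in> couplings (p' i) (q i)"
    "\<And>i. i < N \<Longrightarrow> integrable (\<gamma> i) (\<lambda>z. \<bar>fst z - snd z\<bar> powr r)"
    "(\<Sum>i<N. LINT z|\<gamma> i. \<bar>fst z - snd z\<bar> powr r) \<le> 2 powr r * ((\<Sum>i<N. LINT y|p' i. \<bar>y - \<zeta> i (c y)\<bar> powr r) + N * \<epsilon>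
     + (2 * R) powr r / \<epsilon> powr (2 / r) * (\<Sum>i<N. (LINT y|p i. huber R y) - (LINT y|p' i. huber R (\<zeta> i (c y))))
     + 2 powr (r + 2) * (\<Sum>i<N. LINT y|p i. tail_powr r R y))"
proof (rule mixture_labelling)
  fix Q J
  assume QJ: "Q \<in> borel_measurable borel" "distr U01 borel Q = mixture"
    "J \<in> borel \<rightarrow>\<^sub>M count_space UNIV" "\<And>v. J v \<in> atom_index"
    "\<And>i. i \<in> atom_index \<Longrightarrow> (LINT v|U01. indicator {i} (J v)) = atom_mass i"
    "\<And>i. i \<in> atom_index \<Longrightarrow> (LINT v|U01. indicator {i} (J v) * Q v) = atom_mass i * \<zeta> (fst i) (snd i)"
  note F = glued_cost[OF QJ]
  show thesis
  proof (rule that[of "component Q J" "glued Q J"])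
    have "(\<Sum>i<N. LINT z|glued Q J i. \<bar>fst z - snd z\<bar> powr r)
       \<le> (\<Sum>i<N. 2 powr r * ((LINT y|p' i. \<bar>y - \<zeta> i (c y)\<bar> powr r)
          + N * (LINT v|U01. of_bool (fst (J v) = i) * \<bar>label_value J v - Q v\<bar> powr r)))"
      by (intro sum_mono F(2)) auto
    also have "\<dots> = 2 powr r * ((\<Sum>i<N. LINT y|p' i. \<bar>y - \<zeta> i (c y)\<bar> powr r)
          + N * (LINT v|U01. \<bar>label_value J v - Q v\<bar> powr r))"
      using sum_block_integrals[OF QJ displacement_integrable[OF QJ]]
      by (simp add: sum.distrib distrib_left flip: sum_distrib_left)
    also have "\<dots> \<le> 2 powr r * ((\<Sum>i<N. LINT y|p' i. \<bar>y - \<zeta> i (c y)\<bar> powr r) + (N * \<epsilon>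
     + (2 * R) powr r / \<epsilon> powr (2 / r) * (\<Sum>i<N. (LINT y|p i. huber R y) - (LINT y|p' i. huber R (\<zeta> i (c y))))
     + 2 powr (r + 2) * (\<Sum>i<N. LINT y|p i. tail_powr r R y)))"
      by (intro mult_left_mono add_left_mono displacement_integral[OF QJ R e]) auto
    finally show "(\<Sum>i<N. LINT z|glued Q J i. \<bar>fst z - snd z\<bar> powr r) \<le> 2 powr r * ((\<Sum>i<N. LINT y|p' i. \<bar>y - \<zeta> i (c y)\<bar> powr r) + N * \<epsilon>
     + (2 * R) powr r / \<epsilon> powr (2 / r) * (\<Sum>i<N. (LINT y|p i. huber R y) - (LINT y|p' i. huber R (\<zeta> i (c y))))
     + 2 powr (r + 2) * (\<Sum>i<N. LINT y|p i. tail_powr r R y))" by (simp add: add.assoc)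
  qed (use component_in_prob_moment[OF QJ] measure_components[OF QJ] component_mean[OF QJ] glued_coupling[OF QJ] F(1) in auto)
qed

end

section \<open>Sampling\<close>

text \<open>The weights are approximated by integers: \<open>X b\<close> is repeated
  \<open>\<lfloor>m * w b\<rfloor>\<close> times. The rounding error in constraint \<open>j\<close>
  is at most \<open>B j\<close>, independent of \<open>m\<close>, while the main term grows linearly
  in \<open>m\<close>.\<close>

lemma sample_of_weights:
  fixes f :: "'j \<Rightarrow> 'a \<Rightarrow> real"
  assumes "finite W" "finite T" "T \<noteq> {}" "\<And>b. b \<in> W \<Longrightarrow> 0 \<le> w b" "\<And>b. b \<in> W \<Longrightarrow> X b \<in> S"
    and pos: "\<And>j. j \<in> T \<Longrightarrow> 0 < (\<Sum>b\<in>W. w b * f j (X b))"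
  shows "\<exists>N>0. \<exists>x::nat \<Rightarrow> 'a. (\<forall>i. x i \<in> S) \<and> (\<forall>j\<in>T. 0 < (\<Sum>i<N. f j (x i)))"
proof -
  define B where "B j = (\<Sum>b\<in>W. \<bar>f j (X b)\<bar>)" for j
  define s where "s j = (\<Sum>b\<in>W. w b * f j (X b))" for j
  have "\<exists>m::nat. \<forall>j\<in>T. B j < m * s j"
  proof -
    have "\<exists>m::nat. B j < m * s j" if "j \<in> T" for j
      using reals_Archimedean3[OF pos[OF that]] by (auto simp: s_def)
    then obtain g where g: "\<And>j. j \<in> T \<Longrightarrow> B j < real (g j) * s j" by metis
    show ?thesis
    proof (intro exI[of _ "Max (g ` T)"] ballI)
      fix j assume j: "j \<in> T"
      then have "real (g j) * s j \<le> real (Max (g ` T)) * s j"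
        using assms(2) pos[OF j] by (intro mult_right_mono) (auto simp: s_def)
      then show "B j < Max (g ` T) * s j" using g[OF j] by linarith
    qed
  qed
  then obtain m :: nat where m: "\<And>j. j \<in> T \<Longrightarrow> B j < m * s j" by auto
  define n where "n b = nat \<lfloor>m * w b\<rfloor>" for b
  have n: "\<bar>real (n b) - m * w b\<bar> \<le> 1" if "b \<in> W" for b
  proof -
    have "0 \<le> m * w b" using assms(4)[OF that] by simp
    then show ?thesis unfolding n_def by linarith
  qed
  have ns: "0 < (\<Sum>b\<in>W. real (n b) * f j (X b))" if j: "j \<in> T" for j
  proof -
    have "m * s j - (\<Sum>b\<in>W. real (n b) * f j (X b)) = (\<Sum>b\<in>W. (m * w b - n b) * f j (X b))"
      by (simp add: s_def sum_distrib_left sum_subtractf algebra_simps)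
    also have "\<dots> \<le> (\<Sum>b\<in>W. \<bar>f j (X b)\<bar>)"
    proof (rule sum_mono)
      fix b assume b: "b \<in> W"
      have "(m * w b - n b) * f j (X b) \<le> \<bar>m * w b - n b\<bar> * \<bar>f j (X b)\<bar>" by (metis abs_ge_self abs_mult)
      also have "\<dots> \<le> 1 * \<bar>f j (X b)\<bar>" using n[OF b] by (intro mult_right_mono) (auto simp: abs_minus_commute)
      finally show "(m * w b - n b) * f j (X b) \<le> \<bar>f j (X b)\<bar>" by simp
    qed
    finally show ?thesis using m[OF j] by (simp add: B_def)
  qed
  obtain bs where bs: "set bs = W" "distinct bs" using finite_distinct_list[OF assms(1)] by auto
  define xs where "xs = concat (map (\<lambda>b. replicate (n b) (X b)) bs)"
  have xsS: "set xs \<subseteq> S" using assms(5) bs by (auto simp: xs_def)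
  have sum_xs: "sum_list (map (f j) xs) = (\<Sum>b\<in>W. real (n b) * f j (X b))" for j
  proof -
    have "sum_list (map (f j) xs) = sum_list (map (\<lambda>b. real (n b) * f j (X b)) bs)"
      unfolding xs_def by (induction bs) (auto simp: sum_list_replicate)
    then show ?thesis using bs by (simp add: sum_list_distinct_conv_sum_set)
  qed
  obtain j0 where j0: "j0 \<in> T" using assms(3) by auto
  have ne: "xs \<noteq> []" using ns[OF j0] sum_xs[of j0] by auto
  show ?thesis
  \<comment> \<open>Indices beyond the list fall back to its first element, so that every
    \<open>x i\<close> lies in \<open>S\<close>.\<close>
  proof (intro exI[of _ "length xs"] conjI exI[of _ "\<lambda>i. xs ! (if i < length xs then i else 0)"] allI ballI)
    show "0 < length xs" using ne by simp
    show "xs ! (if i < length xs then i else 0) \<in> S" for i using ne xsS by (auto simp: subset_iff)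
    fix j assume "j \<in> T"
    have "(\<Sum>i<length xs. f j (xs ! (if i < length xs then i else 0))) = sum_list (map (f j) xs)"
      by (simp add: sum_list_sum_nth atLeast0LessThan)
    then show "0 < (\<Sum>i<length xs. f j (xs ! (if i < length xs then i else 0)))"
      using ns[OF \<open>j \<in> T\<close>] sum_xs by simp
  qed
qed

text \<open>A deterministic substitute for the law of large numbers.\<close>

lemma (in prob_space) finite_sample_positive:
  fixes F :: "'j \<Rightarrow> 'a \<Rightarrow> real"
  assumes T: "finite T" "T \<noteq> {}" and int: "\<And>j. j \<in> T \<Longrightarrow> integrable M (F j)"
    and pos: "\<And>j. j \<in> T \<Longrightarrow> 0 < (LINT x|M. F j x)"
    and thick: "\<And>B. B \<in> sets M \<Longrightarrow> 0 < emeasure M B \<Longrightarrow> B \<inter> S \<noteq> {}"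
  shows "\<exists>N>0. \<exists>x::nat \<Rightarrow> 'a. (\<forall>i. x i \<in> S) \<and> (\<forall>j\<in>T. 0 < (\<Sum>i<N. F j (x i)))"
proof -
  \<comment> \<open>Strictly below every mean, so that the bound survives the truncation to
    \<open>A n\<close>. The cells below have width \<open>\<delta>\<close>, and replacing a function
    by its value at one point of each cell costs at most \<open>\<delta>\<close> in total.\<close>
  define \<delta> where "\<delta> = Min ((\<lambda>j. LINT x|M. F j x) ` T) / 2"
  have \<delta>: "0 < \<delta>" "\<And>j. j \<in> T \<Longrightarrow> \<delta> < (LINT x|M. F j x)"
  proof -
    show 0: "0 < \<delta>" using T pos by (simp add: \<delta>_def)
    show "\<delta> < (LINT x|M. F j x)" if "j \<in> T" for j
    proof -
      have "2 * \<delta> \<le> (LINT x|M. F j x)" using T that by (simp add: \<delta>_def)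
      then show ?thesis using 0 by linarith
    qed
  qed
  note [measurable] = borel_measurable_integrable[OF int]
  define A where "A n = {x \<in> space M. \<forall>j\<in>T. \<bar>F j x\<bar> \<le> real n}" for n
  have A[measurable]: "A n \<in> sets M" for n unfolding A_def using T by measurable
  have lim: "(\<lambda>n. LINT x|M. indicator (A n) x * F j x) \<longlonglongrightarrow> (LINT x|M. F j x)" if j: "j \<in> T" for j
  proof (rule integral_dominated_convergence[where w="\<lambda>x. \<bar>F j x\<bar>"])
    show "AE x in M. (\<lambda>n. indicator (A n) x * F j x) \<longlonglongrightarrow> F j x"
    proof (intro AE_I2 tendsto_eventually)
      fix x assume x: "x \<in> space M"
      obtain n0 :: nat where n0: "Max ((\<lambda>j. \<bar>F j x\<bar>) ` T) \<le> real n0" using real_arch_simple by blast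
      show "\<forall>\<^sub>F n in sequentially. indicator (A n) x * F j x = F j x"
        using eventually_ge_at_top[of n0]
      proof eventually_elim
        case (elim n)
        have "\<bar>F i x\<bar> \<le> real n" if "i \<in> T" for i
          using Max_ge[of "(\<lambda>j. \<bar>F j x\<bar>) ` T" "\<bar>F i x\<bar>"] T that n0 elim by auto
        then have "x \<in> A n" using x by (simp add: A_def)
        then show ?case by simp
      qed
    qed
  qed (use int[OF j] j in \<open>auto simp: indicator_def\<close>)
  have "\<forall>\<^sub>F n in sequentially. \<forall>j\<in>T. \<delta> < (LINT x|M. indicator (A n) x * F j x)"
    using T(1) by (intro eventually_ball_finite ballI order_tendstoD(1)[OF lim \<delta>(2)])
  then obtain n where n: "\<And>j. j \<in> T \<Longrightarrow> \<delta> < (LINT x|M. indicator (A n) x * F j x)"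
    by (auto simp: eventually_sequentially)
  define K where "K = \<lceil>real n / \<delta>\<rceil> + 1"
  define G where "G = T \<rightarrow>\<^sub>E {- K .. K}"
  have finG: "finite G" unfolding G_def using T by (intro finite_PiE) auto
  \<comment> \<open>On a cell every \<open>F j\<close> is known up to \<open>\<delta>\<close>; the
    bound on \<open>A n\<close> leaves finitely many cells.\<close>
  define cell where "cell b = {x \<in> A n. \<forall>j\<in>T. \<lfloor>F j x / \<delta>\<rfloor> = b j}" for b
  have cell[measurable]: "cell b \<in> sets M" for b
  proof -
    have "cell b = {x \<in> space M. x \<in> A n \<and> (\<forall>j\<in>T. \<lfloor>F j x / \<delta>\<rfloor> = b j)}" by (auto simp: cell_def A_def)
    also have "\<dots> \<in> sets M" using T by measurable
    finally show ?thesis .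
  qed
  define W where "W = {b \<in> G. 0 < measure M (cell b)}"
  \<comment> \<open>The set \<open>S\<close> enters only through one point in each cell of positive
    measure; it may be non-measurable.\<close>
  have "\<exists>x. x \<in> cell b \<inter> S" if "b \<in> W" for b
    using thick[OF cell, of b] that by (auto simp: W_def emeasure_eq_measure)
  then obtain X where X: "\<And>b. b \<in> W \<Longrightarrow> X b \<in> cell b \<inter> S" by metis
  show ?thesis
  proof (rule sample_of_weights[where W=W and w="\<lambda>b. measure M (cell b)" and X=X])
    show "finite W" unfolding W_def using finG by simp
    fix j assume j: "j \<in> T"
    have ic: "integrable M (\<lambda>x. indicator (cell b) x * (\<delta> * (b j + 1)) :: real)" for b
      by (intro integrable_mult_left integrable_real_indicator) (auto simp: emeasure_eq_measure)
    have "\<delta> < (LINT x|M. indicator (A n) x * F j x)" by (rule n[OF j])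
    also have "\<dots> \<le> (LINT x|M. (\<Sum>b\<in>G. indicator (cell b) x * (\<delta> * (b j + 1))))"
    proof (rule integral_mono)
      show "integrable M (\<lambda>x. indicator (A n) x * F j x)"
        by (rule Bochner_Integration.integrable_bound[OF int[OF j]]) (use j in \<open>auto simp: indicator_def\<close>)
      show "integrable M (\<lambda>x. \<Sum>b\<in>G. indicator (cell b) x * (\<delta> * (b j + 1)))" by (intro Bochner_Integration.integrable_sum ic)
      fix x assume x: "x \<in> space M"
      show "indicator (A n) x * F j x \<le> (\<Sum>b\<in>G. indicator (cell b) x * (\<delta> * (b j + 1)))"
      proof (cases "x \<in> A n")
        case True
        define b where "b = restrict (\<lambda>j. \<lfloor>F j x / \<delta>\<rfloor>) T"
        have bG: "b \<in> G"
        proof -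
          have "\<lfloor>F i x / \<delta>\<rfloor> \<in> {- K .. K}" if "i \<in> T" for i
          proof -
            have "\<bar>F i x\<bar> / \<delta> \<le> n / \<delta>" using True that \<delta>(1) by (intro divide_right_mono) (auto simp: A_def)
            then have "\<bar>F i x / \<delta>\<bar> \<le> n / \<delta>" using \<delta>(1) by simp
            then show ?thesis unfolding K_def atLeastAtMost_iff by linarith
          qed
          then show ?thesis by (simp add: b_def G_def)
        qed
        have uniq: "x \<in> cell b' \<longleftrightarrow> b' = b" if "b' \<in> G" for b'
          using that True by (auto simp: cell_def b_def G_def PiE_def extensional_def fun_eq_iff restrict_def)
        have "(\<Sum>b'\<in>G. indicator (cell b') x * (\<delta> * (b' j + 1))) = (\<Sum>b'\<in>{b}. indicator (cell b') x * (\<delta> * (b' j + 1)))"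
          using bG finG uniq by (intro sum.mono_neutral_right) (auto simp: indicator_def)
        also have "\<dots> = \<delta> * (\<lfloor>F j x / \<delta>\<rfloor> + 1)" using uniq[OF bG] j by (simp add: b_def)
        also have "\<dots> \<ge> \<delta> * (F j x / \<delta>)" using \<delta>(1) by (intro mult_left_mono) linarith+
        finally show ?thesis using True \<delta>(1) by simp
      qed (auto simp: cell_def indicator_def sum_nonneg)
    qed
    also have "\<dots> = (\<Sum>b\<in>G. measure M (cell b) * (\<delta> * (b j + 1)))"
      using ic by (subst Bochner_Integration.integral_sum) auto
    also have "\<dots> = (\<Sum>b\<in>W. measure M (cell b) * (\<delta> * (b j + 1)))"
      using finG by (intro sum.mono_neutral_right) (auto simp: W_def zero_less_measure_iff)
    also have "\<dots> \<le> (\<Sum>b\<in>W. measure M (cell b) * (F j (X b) + \<delta>))"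
    proof (intro sum_mono mult_left_mono)
      fix b assume b: "b \<in> W"
      have "\<lfloor>F j (X b) / \<delta>\<rfloor> = b j" using X[OF b] j by (auto simp: cell_def)
      then have "real_of_int (b j) \<le> F j (X b) / \<delta>" by linarith
      then have "b j * \<delta> \<le> F j (X b)" using \<delta>(1) by (simp add: pos_le_divide_eq)
      then show "\<delta> * (b j + 1) \<le> F j (X b) + \<delta>" by (simp add: algebra_simps)
    qed simp
    also have "\<dots> = (\<Sum>b\<in>W. measure M (cell b) * F j (X b)) + \<delta> * (\<Sum>b\<in>W. measure M (cell b))"
      by (simp add: distrib_left sum.distrib sum_distrib_left mult.commute)
    also have "(\<Sum>b\<in>W. measure M (cell b)) \<le> 1"
    proof -
      have dj: "disjoint_family_on cell W"
        by (auto simp: disjoint_family_on_def cell_def W_def G_def PiE_def extensional_def fun_eq_iff) metis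
      have "(\<Sum>b\<in>W. measure M (cell b)) = measure M (\<Union>b\<in>W. cell b)"
        using finG dj by (intro finite_measure_finite_Union[symmetric]) (auto simp: W_def)
      then show ?thesis by simp
    qed
    finally show "0 < (\<Sum>b\<in>W. measure M (cell b) * F j (X b))" using \<delta>(1) by (simp add: mult_left_mono)
  qed (use T X in auto)
qed

section \<open>Contraction of a measure towards its barycentre\<close>

text \<open>On a cell of measure zero the division yields 0. The product formula
  \<open>cond_mean_mult\<close> covers such cells as well, both of its sides being zero.\<close>

definition cond_mean :: "(real \<Rightarrow> nat) \<Rightarrow> real measure \<Rightarrow> nat \<Rightarrow> real" where
  "cond_mean c p l = (LINT y|p. of_bool (c y = l) * y) / measure p {y. c y = l}"

text \<open>Towards the barycentre \<open>x\<close> by a factor \<open>1 - \<epsilon>\<close>, after replacing each cell by its conditional mean.\<close>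

definition contraction :: "real \<Rightarrow> (real \<Rightarrow> nat) \<Rightarrow> real measure \<Rightarrow> real \<Rightarrow> nat \<Rightarrow> real" where
  "contraction \<epsilon> c p x l = (1 - \<epsilon>) * cond_mean c p l + \<epsilon> * x"

lemma pos_part_subgradient: "max 0 (m - t) + of_bool (m > t) * (y - m) \<le> max 0 (y - t)" for m t y :: real
  by auto

lemma pos_part_mean_le:
  assumes p: "p \<in> prob_moment r" and r: "1 \<le> r"
  shows "max 0 ((LINT y|p. y) - t) \<le> (LINT y|p. max 0 (y - t))"
proof -
  interpret prob_space p by (rule prob_momentD[OF p])
  have id: "integrable p (\<lambda>y. y)" by (rule prob_moment_integrable_id[OF p r])
  let ?x = "LINT y|p. y"
  have "max 0 (?x - t) = (LINT y|p. max 0 (?x - t) + of_bool (?x > t) * (y - ?x))"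
    using id prob_space by simp
  also have "\<dots> \<le> (LINT y|p. max 0 (y - t))"
    using id by (intro integral_mono prob_moment_integrable_pos_part[OF p r] pos_part_subgradient) auto
  finally show ?thesis .
qed

context
  fixes r \<epsilon> x :: real and p :: "real measure" and c :: "real \<Rightarrow> nat" and L :: nat
  assumes r: "1 \<le> r" and p: "p \<in> prob_moment r" and mean: "(LINT y|p. y) = x"
    and c: "c \<in> borel \<rightarrow>\<^sub>M count_space UNIV" and cL: "\<And>y. c y < L" and e: "0 < \<epsilon>" "\<epsilon> \<le> 1"
begin

interpretation prob_space p by (rule prob_momentD[OF p])

lemmas cells = integral_finite_cells[OF prob_momentD(1,2)[OF p] c cL]
lemmas cells_const = integral_finite_cells_const[OF prob_momentD(1,2)[OF p] c cL]

lemma p_id: "integrable p (\<lambda>y. y)" by (rule prob_moment_integrable_id[OF p r])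

lemma p_pos: "integrable p (\<lambda>y. max 0 (y - t))" by (rule prob_moment_integrable_pos_part[OF p r])

lemma cell_in_sets: "{y. c y = l} \<in> sets p"
  using measurable_sets[OF c, of "{l}"] prob_momentD(2)[OF p] by (simp add: vimage_def)

lemma integral_cell_indicator: "(LINT y|p. of_bool (c y = l)) = prob {y. c y = l}"
  "integrable p (\<lambda>y. of_bool (c y = l) * h y)" if "integrable p h" for h :: "real \<Rightarrow> real"
proof -
  have "(\<lambda>y. of_bool (c y = l) :: real) = indicator {y. c y = l}" by (auto simp: indicator_def fun_eq_iff)
  then show "(LINT y|p. of_bool (c y = l)) = prob {y. c y = l}" using cell_in_sets[of l] by simp
  show "integrable p (\<lambda>y. of_bool (c y = l) * h y)" by (rule cells(1)[OF that, of "\<lambda>l'. of_bool (l' = l)"])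
qed

lemma cond_mean_mult: "prob {y. c y = l} * cond_mean c p l = (LINT y|p. of_bool (c y = l) * y)"
proof (cases "prob {y. c y = l} = 0")
  case True
  then have "AE y in p. c y \<noteq> l" using prob_eq_0[OF cell_in_sets[of l]] by simp
  then have "(LINT y|p. of_bool (c y = l) * y) = (LINT y|p. 0)"
    by (intro integral_cong_AE) (use integral_cell_indicator(2)[OF p_id, of l] in auto)
  then show ?thesis using True by simp
qed (simp add: cond_mean_def)

lemma integral_cond_mean: "(LINT y|p. G (c y) * y) = (LINT y|p. G (c y) * cond_mean c p (c y))" for G :: "nat \<Rightarrow> real"
proof -
  have "(LINT y|p. G (c y) * cond_mean c p (c y)) = (\<Sum>l<L. prob {y. c y = l} * (G l * cond_mean c p l))"
    by (rule cells_const(2)[of "\<lambda>l. G l * cond_mean c p l"])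
  also have "\<dots> = (\<Sum>l<L. G l * (LINT y|p. of_bool (c y = l) * y))" by (simp add: cond_mean_mult[symmetric] mult.left_commute)
  also have "\<dots> = (LINT y|p. G (c y) * y)" by (rule cells(2)[OF p_id, symmetric])
  finally show ?thesis ..
qed

text \<open>A supporting line at the conditional mean of each cell. The function
  \<open>\<psi>\<close> may vary with the cell, so that distances to a reference point of the cell
  are covered.\<close>

lemma cond_mean_jensen:
  fixes \<psi> :: "nat \<Rightarrow> real \<Rightarrow> real"
  assumes sub: "\<And>l m y. \<psi> l m + s l m * (y - m) \<le> \<psi> l y" and int: "integrable p (\<lambda>y. \<psi> (c y) y)"
  shows "(LINT y|p. \<psi> (c y) (cond_mean c p (c y))) \<le> (LINT y|p. \<psi> (c y) y)"
proof -
  define G where "G l = s l (cond_mean c p l)" for l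
  note i1 = cells_const(1)[of "\<lambda>l. \<psi> l (cond_mean c p l)"] and i2 = cells(1)[OF p_id, of G]
    and i3 = cells_const(1)[of "\<lambda>l. G l * cond_mean c p l"]
  have "(LINT y|p. \<psi> (c y) (cond_mean c p (c y)))
      = (LINT y|p. \<psi> (c y) (cond_mean c p (c y)) + (G (c y) * y - G (c y) * cond_mean c p (c y)))"
    using i1 i2 i3 integral_cond_mean[of G] by simp
  also have "\<dots> \<le> (LINT y|p. \<psi> (c y) y)"
  proof (rule integral_mono[OF _ int])
    show "integrable p (\<lambda>y. \<psi> (c y) (cond_mean c p (c y)) + (G (c y) * y - G (c y) * cond_mean c p (c y)))"
      using i1 i2 i3 by simp
    fix y
    show "\<psi> (c y) (cond_mean c p (c y)) + (G (c y) * y - G (c y) * cond_mean c p (c y)) \<le> \<psi> (c y) y"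
      using sub[of "c y" "cond_mean c p (c y)" y] by (simp add: G_def algebra_simps)
  qed
  finally show ?thesis .
qed

lemma contraction_integrable: "integrable p (\<lambda>y. F (contraction \<epsilon> c p x (c y)))" for F :: "real \<Rightarrow> real"
  by (rule cells_const(1)[of "\<lambda>l. F (contraction \<epsilon> c p x l)"])

lemma cond_mean_integrable: "integrable p (\<lambda>y. F (c y) (cond_mean c p (c y)))" for F :: "nat \<Rightarrow> real \<Rightarrow> real"
  by (rule cells_const(1)[of "\<lambda>l. F l (cond_mean c p l)"])

lemma contraction_mean: "(LINT y|p. contraction \<epsilon> c p x (c y)) = x"
proof -
  have "(LINT y|p. cond_mean c p (c y)) = x" using integral_cond_mean[of "\<lambda>_. 1"] mean by simp
  then show ?thesis using cond_mean_integrable[of "\<lambda>_ m. m"] prob_space by (simp add: contraction_def algebra_simps)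
qed

text \<open>Averaging over cells lowers the integral of a convex function, and the affine pull
  towards \<open>x\<close> scales the remaining gap by \<open>1 - \<epsilon>\<close>.\<close>

lemma contraction_potential:
  "(LINT y|p. max 0 (contraction \<epsilon> c p x (c y) - t)) - max 0 (x - t)
    \<le> (1 - \<epsilon>) * ((LINT y|p. max 0 (y - t)) - max 0 (x - t))"
proof -
  have "(LINT y|p. max 0 (contraction \<epsilon> c p x (c y) - t))
      \<le> (LINT y|p. (1 - \<epsilon>) * max 0 (cond_mean c p (c y) - t) + \<epsilon> * max 0 (x - t))"
  proof (rule integral_mono[OF contraction_integrable])
    show "integrable p (\<lambda>y. (1 - \<epsilon>) * max 0 (cond_mean c p (c y) - t) + \<epsilon> * max 0 (x - t))"
      using cond_mean_integrable[of "\<lambda>_ m. max 0 (m - t)"] by simp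
    fix y
    let ?m = "cond_mean c p (c y)"
    have "contraction \<epsilon> c p x (c y) - t = (1 - \<epsilon>) * (?m - t) + \<epsilon> * (x - t)" by (simp add: contraction_def algebra_simps)
    also have "\<dots> \<le> (1 - \<epsilon>) * max 0 (?m - t) + \<epsilon> * max 0 (x - t)" using e by (intro add_mono mult_left_mono) auto
    finally show "max 0 (contraction \<epsilon> c p x (c y) - t) \<le> (1 - \<epsilon>) * max 0 (?m - t) + \<epsilon> * max 0 (x - t)"
      using e by simp
  qed
  also have "\<dots> = (1 - \<epsilon>) * (LINT y|p. max 0 (cond_mean c p (c y) - t)) + \<epsilon> * max 0 (x - t)"
    using cond_mean_integrable[of "\<lambda>_ m. max 0 (m - t)"] prob_space by simp
  also have "(1 - \<epsilon>) * (LINT y|p. max 0 (cond_mean c p (c y) - t)) \<le> (1 - \<epsilon>) * (LINT y|p. max 0 (y - t))"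
    using e by (intro mult_left_mono cond_mean_jensen[where \<psi>="\<lambda>_ y. max 0 (y - t)", OF pos_part_subgradient p_pos]) simp
  finally show ?thesis by (simp add: algebra_simps)
qed

text \<open>The values \<open>a l\<close> are reference points of the cells. By Jensen the
  conditional means are no farther from them than the original points, so averaging is controlled by
  the distance to the reference points; the last term pays for the pull.\<close>

lemma contraction_distance:
  "(LINT y|p. \<bar>y - contraction \<epsilon> c p x (c y)\<bar> powr r)
    \<le> 2 powr r * (2 * 2 powr r * (LINT y|p. \<bar>y - a (c y)\<bar> powr r) + \<epsilon> powr r * (LINT y|p. \<bar>y - x\<bar> powr r))"
  for a :: "nat \<Rightarrow> real"
proof -
  obtain s where s: "\<And>m y. \<bar>m\<bar> powr r + s m * (y - m) \<le> \<bar>y\<bar> powr r" using abs_powr_subgradient[OF r] by blast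
  let ?m = "\<lambda>y. cond_mean c p (c y)"
  have meas: "(\<lambda>y. F (c y)) \<in> borel_measurable p" for F :: "nat \<Rightarrow> real"
    using borel_measurable_integrable[OF cells_const(1)] .
  have idm[measurable]: "(\<lambda>y. y) \<in> borel_measurable p" using p_id by simp
  have ia: "integrable p (\<lambda>y. \<bar>y - b (c y)\<bar> powr r)" for b :: "nat \<Rightarrow> real"
  proof -
    have [measurable]: "(\<lambda>y. b (c y)) \<in> borel_measurable p" by (rule meas)
    have "integrable p (\<lambda>y. 2 powr r * (\<bar>y\<bar> powr r + \<bar>b (c y)\<bar> powr r))"
      using prob_momentD(4)[OF p] cells_const(1)[of "\<lambda>l. \<bar>b l\<bar> powr r"] by simp
    then show ?thesis
      by (rule Bochner_Integration.integrable_bound) (use abs_add_powr_le[of r y "- b (c y)" for y] r in auto)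
  qed
  have ix: "integrable p (\<lambda>y. \<bar>y - x\<bar> powr r)" using ia[of "\<lambda>_. x"] .
  have im: "integrable p (\<lambda>y. \<bar>?m y - b (c y)\<bar> powr r)" for b :: "nat \<Rightarrow> real"
    by (rule cond_mean_integrable[of "\<lambda>l m. \<bar>m - b l\<bar> powr r"])
  have J: "(LINT y|p. \<bar>?m y - b (c y)\<bar> powr r) \<le> (LINT y|p. \<bar>y - b (c y)\<bar> powr r)" for b :: "nat \<Rightarrow> real"
  proof (rule cond_mean_jensen[where \<psi>="\<lambda>l y. \<bar>y - b l\<bar> powr r" and s="\<lambda>l m. s (m - b l)"])
    show "\<bar>m - b l\<bar> powr r + s (m - b l) * (y - m) \<le> \<bar>y - b l\<bar> powr r" for l m y using s[of "m - b l" "y - b l"] by simp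
  qed (rule ia)
  have "(LINT y|p. \<bar>y - contraction \<epsilon> c p x (c y)\<bar> powr r)
     \<le> (LINT y|p. 2 powr r * (2 powr r * (\<bar>y - a (c y)\<bar> powr r + \<bar>?m y - a (c y)\<bar> powr r) + \<epsilon> powr r * \<bar>?m y - x\<bar> powr r))"
  proof (rule integral_mono[OF ia])
    show "integrable p (\<lambda>y. 2 powr r * (2 powr r * (\<bar>y - a (c y)\<bar> powr r + \<bar>?m y - a (c y)\<bar> powr r) + \<epsilon> powr r * \<bar>?m y - x\<bar> powr r))"
      using ia[of a] im[of a] im[of "\<lambda>_. x"] by simp
    fix y
    have "\<bar>y - contraction \<epsilon> c p x (c y)\<bar> powr r = \<bar>(y - ?m y) + \<epsilon> * (?m y - x)\<bar> powr r"
      by (simp add: contraction_def algebra_simps)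
    also have "\<dots> \<le> 2 powr r * (\<bar>y - ?m y\<bar> powr r + \<bar>\<epsilon> * (?m y - x)\<bar> powr r)" using r by (intro abs_add_powr_le) simp
    also have "\<bar>\<epsilon> * (?m y - x)\<bar> powr r = \<epsilon> powr r * \<bar>?m y - x\<bar> powr r" using e by (simp add: abs_mult powr_mult)
    also have "\<bar>y - ?m y\<bar> powr r \<le> 2 powr r * (\<bar>y - a (c y)\<bar> powr r + \<bar>?m y - a (c y)\<bar> powr r)"
      using abs_add_powr_le[of r "y - a (c y)" "a (c y) - ?m y"] r by (simp add: abs_minus_commute)
    finally show "\<bar>y - contraction \<epsilon> c p x (c y)\<bar> powr r \<le>
       2 powr r * (2 powr r * (\<bar>y - a (c y)\<bar> powr r + \<bar>?m y - a (c y)\<bar> powr r) + \<epsilon> powr r * \<bar>?m y - x\<bar> powr r)"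
      by (simp add: mult_left_mono)
  qed
  also have "\<dots> = 2 powr r * (2 powr r * ((LINT y|p. \<bar>y - a (c y)\<bar> powr r) + (LINT y|p. \<bar>?m y - a (c y)\<bar> powr r)) + \<epsilon> powr r * (LINT y|p. \<bar>?m y - x\<bar> powr r))"
    using ia[of a] im[of a] im[of "\<lambda>_. x"] by simp
  also have "\<dots> \<le> 2 powr r * (2 powr r * ((LINT y|p. \<bar>y - a (c y)\<bar> powr r) + (LINT y|p. \<bar>y - a (c y)\<bar> powr r)) + \<epsilon> powr r * (LINT y|p. \<bar>y - x\<bar> powr r))"
    by (intro mult_left_mono add_mono J order_refl J[of "\<lambda>_. x"]) auto
  finally show ?thesis by (simp add: algebra_simps)
qed

text \<open>\<open>lo\<close> and \<open>hi\<close> are the extreme atoms of the contracted measure;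
  outside them its potential is that of the point mass at \<open>x\<close>. If the potential of
  \<open>p\<close> touched that of the point mass at a level \<open>t\<close> distinct from
  \<open>x\<close>, then \<open>p\<close> would live on the side of \<open>t\<close> that contains
  \<open>x\<close>, and the pull would put every atom strictly on that side, so \<open>t\<close>
  could not lie between \<open>lo\<close> and \<open>hi\<close>.\<close>

lemma contraction_support:
  obtains lo hi where
    "\<And>t. (LINT y|p. max 0 (contraction \<epsilon> c p x (c y) - t)) - max 0 (x - t) > 0 \<Longrightarrow> lo \<le> t \<and> t \<le> hi"
    "\<And>t. lo \<le> t \<Longrightarrow> t \<le> hi \<Longrightarrow> (LINT y|p. max 0 (y - t)) - max 0 (x - t) > 0"
proof -
  let ?z = "contraction \<epsilon> c p x"
  have AEW: "AE y in p. 0 < prob {y'. c y' = c y}"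
    by (rule AE_finite_cells_pos[OF prob_momentD(1,2)[OF p] c cL])
  have cell_le: "cond_mean c p l \<le> t" if "AE y in p. y \<le> t" "0 < prob {y. c y = l}" for l t
  proof -
    have "prob {y. c y = l} * cond_mean c p l = (LINT y|p. of_bool (c y = l) * y)" by (rule cond_mean_mult)
    also have "\<dots> \<le> (LINT y|p. of_bool (c y = l) * t)"
      by (intro integral_mono_AE integral_cell_indicator(2) p_id integrable_const) (use that(1) in eventually_elim, auto)
    also have "\<dots> = prob {y. c y = l} * t" using integral_cell_indicator(1)[OF p_id, of l] by simp
    finally show ?thesis using that(2) by simp
  qed
  have cell_ge: "t \<le> cond_mean c p l" if "AE y in p. t \<le> y" "0 < prob {y. c y = l}" for l t
  proof -
    have "prob {y. c y = l} * t = (LINT y|p. of_bool (c y = l) * t)" using integral_cell_indicator(1)[OF p_id, of l] by simp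
    also have "\<dots> \<le> (LINT y|p. of_bool (c y = l) * y)"
      by (intro integral_mono_AE integral_cell_indicator(2) p_id integrable_const) (use that(1) in eventually_elim, auto)
    also have "\<dots> = prob {y. c y = l} * cond_mean c p l" by (rule cond_mean_mult[symmetric])
    finally show ?thesis using that(2) by simp
  qed
  have le_AE: "AE y in p. y \<le> t" if "(LINT y|p. max 0 (y - t)) = 0" for t
  proof -
    have "AE y in p. max 0 (y - t) = 0"
      using that integral_nonneg_eq_0_iff_AE[OF p_pos[of t]] by simp
    then show ?thesis by eventually_elim auto
  qed
  have ge_AE: "AE y in p. t \<le> y" if "(LINT y|p. max 0 (y - t)) = x - t" for t
  proof -
    have i: "integrable p (\<lambda>y. max 0 (y - t) - (y - t))" using p_pos p_id by simp
    have "(LINT y|p. max 0 (y - t) - (y - t)) = 0" using p_pos[of t] p_id mean that prob_space by simp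
    then have "AE y in p. max 0 (y - t) - (y - t) = 0" using integral_nonneg_eq_0_iff_AE[OF i] by simp
    then show ?thesis by eventually_elim auto
  qed
  show thesis
  proof (cases "(LINT y|p. max 0 (y - x)) = 0")
    \<comment> \<open>Here \<open>p\<close> is the point mass at \<open>x\<close>: no level has a
      gap, and the empty interval from 1 to 0 serves.\<close>
    case True
    have True': "(LINT y|p. max 0 (y - x)) = x - x" using True by simp
    have z: "?z l = x" if "0 < prob {y. c y = l}" for l
    proof -
      have "cond_mean c p l = x" using cell_le[OF le_AE[OF True] that] cell_ge[OF ge_AE[OF True'] that] by simp
      then show ?thesis by (simp add: contraction_def algebra_simps)
    qed
    have "(LINT y|p. max 0 (?z (c y) - t)) = (LINT y|p. max 0 (x - t))" for t
      by (intro integral_cong_AE borel_measurable_integrable[OF contraction_integrable[of "\<lambda>z. max 0 (z - t)"]])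
        (use AEW z in auto)
    then show thesis using prob_space by (intro that[of 1 0]) auto
  next
    case False
    define W where "W = {l. l < L \<and> 0 < prob {y. c y = l}}"
    have finW: "finite W" by (simp add: W_def)
    have AEW': "AE y in p. c y \<in> W" using AEW cL by (auto simp: W_def)
    have neW: "W \<noteq> {}"
    proof
      assume "W = {}"
      then have "AE y in p. False" using AEW' by simp
      then show False using not_empty AE_False by (metis emeasure_space_1 zero_neq_one AE_iff_null_sets null_setsD1 sets.top eventually_mono)
    qed
    define lo where "lo = Min (?z ` W)"
    define hi where "hi = Max (?z ` W)"
    have lohi: "lo \<le> ?z l" "?z l \<le> hi" if "l \<in> W" for l using that finW by (auto simp: lo_def hi_def)
    show thesis
    proof (rule that[of lo hi])
      fix t assume g: "(LINT y|p. max 0 (?z (c y) - t)) - max 0 (x - t) > 0"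
      show "lo \<le> t \<and> t \<le> hi"
      proof (rule ccontr)
        assume "\<not> (lo \<le> t \<and> t \<le> hi)"
        then consider "t < lo" | "hi < t" by linarith
        then show False
        proof cases
          case 1
          have "(LINT y|p. max 0 (?z (c y) - t)) = (LINT y|p. ?z (c y) - t)"
            by (intro integral_cong_AE borel_measurable_integrable[OF contraction_integrable[of "\<lambda>z. max 0 (z - t)"]]
              borel_measurable_integrable[OF contraction_integrable[of "\<lambda>z. z - t"]])
              (use AEW' lohi(1) 1 in \<open>auto elim!: eventually_mono intro!: max.absorb2 dest!: lohi(1)\<close>)
          also have "\<dots> = x - t" using contraction_mean contraction_integrable[of "\<lambda>z. z"] prob_space by simp
          finally show False using g by simp
        next
          case 2
          have "(LINT y|p. max 0 (?z (c y) - t)) = (LINT y|p. 0)"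
            by (intro integral_cong_AE borel_measurable_integrable[OF contraction_integrable[of "\<lambda>z. max 0 (z - t)"]])
              (use AEW' 2 in \<open>auto elim!: eventually_mono intro!: max.absorb1 dest!: lohi(2)\<close>)
          then show False using g by simp
        qed
      qed
    next
      fix t assume t: "lo \<le> t" "t \<le> hi"
      show "(LINT y|p. max 0 (y - t)) - max 0 (x - t) > 0"
      proof (rule ccontr)
        assume "\<not> (LINT y|p. max 0 (y - t)) - max 0 (x - t) > 0"
        then have eq: "(LINT y|p. max 0 (y - t)) = max 0 (x - t)" using pos_part_mean_le[OF p r, of t, unfolded mean] by linarith
        \<comment> \<open>Touching at \<open>x\<close> itself is the degenerate case already
          excluded.\<close>
        have "t \<noteq> x" using False eq by auto
        then consider "x < t" | "t < x" by linarith
        then show False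
        proof cases
          case 1
          then have AE: "AE y in p. y \<le> t" using eq by (intro le_AE) simp
          have "?z l < t" if "l \<in> W" for l
          proof -
            have "(1 - \<epsilon>) * cond_mean c p l \<le> (1 - \<epsilon>) * t" using cell_le[OF AE] that e by (intro mult_left_mono) (auto simp: W_def)
            moreover have "\<epsilon> * x < \<epsilon> * t" using 1 e by simp
            ultimately show ?thesis by (simp add: contraction_def algebra_simps)
          qed
          then have "hi < t" using finW neW by (simp add: hi_def)
          then show False using t by simp
        next
          case 2
          then have AE: "AE y in p. t \<le> y" using eq by (intro ge_AE) simp
          have "t < ?z l" if "l \<in> W" for l
          proof -
            have "(1 - \<epsilon>) * t \<le> (1 - \<epsilon>) * cond_mean c p l" using cell_ge[OF AE] that e by (intro mult_left_mono) (auto simp: W_def)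
            moreover have "\<epsilon> * t < \<epsilon> * x" using 2 e by simp
            ultimately show ?thesis by (simp add: contraction_def algebra_simps)
          qed
          then have "t < lo" using finW neW by (simp add: lo_def)
          then show False using t by simp
        qed
      qed
    qed
  qed
qed

end

text \<open>A numbering of the grid cells; \<open>a\<close> recovers the grid value, the reference
  point of the cell.\<close>

lemma grid_cell_map:
  obtains c :: "real \<Rightarrow> nat" and L :: nat and a :: "nat \<Rightarrow> real"
  where "c \<in> borel \<rightarrow>\<^sub>M count_space UNIV" "\<And>y. c y < L" "\<And>y. a (c y) = grid n y"
proof -
  obtain h where h: "bij_betw h (range (grid n)) {0..<card (range (grid n))}"
    using ex_bij_betw_finite_nat[OF finite_range_grid] by blast
  have inj: "inj_on h (range (grid n))" using h by (simp add: bij_betw_def)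
  show thesis
  proof (rule that[of "\<lambda>y. h (grid n y)" "card (range (grid n))" "inv_into (range (grid n)) h"])
    show "h (grid n y) < card (range (grid n))" for y using bij_betwE[OF h] by auto
    show "inv_into (range (grid n)) h (h (grid n y)) = grid n y" for y using inj by simp
    show "(\<lambda>y. h (grid n y)) \<in> borel \<rightarrow>\<^sub>M count_space UNIV"
    proof (rule measurable_count_space_eq2_countable[THEN iffD2], intro conjI ballI)
      fix l
      have "(\<lambda>y. h (grid n y)) -` {l} \<inter> space borel = (\<Union>z\<in>{z \<in> range (grid n). h z = l}. grid n -` {z})" by auto
      also have "\<dots> \<in> sets borel"
        using finite_range_grid measurable_sets[OF measurable_grid, of "{z}" n for z] by (intro sets.finite_UN) auto
      finally show "(\<lambda>y. h (grid n y)) -` {l} \<inter> space borel \<in> sets borel" .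
    qed auto
  qed
qed

lemma grid_distance:
  assumes r: "1 \<le> r" and p: "p \<in> prob_moment r" and n: "n \<noteq> 0"
  shows "(LINT y|p. \<bar>y - grid n y\<bar> powr r) \<le> (1 / n) powr r + (LINT y|p. indicator {y::real. n < \<bar>y\<bar>} y * \<bar>y\<bar> powr r)"
proof -
  interpret prob_space p by (rule prob_momentD[OF p])
  have m[measurable]: "(\<lambda>y::real. indicator {y::real. n < \<bar>y\<bar>} y * \<bar>y\<bar> powr r) \<in> borel_measurable p"
    by (subst measurable_cong_sets[OF prob_momentD(2)[OF p] refl]) measurable
  have i: "integrable p (\<lambda>y::real. indicator {y::real. n < \<bar>y\<bar>} y * \<bar>y\<bar> powr r)"
    by (rule Bochner_Integration.integrable_bound[OF prob_momentD(4)[OF p] m]) (auto simp: indicator_def)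
  have "(LINT y|p. \<bar>y - grid n y\<bar> powr r) \<le> (LINT y|p. (1 / n) powr r + indicator {y::real. n < \<bar>y\<bar>} y * \<bar>y\<bar> powr r)"
  proof (rule integral_mono')
    show "integrable p (\<lambda>y::real. (1 / n) powr r + indicator {y::real. n < \<bar>y\<bar>} y * \<bar>y\<bar> powr r)" using i by simp
    fix y :: real
    show "\<bar>y - grid n y\<bar> powr r \<le> (1 / n) powr r + indicator {y::real. n < \<bar>y\<bar>} y * \<bar>y\<bar> powr r"
    proof (cases "\<bar>y\<bar> \<le> n")
      case True
      then have "\<bar>y - grid n y\<bar> powr r \<le> (1 / n) powr r"
        using abs_grid_diff_le[OF n] r by (intro powr_mono2) auto
      then show ?thesis using True by simp
    qed (simp add: grid_def)
  qed simp
  also have "\<dots> = (1 / n) powr r + (LINT y|p. indicator {y::real. n < \<bar>y\<bar>} y * \<bar>y\<bar> powr r)" using i prob_space by simp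
  finally show ?thesis .
qed

section \<open>Kernels with the martingale property\<close>

text \<open>Moments and barycentres are required at every \<open>x\<close>, not just almost
  everywhere, so that sample points meet no exceptional set.
  \<open>martingale_kernel_version\<close> produces such kernels.\<close>

locale martingale_kernel =
  fixes r :: real and \<mu> :: "real measure" and k :: "real \<Rightarrow> real measure"
  assumes r: "1 \<le> r" and \<mu>: "\<mu> \<in> prob_moment r" and k[measurable]: "k \<in> borel \<rightarrow>\<^sub>M prob_algebra borel"
    and k_moment: "\<And>x. k x \<in> prob_moment r" and k_mean: "\<And>x. (LINT y|k x. y) = x"
    and bind_moment: "\<mu> \<bind> k \<in> prob_moment r"
begin

sublocale prob_space \<mu> by (rule prob_momentD[OF \<mu>])

lemma sets_\<mu>[simp, measurable_cong]: "sets \<mu> = sets borel" by (rule prob_momentD[OF \<mu>])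
lemma space_\<mu>[simp]: "space \<mu> = UNIV" by (rule prob_momentD[OF \<mu>])

lemma measurable_\<mu>_iff: "f \<in> \<mu> \<rightarrow>\<^sub>M M \<longleftrightarrow> f \<in> borel \<rightarrow>\<^sub>M M"
  by (rule arg_cong[OF measurable_cong_sets]) auto

lemma k_subprob: "k \<in> borel \<rightarrow>\<^sub>M subprob_algebra borel" by (rule measurable_prob_algebraD[OF k])

lemma kernel_integral_measurable:
  fixes h :: "real \<Rightarrow> real \<Rightarrow> real"
  assumes [measurable]: "(\<lambda>(x, y). h x y) \<in> borel_measurable (borel \<Otimes>\<^sub>M borel)" and nonneg: "\<And>x y. 0 \<le> h x y"
  shows "(\<lambda>x. LINT y|k x. h x y) \<in> borel_measurable borel"
proof -
  have "(LINT y|k x. h x y) = enn2real (\<integral>\<^sup>+y. ennreal (h x y) \<partial>k x)" for x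
  proof (rule integral_eq_nn_integral)
    have "h x \<in> borel_measurable borel"
      using measurable_Pair2[OF assms(1), of x] by simp
    then show "h x \<in> borel_measurable (k x)" by (simp add: measurable_cong_sets[OF prob_momentD(2)[OF k_moment] refl])
  qed (simp add: nonneg)
  moreover have "(\<lambda>x. \<integral>\<^sup>+y. ennreal (h x y) \<partial>k x) \<in> borel_measurable borel"
    by (rule nn_integral_measurable_subprob_algebra2[OF _ k_subprob]) measurable
  ultimately show ?thesis by simp
qed

lemma kernel_integral:
  fixes h :: "real \<Rightarrow> real"
  assumes "integrable (\<mu> \<bind> k) h"
  shows "integrable \<mu> (\<lambda>x. LINT y|k x. h y)" "(LINT x|\<mu>. LINT y|k x. h y) = (LINT y|(\<mu> \<bind> k). h y)"
  using integral_bind_kernel(2,3)[OF _ _ assms] k_subprob by (auto simp: measurable_\<mu>_iff)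

text \<open>The potential of \<open>k x\<close> minus that of the point mass at \<open>x\<close>.
  Its \<mu>-average is \<open>mean_gap\<close>, the difference of the potentials of the two
  marginals.\<close>

definition "potential_gap x t = (LINT y|k x. max 0 (y - t)) - max 0 (x - t)"

definition "mean_gap t = (LINT y|(\<mu> \<bind> k). max 0 (y - t)) - (LINT x|\<mu>. max 0 (x - t))"

lemma potential_gap_nonneg: "0 \<le> potential_gap x t"
  using pos_part_mean_le[OF k_moment[of x] r, of t] by (simp add: k_mean potential_gap_def)

lemma potential_gap_integrable: "integrable \<mu> (\<lambda>x. potential_gap x t)"
  and integral_potential_gap: "(LINT x|\<mu>. potential_gap x t) = mean_gap t"
  using kernel_integral[OF prob_moment_integrable_pos_part[OF bind_moment r, of t]]
    prob_moment_integrable_pos_part[OF \<mu> r, of t]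
  by (simp_all add: potential_gap_def mean_gap_def)

lemma pos_part_integral_lipschitz:
  assumes "p \<in> prob_moment r"
  shows "\<bar>(LINT y|p. max 0 (y - s)) - (LINT y|p. max 0 (y - t))\<bar> \<le> \<bar>s - t\<bar>"
proof -
  interpret p: prob_space p by (rule prob_momentD[OF assms])
  note i = prob_moment_integrable_pos_part[OF assms r]
  have "\<bar>(LINT y|p. max 0 (y - s)) - (LINT y|p. max 0 (y - t))\<bar> = \<bar>LINT y|p. max 0 (y - s) - max 0 (y - t)\<bar>"
    using i by simp
  also have "\<dots> \<le> (LINT y|p. \<bar>max 0 (y - s) - max 0 (y - t)\<bar>)" by (rule integral_abs_bound)
  also have "\<dots> \<le> (LINT y|p. \<bar>s - t\<bar>)" using i by (intro integral_mono) auto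
  finally show ?thesis using p.prob_space by simp
qed

lemma continuous_potential_gap: "continuous_on UNIV (potential_gap x)"
  and continuous_mean_gap: "continuous_on UNIV mean_gap"
proof -
  have L: "continuous_on UNIV (\<lambda>t. LINT y|p. max 0 (y - t))" if "p \<in> prob_moment r" for p
    by (rule lipschitz_on_continuous_on[of 1], rule lipschitz_onI)
      (use pos_part_integral_lipschitz[OF that] in \<open>auto simp: dist_real_def\<close>)
  show "continuous_on UNIV (potential_gap x)" unfolding potential_gap_def[abs_def]
    by (intro continuous_intros L k_moment)
  show "continuous_on UNIV mean_gap" unfolding mean_gap_def[abs_def]
    by (intro continuous_intros L \<mu> bind_moment)
qed

lemma mean_gap_nonneg: "0 \<le> mean_gap t"
  unfolding integral_potential_gap[symmetric] using potential_gap_nonneg by simp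

text \<open>No mass crosses a level \<open>t\<close> at which the potentials of the two marginals touch.\<close>

lemma AE_mean_gap_pos: "AE x in \<mu>. \<forall>t. 0 < potential_gap x t \<longrightarrow> 0 < mean_gap t"
proof -
  define Z where "Z = {t. mean_gap t \<le> 0}"
  \<comment> \<open>A countable dense set of touching levels leaves countably many exceptional sets;
    continuity of \<open>potential_gap x\<close> then reaches all touching levels.\<close>
  obtain T where T: "countable T" "T \<subseteq> Z" "Z \<subseteq> closure T" using separable by blast
  have "AE x in \<mu>. \<forall>t\<in>T. potential_gap x t = 0"
  proof (subst AE_ball_countable[OF T(1)], intro ballI)
    fix t assume "t \<in> T"
    then have "mean_gap t = 0" using T(2) mean_gap_nonneg[of t] by (auto simp: Z_def intro: antisym)
    then show "AE x in \<mu>. potential_gap x t = 0"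
      using integral_nonneg_eq_0_iff_AE[OF potential_gap_integrable[of t]] potential_gap_nonneg
      by (simp add: integral_potential_gap)
  qed
  then show ?thesis
  proof eventually_elim
    case (elim x)
    have "closed {t. potential_gap x t = 0}"
      using continuous_closed_vimage[of "{0}" "potential_gap x"] continuous_potential_gap[of x]
      by (simp add: continuous_on_eq_continuous_at vimage_def)
    then have "closure T \<subseteq> {t. potential_gap x t = 0}" using elim by (intro closure_minimal) auto
    then have "potential_gap x t = 0" if "mean_gap t \<le> 0" for t using T(3) that by (auto simp: Z_def)
    then show ?case by (metis less_irrefl not_le)
  qed
qed

lemma measure_k_space[simp]: "measure (k x) (space (k x)) = 1"
  by (rule prob_space.prob_space[OF prob_momentD(1)[OF k_moment]])

lemma integral_const_k: "(LINT y|k x. a) = (a::real)" "integrable (k x) (\<lambda>_. a)"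
  using prob_space.prob_space[OF prob_momentD(1)[OF k_moment[of x]]]
    finite_measure.integrable_const[OF prob_space.finite_measure[OF prob_momentD(1)[OF k_moment[of x]]]]
  by (auto simp: prob_momentD(3)[OF k_moment])

text \<open>The growth bound for the cost at \<open>k x\<close>, up to its constant.\<close>

definition "moment_bound x = 1 + \<bar>x\<bar> powr r + (LINT y|k x. \<bar>y\<bar> powr r)"

lemma moment_bound_ge_1: "1 \<le> moment_bound x"
  by (simp add: moment_bound_def add_increasing2)

lemma moment_bound_integrable: "integrable \<mu> moment_bound"
  unfolding moment_bound_def[abs_def]
  using prob_momentD(4)[OF \<mu>] kernel_integral(1)[OF prob_momentD(4)[OF bind_moment]] by simp

lemma centered_moment_le: "(LINT y|k x. \<bar>y - x\<bar> powr r) \<le> 2 powr r * moment_bound x"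
proof -
  have "(LINT y|k x. \<bar>y - x\<bar> powr r) \<le> (LINT y|k x. 2 powr r * (\<bar>y\<bar> powr r + \<bar>x\<bar> powr r))"
    using abs_add_powr_le[of r y "- x" for y] r prob_momentD(4)[OF k_moment, of x] integral_const_k(2)
    by (intro integral_mono prob_moment_integrable_diff_powr[OF k_moment r]) auto
  also have "\<dots> = 2 powr r * ((LINT y|k x. \<bar>y\<bar> powr r) + \<bar>x\<bar> powr r)"
    using prob_momentD(4)[OF k_moment, of x] integral_const_k by simp
  also have "\<dots> \<le> 2 powr r * moment_bound x" by (intro mult_left_mono) (auto simp: moment_bound_def)
  finally show ?thesis .
qed

section \<open>Regular points and the contracted kernel\<close>

context
  fixes \<epsilon> :: real and c :: "real \<Rightarrow> nat" and L :: nat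
  assumes c: "c \<in> borel \<rightarrow>\<^sub>M count_space UNIV" and cL: "\<And>y. c y < L" and e: "0 < \<epsilon>" "\<epsilon> \<le> 1"
begin

definition "contracted_gap x t = (LINT y|k x. max 0 (contraction \<epsilon> c (k x) x (c y) - t)) - max 0 (x - t)"

lemma contraction_measurable[measurable]: "(\<lambda>x. contraction \<epsilon> c (k x) x l) \<in> borel_measurable borel"
proof -
  have [measurable]: "(\<lambda>y. of_bool (c y = l) :: real) \<in> borel_measurable borel"
    by (rule measurable_compose[OF c, of "\<lambda>l'. of_bool (l' = l)"]) simp
  have [measurable]: "(\<lambda>x. LINT y|k x. of_bool (c y = l) * y) \<in> borel_measurable borel"
    by (rule measurable_compose[OF k_subprob integral_measurable_subprob_algebra]) measurable
  have [measurable]: "(\<lambda>x. measure (k x) {y. c y = l}) \<in> borel_measurable borel"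
    by (rule measurable_compose[OF k measurable_measure_prob_algebra])
      (use measurable_sets[OF c, of "{l}"] in \<open>simp add: vimage_def\<close>)
  show ?thesis unfolding contraction_def cond_mean_def by measurable
qed

lemma label_fun_measurable:
  assumes [measurable]: "\<And>l. (\<lambda>x. f x l) \<in> borel_measurable borel"
  shows "(\<lambda>(x, y). f x (c y) :: real) \<in> borel_measurable (borel \<Otimes>\<^sub>M borel)"
  unfolding case_prod_beta
  by (rule measurable_compose_countable[where f="\<lambda>l z. f (fst z) l" and g="\<lambda>z. c (snd z)", OF _ measurable_compose[OF measurable_snd c]]) measurable

lemma contracted_gap_measurable[measurable]: "(\<lambda>x. contracted_gap x t) \<in> borel_measurable borel"
proof -
  have [measurable]: "(\<lambda>x. LINT y|k x. max 0 (contraction \<epsilon> c (k x) x (c y) - t)) \<in> borel_measurable borel"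
    by (rule kernel_integral_measurable, rule label_fun_measurable) auto
  show ?thesis unfolding contracted_gap_def by measurable
qed

lemma contracted_gap_continuous: "continuous_on UNIV (contracted_gap x)"
proof -
  have "(LINT y|k x. max 0 (contraction \<epsilon> c (k x) x (c y) - t))
      = (\<Sum>l<L. measure (k x) {y. c y = l} * max 0 (contraction \<epsilon> c (k x) x l - t))" for t
    by (rule integral_finite_cells_const(2)[OF prob_momentD(1,2)[OF k_moment] c cL])
  then show ?thesis unfolding contracted_gap_def[abs_def] by (simp, intro continuous_intros)
qed

text \<open>Points whose contracted gap is confined to a compact set of levels at which the marginal
  potentials differ by at least \<open>1 / real (Suc m)\<close>. Rational levels make this a
  countable intersection of Borel sets.\<close>

definition "regular_set m = {x. \<forall>t\<in>\<rat>. 0 < contracted_gap x t \<longrightarrow> \<bar>t\<bar> \<le> real (Suc m) \<and> 1 / real (Suc m) \<le> mean_gap t}"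

lemma regular_set_sets[measurable]: "regular_set m \<in> sets borel"
proof -
  have "regular_set m = (\<Inter>t\<in>\<rat>. {x \<in> space borel. 0 < contracted_gap x t \<longrightarrow> \<bar>t\<bar> \<le> real (Suc m) \<and> 1 / real (Suc m) \<le> mean_gap t})"
    by (auto simp: regular_set_def)
  also have "\<dots> \<in> sets borel"
    by (rule sets.countable_INT'[OF countable_rat]) auto
  finally show ?thesis .
qed

text \<open>The levels with positive contracted gap form an open set, in which the rational ones are
  dense, and the constraint on the level is closed.\<close>

lemma regular_setD:
  assumes x: "x \<in> regular_set m" and t: "0 < contracted_gap x t"
  shows "\<bar>t\<bar> \<le> real (Suc m)" "1 / real (Suc m) \<le> mean_gap t"
proof -
  define U where "U = {t. 0 < contracted_gap x t}"
  define K where "K = {t. \<bar>t\<bar> \<le> real (Suc m)} \<inter> {t. 1 / real (Suc m) \<le> mean_gap t}"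
  have U: "open U" unfolding U_def
    using contracted_gap_continuous[of x] by (intro open_Collect_less) auto
  have K: "closed K" unfolding K_def
    using continuous_mean_gap by (intro closed_Int closed_Collect_le continuous_intros) auto
  have "U \<subseteq> closure (U \<inter> \<rat>)"
    using open_Int_closure_subset[OF U, of "\<rat>"] Rats_closure_real by auto
  also have "\<dots> \<subseteq> K" using K x by (intro closure_minimal) (auto simp: U_def K_def regular_set_def)
  finally have "t \<in> K" using t by (auto simp: U_def)
  then show "\<bar>t\<bar> \<le> real (Suc m)" "1 / real (Suc m) \<le> mean_gap t" by (auto simp: K_def)
qed

lemma regular_set_mono: "m \<le> n \<Longrightarrow> regular_set m \<subseteq> regular_set n"
proof
  fix x assume mn: "m \<le> n" and x: "x \<in> regular_set m"
  have "1 / real (Suc n) \<le> 1 / real (Suc m)" using mn by (intro divide_left_mono) auto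
  moreover have "real (Suc m) \<le> real (Suc n)" using mn by simp
  ultimately have "\<bar>t\<bar> \<le> real (Suc n) \<and> 1 / real (Suc n) \<le> mean_gap t"
    if "\<bar>t\<bar> \<le> real (Suc m) \<and> 1 / real (Suc m) \<le> mean_gap t" for t
    using that by (meson order_trans)
  then show "x \<in> regular_set n" using x unfolding regular_set_def by blast
qed

text \<open>By \<open>contraction_support\<close> the contracted gap lives on a compact interval on
  which \<open>potential_gap x\<close> is positive. For almost every \<open>x\<close> this makes
  \<open>mean_gap\<close> positive there, and continuity bounds it away from zero.\<close>

lemma AE_regular: "AE x in \<mu>. \<exists>m. x \<in> regular_set m"
  using AE_mean_gap_pos
proof eventually_elim
  case (elim x)
  obtain lo hi where lh: "\<And>t. 0 < contracted_gap x t \<Longrightarrow> lo \<le> t \<and> t \<le> hi"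
    "\<And>t. lo \<le> t \<Longrightarrow> t \<le> hi \<Longrightarrow> 0 < potential_gap x t"
    unfolding contracted_gap_def potential_gap_def
    using contraction_support[OF r k_moment k_mean c cL e, of x] by metis
  show ?case
  proof (cases "lo \<le> hi")
    case True
    have "continuous_on {lo..hi} mean_gap" by (rule continuous_on_subset[OF continuous_mean_gap]) auto
    then obtain t0 where t0: "t0 \<in> {lo..hi}" "\<And>t. t \<in> {lo..hi} \<Longrightarrow> mean_gap t0 \<le> mean_gap t"
      using continuous_attains_inf[of "{lo..hi}" mean_gap] True by auto
    have pos: "0 < mean_gap t0" using elim lh(2) t0(1) by auto
    obtain m1 where m1: "1 / real (Suc m1) < mean_gap t0" using pos nat_approx_posE by blast
    obtain m2 :: nat where m2: "max \<bar>lo\<bar> \<bar>hi\<bar> \<le> real m2" using real_arch_simple by blast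
    have M: "1 / real (Suc (max m1 m2)) \<le> 1 / real (Suc m1)" "real m2 \<le> real (Suc (max m1 m2))"
      by (intro divide_left_mono) auto
    have "\<bar>t\<bar> \<le> real (Suc (max m1 m2)) \<and> 1 / real (Suc (max m1 m2)) \<le> mean_gap t" if "0 < contracted_gap x t" for t
    proof
      have t: "lo \<le> t" "t \<le> hi" using lh(1)[OF that] by auto
      then have "\<bar>t\<bar> \<le> max \<bar>lo\<bar> \<bar>hi\<bar>" by auto
      then show "\<bar>t\<bar> \<le> real (Suc (max m1 m2))" using m2 M(2) by linarith
      have "mean_gap t0 \<le> mean_gap t" using t t0(2) by auto
      then show "1 / real (Suc (max m1 m2)) \<le> mean_gap t" using M(1) m1 by linarith
    qed
    then have "x \<in> regular_set (max m1 m2)" unfolding regular_set_def by blast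
    then show ?thesis by blast
  next
    case False
    then have "\<not> 0 < contracted_gap x t" for t using lh(1)[of t] by linarith
    then have "x \<in> regular_set 0" by (simp add: regular_set_def)
    then show ?thesis by blast
  qed
qed

text \<open>At an irregular point everything is collapsed to \<open>x\<close>. This costs a full
  moment, but it confines the gaps of all points to one compact set of levels, and irregular points
  weigh little for large \<open>m\<close>.\<close>

definition "target m x l = (if x \<in> regular_set m then contraction \<epsilon> c (k x) x l else x)"

definition "transport_cost m x = (LINT y|k x. \<bar>y - target m x (c y)\<bar> powr r)"

lemma target_measurable[measurable]: "(\<lambda>x. target m x l) \<in> borel_measurable borel"
  unfolding target_def by measurable

lemma target_integrable: "integrable (k x) (\<lambda>y. F (target m x (c y)))" for F :: "real \<Rightarrow> real"
  by (rule integral_finite_cells_const(1)[OF prob_momentD(1,2)[OF k_moment] c cL])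

lemma target_mean: "(LINT y|k x. target m x (c y)) = x"
  using contraction_mean[OF r k_moment k_mean c cL e, of x]
  by (cases "x \<in> regular_set m") (simp_all add: target_def)

lemma target_potential:
  "(LINT y|k x. max 0 (target m x (c y) - t)) - max 0 (x - t) \<le> (1 - \<epsilon>) * potential_gap x t"
proof (cases "x \<in> regular_set m")
  case True
  then show ?thesis using contraction_potential[OF r k_moment k_mean c cL e, of x t] by (simp add: target_def potential_gap_def)
next
  case False
  then show ?thesis using e potential_gap_nonneg[of x t] by (simp add: target_def integral_const_k)
qed

text \<open>Off the compact set of levels the comparison holds for each \<open>x\<close> separately,
  so it passes to every sample without any averaging.\<close>

lemma target_potential_outside:
  assumes "\<not> (\<bar>t\<bar> \<le> real (Suc m) \<and> 1 / real (Suc m) \<le> mean_gap t)"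
  shows "(LINT y|k x. max 0 (target m x (c y) - t)) \<le> max 0 (x - t)"
proof (cases "x \<in> regular_set m")
  case True
  then have "\<not> 0 < contracted_gap x t" using regular_setD[OF True, of t] assms by blast
  then have "(LINT y|k x. max 0 (contraction \<epsilon> c (k x) x (c y) - t)) \<le> max 0 (x - t)"
    unfolding contracted_gap_def by linarith
  then show ?thesis using True by (simp add: target_def)
qed (simp add: target_def integral_const_k)

lemma target_potential_bounds:
  "0 \<le> (LINT y|k x. max 0 (target m x (c y) - t))"
  "(LINT y|k x. max 0 (target m x (c y) - t)) \<le> (LINT y|k x. max 0 (y - t))"
proof -
  show "0 \<le> (LINT y|k x. max 0 (target m x (c y) - t))" by simp
  have "(1 - \<epsilon>) * potential_gap x t \<le> potential_gap x t" using e potential_gap_nonneg[of x t] by (simp add: mult_left_le_one_le)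
  then show "(LINT y|k x. max 0 (target m x (c y) - t)) \<le> (LINT y|k x. max 0 (y - t))"
    using target_potential[where m=m and x=x and t=t] by (simp add: potential_gap_def)
qed

lemma target_potential_integrable: "integrable \<mu> (\<lambda>x. LINT y|k x. max 0 (target m x (c y) - t))"
proof (rule Bochner_Integration.integrable_bound[OF kernel_integral(1)[OF prob_moment_integrable_pos_part[OF bind_moment r, of t]]])
  show "(\<lambda>x. LINT y|k x. max 0 (target m x (c y) - t)) \<in> borel_measurable \<mu>"
    unfolding measurable_\<mu>_iff by (rule kernel_integral_measurable, rule label_fun_measurable) auto
qed (use target_potential_bounds in auto)

lemma transport_cost_measurable: "transport_cost m \<in> borel_measurable borel"
proof -
  have [measurable]: "(\<lambda>(x, y). target m x (c y)) \<in> borel_measurable (borel \<Otimes>\<^sub>M borel)"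
    by (rule label_fun_measurable) simp
  show ?thesis unfolding transport_cost_def by (rule kernel_integral_measurable) auto
qed

lemma transport_cost_nonneg: "0 \<le> transport_cost m x" by (simp add: transport_cost_def)

text \<open>Regular points pay for the mesh, the tail and the pull; irregular ones for the collapse
  to \<open>x\<close>.\<close>

lemma transport_cost_le:
  assumes a: "\<And>y. a (c y) = grid n y" and n: "n \<noteq> 0"
  shows "transport_cost m x \<le> 2 powr r * (2 * 2 powr r * ((1 / n) powr r + (LINT y|k x. indicator {y. n < \<bar>y\<bar>} y * \<bar>y\<bar> powr r))
      + \<epsilon> powr r * (2 powr r * moment_bound x)) + indicator (- regular_set m) x * (2 powr r * moment_bound x)"
    (is "_ \<le> ?U + _")
proof (cases "x \<in> regular_set m")
  case True
  have "transport_cost m x \<le> 2 powr r * (2 * 2 powr r * (LINT y|k x. \<bar>y - grid n y\<bar> powr r) + \<epsilon> powr r * (LINT y|k x. \<bar>y - x\<bar> powr r))"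
    using contraction_distance[OF r k_moment k_mean c cL e, of x a] True by (simp add: transport_cost_def target_def a)
  also have "\<dots> \<le> ?U"
    by (intro mult_left_mono add_mono grid_distance[OF r k_moment n] centered_moment_le) auto
  finally show ?thesis using True by simp
next
  case False
  have "0 \<le> ?U" using moment_bound_ge_1[of x]
    by (intro mult_nonneg_nonneg add_nonneg_nonneg integral_nonneg_AE) (auto simp: indicator_def)
  then show ?thesis using False centered_moment_le[of x] by (simp add: transport_cost_def target_def)
qed

lemma transport_cost_integrable:
  assumes a: "\<And>y. a (c y) = grid n y" and n: "n \<noteq> 0"
  shows "integrable \<mu> (transport_cost m)"
    and "(LINT x|\<mu>. transport_cost m x) \<le> 2 powr r * (2 * 2 powr r * ((1 / n) powr r + (LINT y|(\<mu> \<bind> k). indicator {y::real. n < \<bar>y\<bar>} y * \<bar>y\<bar> powr r))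
      + \<epsilon> powr r * (2 powr r * (LINT x|\<mu>. moment_bound x))) + (LINT x|\<mu>. indicator (- regular_set m) x * (2 powr r * moment_bound x))"
proof -
  let ?t = "\<lambda>y::real. indicator {y. real n < \<bar>y\<bar>} y * \<bar>y\<bar> powr r"
  have "integrable (\<mu> \<bind> k) ?t"
    by (rule prob_moment_integrable[OF bind_moment, where A=0 and B=1]) (auto simp: indicator_def)
  note t = kernel_integral[OF this]
  have i: "integrable \<mu> (\<lambda>x. indicator (- regular_set m) x * (2 powr r * moment_bound x))"
    by (rule Bochner_Integration.integrable_bound[OF integrable_mult_right[OF moment_bound_integrable, of "2 powr r"]])
      (use borel_measurable_integrable[OF moment_bound_integrable] in \<open>auto simp: indicator_def measurable_\<mu>_iff\<close>)
  let ?U = "\<lambda>x. 2 powr r * (2 * 2 powr r * ((1 / n) powr r + (LINT y|k x. ?t y)) + \<epsilon> powr r * (2 powr r * moment_bound x))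
      + indicator (- regular_set m) x * (2 powr r * moment_bound x)"
  have iU: "integrable \<mu> ?U" using t(1) i moment_bound_integrable by simp
  show int: "integrable \<mu> (transport_cost m)"
    by (rule Bochner_Integration.integrable_bound[OF iU])
      (use transport_cost_le[OF a n, where m=m] transport_cost_nonneg transport_cost_measurable in
        \<open>auto simp: measurable_\<mu>_iff intro!: AE_I2 order_trans[OF _ abs_ge_self]\<close>)
  have "(LINT x|\<mu>. transport_cost m x) \<le> (LINT x|\<mu>. ?U x)"
    by (rule integral_mono[OF int iU transport_cost_le[OF a n]])
  also have "\<dots> = 2 powr r * (2 * 2 powr r * ((1 / n) powr r + (LINT y|(\<mu> \<bind> k). ?t y))
      + \<epsilon> powr r * (2 powr r * (LINT x|\<mu>. moment_bound x))) + (LINT x|\<mu>. indicator (- regular_set m) x * (2 powr r * moment_bound x))"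
    using t i moment_bound_integrable prob_space by simp
  finally show "(LINT x|\<mu>. transport_cost m x) \<le> 2 powr r * (2 * 2 powr r * ((1 / n) powr r + (LINT y|(\<mu> \<bind> k). ?t y))
      + \<epsilon> powr r * (2 powr r * (LINT x|\<mu>. moment_bound x))) + (LINT x|\<mu>. indicator (- regular_set m) x * (2 powr r * moment_bound x))" .
qed

lemma irregular_moment_tendsto_0:
  "(\<lambda>m. LINT x|\<mu>. indicator (- regular_set m) x * (2 powr r * moment_bound x)) \<longlonglongrightarrow> 0"
proof -
  have [measurable]: "moment_bound \<in> borel_measurable borel"
    using borel_measurable_integrable[OF moment_bound_integrable] by (simp add: measurable_\<mu>_iff)
  have "(\<lambda>m. LINT x|\<mu>. indicator (- regular_set m) x * (2 powr r * moment_bound x)) \<longlonglongrightarrow> (LINT x|\<mu>. 0)"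
  proof (rule integral_dominated_convergence[where w="\<lambda>x. 2 powr r * \<bar>moment_bound x\<bar>"])
    show "AE x in \<mu>. (\<lambda>m. indicator (- regular_set m) x * (2 powr r * moment_bound x)) \<longlonglongrightarrow> 0"
      using AE_regular
    proof eventually_elim
      case (elim x)
      then obtain m0 where m0: "x \<in> regular_set m0" by blast
      show ?case
      proof (rule tendsto_eventually)
        show "\<forall>\<^sub>F m in sequentially. indicator (- regular_set m) x * (2 powr r * moment_bound x) = 0"
          using eventually_ge_at_top[of m0]
        proof eventually_elim
          case (elim m)
          then have "x \<in> regular_set m" using m0 regular_set_mono by blast
          then show ?case by simp
        qed
      qed
    qed
    show "(\<lambda>x. indicator (- regular_set m) x * (2 powr r * moment_bound x)) \<in> borel_measurable \<mu>" for m
      unfolding measurable_\<mu>_iff by measurable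
  qed (use moment_bound_integrable in \<open>auto simp: abs_mult indicator_def\<close>)
  then show ?thesis by simp
qed

text \<open>\<open>huber R\<close> is Lipschitz, and
  \<open>u \<le> \<theta> + \<theta> powr (1 - r) * u powr r\<close> converts the first power of the
  distance into the r-th at the price of a free constant \<open>\<theta>\<close>.\<close>

lemma huber_target_le:
  assumes R: "0 \<le> R" and \<theta>: "0 < \<theta>"
  shows "\<bar>(LINT y|k x. huber R y) - (LINT y|k x. huber R (target m x (c y)))\<bar> \<le> 2 * R * (\<theta> + \<theta> powr (1 - r) * transport_cost m x)"
proof -
  have m[measurable]: "(\<lambda>y. target m x (c y)) \<in> borel_measurable (k x)"
    using borel_measurable_integrable[OF target_integrable[where x=x and m=m and F="\<lambda>z. z"]] .
  have id[measurable]: "(\<lambda>y. y) \<in> borel_measurable (k x)" using borel_measurable_integrable[OF prob_moment_integrable_id[OF k_moment r]] .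
  have i: "integrable (k x) (\<lambda>y. \<bar>y - target m x (c y)\<bar> powr r)"
  proof -
    have "integrable (k x) (\<lambda>y. 2 powr r * (\<bar>y\<bar> powr r + \<bar>target m x (c y)\<bar> powr r))"
      using prob_momentD(4)[OF k_moment] target_integrable[where x=x and m=m and F="\<lambda>z. \<bar>z\<bar> powr r"] by simp
    then show ?thesis
      by (rule Bochner_Integration.integrable_bound) (use abs_add_powr_le[of r y "- target m x (c y)" for y] r in auto)
  qed
  have pw: "u \<le> \<theta> + \<theta> powr (1 - r) * u powr r" if "0 \<le> u" for u
  proof (cases "u \<le> \<theta>")
    case False
    have "\<theta> powr (r - 1) \<le> u powr (r - 1)" using False \<theta> r by (intro powr_mono2) auto
    then have "u * \<theta> powr (r - 1) \<le> u * u powr (r - 1)" using that by (rule mult_left_mono)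
    also have "\<dots> = u powr r" using False \<theta> by (simp add: powr_mult_base)
    finally have "\<theta> powr (1 - r) * (u * \<theta> powr (r - 1)) \<le> \<theta> powr (1 - r) * u powr r" by (rule mult_left_mono) simp
    moreover have "\<theta> powr (1 - r) * (u * \<theta> powr (r - 1)) = u * (\<theta> powr (1 - r) * \<theta> powr (r - 1))" by simp
    moreover have "\<theta> powr (1 - r) * \<theta> powr (r - 1) = 1" using \<theta> by (simp flip: powr_add)
    ultimately show ?thesis using \<theta> by simp
  qed (use \<theta> in \<open>simp add: add_increasing2\<close>)
  note ih = prob_moment_integrable_huber[OF k_moment r R, of x] and it = target_integrable[where x=x and m=m and F="huber R"]
  have "\<bar>(LINT y|k x. huber R y) - (LINT y|k x. huber R (target m x (c y)))\<bar> = \<bar>LINT y|k x. huber R y - huber R (target m x (c y))\<bar>"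
    using ih it by simp
  also have "\<dots> \<le> (LINT y|k x. \<bar>huber R y - huber R (target m x (c y))\<bar>)" by (rule integral_abs_bound)
  also have "\<dots> \<le> (LINT y|k x. 2 * R * (\<theta> + \<theta> powr (1 - r) * \<bar>y - target m x (c y)\<bar> powr r))"
  proof (rule integral_mono)
    show "integrable (k x) (\<lambda>y. \<bar>huber R y - huber R (target m x (c y))\<bar>)" using ih it by simp
    show "integrable (k x) (\<lambda>y. 2 * R * (\<theta> + \<theta> powr (1 - r) * \<bar>y - target m x (c y)\<bar> powr r))" using i integral_const_k(2) by simp
    fix y
    have "\<bar>huber R y - huber R (target m x (c y))\<bar> \<le> 2 * R * \<bar>y - target m x (c y)\<bar>" by (rule huber_lipschitz[OF R])
    also have "\<dots> \<le> 2 * R * (\<theta> + \<theta> powr (1 - r) * \<bar>y - target m x (c y)\<bar> powr r)" using R by (intro mult_left_mono pw) auto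
    finally show "\<bar>huber R y - huber R (target m x (c y))\<bar> \<le> 2 * R * (\<theta> + \<theta> powr (1 - r) * \<bar>y - target m x (c y)\<bar> powr r)" .
  qed
  also have "\<dots> = 2 * R * (\<theta> + \<theta> powr (1 - r) * transport_cost m x)"
    using i integral_const_k by (simp add: transport_cost_def)
  finally show ?thesis .
qed

lemma huber_target_integrable:
  assumes R: "0 \<le> R" and int: "integrable \<mu> (transport_cost m)"
  shows "integrable \<mu> (\<lambda>x. LINT y|k x. huber R (target m x (c y)))"
proof -
  have h0: "0 \<le> huber R z" for z using huber_ge[of 0 R z] R by simp
  have "integrable \<mu> (\<lambda>x. (LINT y|k x. huber R y) + 2 * R * (1 + 1 powr (1 - r) * transport_cost m x))"
    using kernel_integral(1)[OF prob_moment_integrable_huber[OF bind_moment r R]] int by simp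
  then show ?thesis
  proof (rule Bochner_Integration.integrable_bound)
    show "(\<lambda>x. LINT y|k x. huber R (target m x (c y))) \<in> borel_measurable \<mu>"
      unfolding measurable_\<mu>_iff using h0 by (intro kernel_integral_measurable label_fun_measurable) auto
    have "norm (LINT y|k x. huber R (target m x (c y))) \<le> norm ((LINT y|k x. huber R y) + 2 * R * (1 + 1 powr (1 - r) * transport_cost m x))" for x
    proof -
      have "0 \<le> (LINT y|k x. huber R (target m x (c y)))" using h0 by simp
      then show ?thesis using huber_target_le[OF R zero_less_one, where x=x and m=m] by (simp add: abs_le_iff)
    qed
    then show "AE x in \<mu>. norm (LINT y|k x. huber R (target m x (c y))) \<le> norm ((LINT y|k x. huber R y) + 2 * R * (1 + 1 powr (1 - r) * transport_cost m x))"
      by simp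
  qed
qed

end

text \<open>One index \<open>n\<close> sets both the grid and the pull
  \<open>\<epsilon> = 1 / n\<close>. Only then is \<open>m\<close> chosen, because the regular sets
  depend on both.\<close>

lemma exists_small_transport:
  assumes "0 < \<theta>"
  obtains \<epsilon> c L m where "c \<in> borel \<rightarrow>\<^sub>M count_space UNIV" "\<And>y. c y < (L::nat)" "0 < \<epsilon>" "\<epsilon> \<le> 1"
    "integrable \<mu> (transport_cost \<epsilon> c m)" "(LINT x|\<mu>. transport_cost \<epsilon> c m x) < \<theta>"
proof -
  define M where "M = (LINT x|\<mu>. moment_bound x)"
  define u where "u n = 2 powr r * (2 * 2 powr r * ((1 / n) powr r + (LINT y|(\<mu> \<bind> k). indicator {y::real. n < \<bar>y\<bar>} y * \<bar>y\<bar> powr r))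
      + (1 / n) powr r * (2 powr r * M))" for n :: nat
  have p0: "(\<lambda>n. (1 / real n) powr r) \<longlonglongrightarrow> 0 powr r"
    using lim_1_over_n r by (intro tendsto_powr2) (auto intro!: always_eventually)
  have t0: "(\<lambda>n::nat. LINT y|(\<mu> \<bind> k). indicator {y::real. n < \<bar>y\<bar>} y * \<bar>y\<bar> powr r) \<longlonglongrightarrow> 0"
    by (rule tail_moment_tendsto_0[OF prob_momentD(4,2)[OF bind_moment]])
  have "u \<longlonglongrightarrow> 2 powr r * (2 * 2 powr r * (0 powr r + 0) + 0 powr r * (2 powr r * M))"
    unfolding u_def by (intro tendsto_intros p0 t0)
  then have "u \<longlonglongrightarrow> 0" by simp
  then have "\<forall>\<^sub>F n in sequentially. u n < \<theta> / 2" using assms by (intro order_tendstoD(2)) auto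
  then obtain n where n: "n \<noteq> 0" "u n < \<theta> / 2"
    using eventually_conj[OF _ eventually_gt_at_top[of 0]] by (metis (mono_tags, lifting) eventually_sequentially le_refl less_irrefl)
  obtain c L a where c: "c \<in> borel \<rightarrow>\<^sub>M count_space UNIV" "\<And>y. c y < (L::nat)" and a: "\<And>y. a (c y) = grid n y"
    using grid_cell_map by metis
  have e: "0 < 1 / real n" "1 / real n \<le> 1" using n by auto
  have "\<forall>\<^sub>F m in sequentially. (LINT x|\<mu>. indicator (- regular_set (1 / n) c m) x * (2 powr r * moment_bound x)) < \<theta> / 2"
    by (rule order_tendstoD(2)[OF irregular_moment_tendsto_0[OF c e]]) (use assms in simp)
  then obtain m where m: "(LINT x|\<mu>. indicator (- regular_set (1 / n) c m) x * (2 powr r * moment_bound x)) < \<theta> / 2"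
    by (auto simp: eventually_sequentially)
  show thesis
  proof (rule that[OF c e, of m])
    show "integrable \<mu> (transport_cost (1 / n) c m)" by (rule transport_cost_integrable(1)[OF c e a n(1)])
    have "(LINT x|\<mu>. transport_cost (1 / n) c m x) \<le> u n + (LINT x|\<mu>. indicator (- regular_set (1 / n) c m) x * (2 powr r * moment_bound x))"
      using transport_cost_integrable(2)[OF c e a n(1), of m] by (simp add: u_def M_def)
    then show "(LINT x|\<mu>. transport_cost (1 / n) c m x) < \<theta>" using n(2) m by simp
  qed
qed

end

section \<open>Comparison of two martingale kernels\<close>

text \<open>Carries the growth bound over to a competitor that may be far from the original
  kernel.\<close>

lemma coupling_moment_le:
  assumes \<gamma>: "\<gamma> \<in> couplings p q" and r: "1 \<le> r" and p: "p \<in> prob_moment r" and q: "q \<in> prob_moment r"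
    and int: "integrable \<gamma> (\<lambda>z. \<bar>fst z - snd z\<bar> powr r)"
  shows "(LINT y|q. \<bar>y\<bar> powr r) \<le> 2 powr r * ((LINT y|p. \<bar>y\<bar> powr r) + (LINT z|\<gamma>. \<bar>fst z - snd z\<bar> powr r))"
proof -
  have \<gamma>D: "sets \<gamma> = sets borel" "distr \<gamma> borel fst = p" "distr \<gamma> borel snd = q" using \<gamma> by (auto simp: couplings_def)
  have m: "f \<in> \<gamma> \<rightarrow>\<^sub>M M \<longleftrightarrow> f \<in> borel \<rightarrow>\<^sub>M M" for f :: "real \<times> real \<Rightarrow> 'z" and M
    by (rule arg_cong[OF measurable_cong_sets]) (auto simp: \<gamma>D)
  have [measurable]: "fst \<in> \<gamma> \<rightarrow>\<^sub>M borel" "snd \<in> \<gamma> \<rightarrow>\<^sub>M borel" unfolding m by (subst borel_prod[symmetric], measurable)+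
  have "integrable (distr \<gamma> borel fst) (\<lambda>y. \<bar>y\<bar> powr r)" "integrable (distr \<gamma> borel snd) (\<lambda>y. \<bar>y\<bar> powr r)"
    unfolding \<gamma>D using p q by (auto dest: prob_momentD)
  then have i: "integrable \<gamma> (\<lambda>z. \<bar>fst z\<bar> powr r)" "integrable \<gamma> (\<lambda>z. \<bar>snd z\<bar> powr r)"
    by (auto simp: integrable_distr_eq)
  have "(LINT y|q. \<bar>y\<bar> powr r) = (LINT z|\<gamma>. \<bar>snd z\<bar> powr r)"
    unfolding \<gamma>D(3)[symmetric] by (subst integral_distr) auto
  also have "\<dots> \<le> (LINT z|\<gamma>. 2 powr r * (\<bar>fst z\<bar> powr r + \<bar>fst z - snd z\<bar> powr r))"
  proof (rule integral_mono[OF i(2)])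
    show "integrable \<gamma> (\<lambda>z. 2 powr r * (\<bar>fst z\<bar> powr r + \<bar>fst z - snd z\<bar> powr r))" using i int by simp
    show "\<bar>snd z\<bar> powr r \<le> 2 powr r * (\<bar>fst z\<bar> powr r + \<bar>fst z - snd z\<bar> powr r)" for z
      using abs_add_powr_le[of r "fst z" "snd z - fst z"] r by (simp add: abs_minus_commute)
  qed
  also have "\<dots> = 2 powr r * ((LINT z|\<gamma>. \<bar>fst z\<bar> powr r) + (LINT z|\<gamma>. \<bar>fst z - snd z\<bar> powr r))" using i int by simp
  also have "(LINT z|\<gamma>. \<bar>fst z\<bar> powr r) = (LINT y|p. \<bar>y\<bar> powr r)"
    unfolding \<gamma>D(2)[symmetric] by (subst integral_distr) auto
  finally show ?thesis .
qed

lemma excess_tendsto_0: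
  fixes h :: "'a \<Rightarrow> real"
  assumes h: "integrable M h"
  shows "(\<lambda>n. LINT x|M. max 0 (h x - real n)) \<longlonglongrightarrow> 0"
proof -
  have [measurable]: "h \<in> borel_measurable M" using h by simp
  have "(\<lambda>n. LINT x|M. max 0 (h x - real n)) \<longlonglongrightarrow> (LINT x|M. 0)"
  proof (rule integral_dominated_convergence[where w="\<lambda>x. \<bar>h x\<bar>"])
    show "AE x in M. (\<lambda>n. max 0 (h x - real n)) \<longlonglongrightarrow> 0"
    proof (intro AE_I2 tendsto_eventually)
      fix x
      obtain n0 :: nat where n0: "h x \<le> real n0" using real_arch_simple by blast
      show "\<forall>\<^sub>F n in sequentially. max 0 (h x - real n) = 0"
        using eventually_ge_at_top[of n0] by eventually_elim (use n0 in auto)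
    qed
  qed (use h in auto)
  then show ?thesis by simp
qed

lemma tail_powr_tendsto_0:
  assumes p: "p \<in> prob_moment r" and r: "1 \<le> r"
  shows "(\<lambda>n. LINT y|p. tail_powr r (real n) y) \<longlonglongrightarrow> 0"
proof -
  have "(\<lambda>n. LINT y|p. tail_powr r (real n) y) \<longlonglongrightarrow> (LINT y|p. 0)"
  proof (rule integral_dominated_convergence[where w="\<lambda>y. \<bar>y\<bar> powr r"])
    show "AE y in p. (\<lambda>n. tail_powr r (real n) y) \<longlonglongrightarrow> 0"
    proof (intro AE_I2 tendsto_eventually)
      fix y :: real
      obtain n0 :: nat where n0: "max 1 (2 * \<bar>y\<bar> powr r) \<le> real n0" using real_arch_simple by blast
      show "\<forall>\<^sub>F n in sequentially. tail_powr r (real n) y = 0"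
        using eventually_ge_at_top[of n0]
      proof eventually_elim
        case (elim n)
        have "real n powr 1 \<le> real n powr r" using r n0 elim by (intro powr_mono) auto
        then have "2 * \<bar>y\<bar> powr r \<le> real n powr r" using n0 elim by simp
        then show ?case by (simp add: tail_powr_def)
      qed
    qed
    show "tail_powr r (real n) \<in> borel_measurable p" for n
      by (simp add: measurable_cong_sets[OF prob_momentD(2)[OF p] refl])
  qed (use prob_momentD(4)[OF p] tail_powr_bounds in auto)
  then show ?thesis by simp
qed

text \<open>The modulus of continuity of \<open>C x\<close> at \<open>k' x\<close> need not depend measurably on \<open>x\<close>; therefore the
  sets on which it is controlled are only handled through their outer measure.\<close>

lemma (in prob_space) exists_envelope:
  assumes "incseq A" "(\<Union>n. A n) = space M" "0 < \<eta>"
  obtains n E where "E \<in> sets M" "A n \<subseteq> E" "prob (space M - E) < \<eta>"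
    "\<And>B. B \<in> sets M \<Longrightarrow> B \<subseteq> E - A n \<Longrightarrow> emeasure M B = 0"
proof -
  have sub: "A n \<subseteq> space M" for n using assms(2) by auto
  \<comment> \<open>Outer measure is continuous along increasing sequences of arbitrary sets, so
    some \<open>A n\<close> has outer measure above \<open>1 - \<eta>\<close>, and a measurable
    envelope of it inherits this value.\<close>
  have "(SUP n. outer_measure_of M (A n)) = 1"
    using SUP_outer_measure_of_incseq[of A M, OF sub assms(1)] assms(2) by (simp add: emeasure_space_1)
  moreover have "ennreal (1 - \<eta>) < 1" using assms(3) by (simp add: ennreal_less_one_iff)
  ultimately obtain n where n: "ennreal (1 - \<eta>) < outer_measure_of M (A n)" by (metis less_SUP_iff)
  obtain E where E: "E \<in> sets M" "A n \<subseteq> E" "outer_measure_of M (A n) = emeasure M E"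
    using outer_measure_of_attain[OF sub] by blast
  have env: "measurable_envelope M (A n) E"
    using E by (subst measurable_envelope_eq2) (auto simp: less_top[symmetric])
  have "1 - \<eta> < prob E"
  proof (cases "0 \<le> 1 - \<eta>")
    case True
    then show ?thesis using n E(3) by (simp add: emeasure_eq_measure ennreal_less_iff)
  qed (use measure_nonneg[of M E] in linarith)
  then have "prob (space M - E) < \<eta>" using E(1) by (simp add: prob_compl)
  then show thesis using that[OF E(1,2)] measurable_envelopeD1[OF env] by blast
qed

text \<open>A set of positive measure that missed the admissible points would, up to a null set, lie
  in \<open>E - A\<close>, where the envelope leaves only null sets. This is the thickness that
  \<open>finite_sample_positive\<close> asks for.\<close>

lemma (in prob_space) envelope_thick:
  assumes E: "E \<in> sets M" "\<And>B. B \<in> sets M \<Longrightarrow> B \<subseteq> E - A \<Longrightarrow> emeasure M B = 0"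
    and S: "AE x in M. x \<in> S" and B: "B \<in> sets M" "0 < emeasure M B"
  shows "B \<inter> {x \<in> S. x \<in> E \<longrightarrow> x \<in> A} \<noteq> {}"
proof
  assume empty: "B \<inter> {x \<in> S. x \<in> E \<longrightarrow> x \<in> A} = {}"
  obtain Z where Z: "{x \<in> space M. x \<notin> S} \<subseteq> Z" "emeasure M Z = 0" "Z \<in> sets M" using S by (rule AE_E)
  have "B - Z \<subseteq> E - A" using empty Z(1) sets.sets_into_space[OF B(1)] by blast
  then have "emeasure M (B - Z) = 0" using B(1) Z(3) by (intro E(2)) auto
  then have "emeasure M B = 0" using emeasure_Diff_null_set[of Z M B] Z B(1) by (simp add: null_setsI)
  then show False using B(2) by simp
qed

text \<open>\<open>g\<close> is a lower-bounded majorant of the competing cost. Were the inequality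
  to fail by \<open>\<Delta>\<close>, sampling would yield cheaper competitors: three losses of at
  most \<open>\<Delta> / 8\<close> (modulus, large moments, bad points) and five of at most
  \<open>\<Delta> / 64\<close> (coupling cost) leave a positive margin.\<close>

lemma kernel_cost_le_truncated:
  fixes C :: "real \<Rightarrow> real measure \<Rightarrow> real"
  assumes k: "martingale_kernel r \<mu> k" and k': "martingale_kernel r \<mu> k'" and bind_eq: "\<mu> \<bind> k = \<mu> \<bind> k'"
    and cont: "\<And>x. continuous_map (wasserstein_topology r) euclidean (C x)"
    and bound: "\<And>x p. p \<in> prob_moment r \<Longrightarrow> C x p \<le> K * (1 + \<bar>x\<bar> powr r + (LINT y|p. \<bar>y\<bar> powr r))" and K: "0 \<le> K"
    and mono: "\<And>N x q. (\<And>i. i < N \<Longrightarrow> x i \<in> S) \<Longrightarrow> (\<And>i. i < N \<Longrightarrow> q i \<in> prob_moment r) \<Longrightarrow>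
        (\<And>A. A \<in> sets borel \<Longrightarrow> (\<Sum>i<N. measure (k (x i)) A) = (\<Sum>i<N. measure (q i) A)) \<Longrightarrow>
        (\<And>i. i < N \<Longrightarrow> (LINT y|q i. y) = x i) \<Longrightarrow> (\<Sum>i<(N::nat). C (x i) (k (x i))) \<le> (\<Sum>i<N. C (x i) (q i))"
    and S: "AE x in \<mu>. x \<in> S"
    and f: "integrable \<mu> (\<lambda>x. C x (k x))" and g: "integrable \<mu> g"
    and g_ge: "\<And>x. C x (k' x) \<le> g x" "\<And>x. - b0 \<le> g x" and b0: "0 \<le> b0"
  shows "(LINT x|\<mu>. C x (k x)) \<le> (LINT x|\<mu>. g x)"
proof (rule ccontr)
  interpret K: martingale_kernel r \<mu> k by (rule k)
  interpret K': martingale_kernel r \<mu> k' by (rule k')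
  note r = K.r
  define \<nu> where "\<nu> = \<mu> \<bind> k"
  have \<nu>: "\<nu> \<in> prob_moment r" "\<mu> \<bind> k' = \<nu>" "\<mu> \<bind> k = \<nu>" using K.bind_moment by (auto simp: \<nu>_def bind_eq)
  assume neg: "\<not> (LINT x|\<mu>. C x (k x)) \<le> (LINT x|\<mu>. g x)"
  define \<Delta> where "\<Delta> = (LINT x|\<mu>. C x (k x)) - (LINT x|\<mu>. g x)"
  have \<Delta>: "0 < \<Delta>" using neg by (simp add: \<Delta>_def)
  \<comment> \<open>\<open>K * 2 powr r\<close> stems from the growth bound after the transfer of
    moments, \<open>b0\<close> absorbs the negative part of \<open>g\<close>, and 1 makes
    \<open>a\<close> positive.\<close>
  define a where "a = K * 2 powr r + b0 + 1"
  have a: "0 < a" using K b0 by (simp add: a_def add_nonneg_pos)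
  define H where "H = K'.moment_bound"
  have H1: "1 \<le> H x" for x by (simp add: H_def K'.moment_bound_ge_1)
  have iH: "integrable \<mu> H" by (simp add: H_def K'.moment_bound_integrable)
  have "\<forall>\<^sub>F n in sequentially. (LINT x|\<mu>. max 0 (H x - real n)) < \<Delta> / (8 * a)"
    by (rule order_tendstoD(2)[OF excess_tendsto_0[OF iH]]) (use \<Delta> a in simp)
  then obtain n0 where n0: "\<And>n. n0 \<le> n \<Longrightarrow> (LINT x|\<mu>. max 0 (H x - real n)) < \<Delta> / (8 * a)"
    by (auto simp: eventually_sequentially)
  \<comment> \<open>The part of the moment above \<open>T\<close> is paid for by its small integral;
    the part below \<open>T\<close> is paid at bad indices.\<close>
  define T where "T = real (Suc n0)"
  have T: "0 < T" "a * (LINT x|\<mu>. max 0 (H x - T)) < \<Delta> / 8"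
    using n0[of "Suc n0"] a by (auto simp: T_def field_simps)
  \<comment> \<open>Only an upper bound on \<open>C x q\<close> is asked for, because competitors
    merely have to be cheap.\<close>
  define A where "A j = {x. \<forall>q\<in>prob_moment r. wasserstein r (k' x) q < 1 / real (Suc j) \<longrightarrow> C x q < C x (k' x) + \<Delta> / 8}" for j
  have incA: "incseq A"
  proof (rule incseq_SucI)
    fix j
    have "1 / real (Suc (Suc j)) \<le> 1 / real (Suc j)" by (intro divide_left_mono) auto
    then show "A j \<subseteq> A (Suc j)" unfolding A_def by (auto intro: less_le_trans)
  qed
  have UA: "(\<Union>j. A j) = space \<mu>"
  proof -
    have "\<exists>j. x \<in> A j" for x
    proof -
      obtain \<delta> where \<delta>: "\<delta> > 0" "\<And>q. q \<in> prob_moment r \<Longrightarrow> wasserstein r (k' x) q < \<delta> \<Longrightarrow> \<bar>C x q - C x (k' x)\<bar> < \<Delta> / 8"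
        using wasserstein_continuous_at[OF cont K'.k_moment, of "\<Delta> / 8" x x] \<Delta> by auto
      obtain j where j: "1 / real (Suc j) < \<delta>" using \<delta>(1) nat_approx_posE by blast
      have "C x q < C x (k' x) + \<Delta> / 8" if "q \<in> prob_moment r" "wasserstein r (k' x) q < 1 / real (Suc j)" for q
      proof -
        have "\<bar>C x q - C x (k' x)\<bar> < \<Delta> / 8" using that(2) j by (intro \<delta>(2)[OF that(1)]) linarith
        then show ?thesis by linarith
      qed
      then have "x \<in> A j" by (simp add: A_def)
      then show ?thesis ..
    qed
    then show ?thesis by auto
  qed
  have \<eta>: "0 < \<Delta> / (8 * a * T)" using \<Delta> a T by simp
  obtain j E where E: "E \<in> sets \<mu>" "A j \<subseteq> E" "K.prob (space \<mu> - E) < \<Delta> / (8 * a * T)"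
    "\<And>B. B \<in> sets \<mu> \<Longrightarrow> B \<subseteq> E - A j \<Longrightarrow> emeasure \<mu> B = 0"
    using K.exists_envelope[OF incA UA \<eta>] by metis
  have E3: "a * T * K.prob (- E) < \<Delta> / 8" using E(3) a T by (simp add: field_simps Compl_eq_Diff_UNIV)
  define \<delta> where "\<delta> = 1 / real (Suc j)"
  have \<delta>: "0 < \<delta>" by (simp add: \<delta>_def)
  \<comment> \<open>The factor in front of the total coupling cost:
    \<open>a * (T / \<delta> powr r + 1)\<close> comes from the estimate \<open>each\<close>,
    \<open>2 powr r\<close> from \<open>competitor_exists\<close>.\<close>
  define b where "b = a * (T / \<delta> powr r + 1) * 2 powr r"
  have b: "0 < b" using a T \<delta> by (auto simp: b_def intro!: mult_pos_pos add_pos_pos)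
  \<comment> \<open>Order of choices: \<open>e2\<close>, then \<open>R\<close> for the tails, which
    fixes \<open>c2\<close>, then \<open>\<theta>1\<close> for the Huber estimate, and last
    \<open>\<theta>\<close> for the contraction. Each depends only on the earlier ones.\<close>
  define e2 where "e2 = \<Delta> / (64 * b)"
  have e2: "0 < e2" "b * e2 = \<Delta> / 64" using \<Delta> b by (auto simp: e2_def)
  have "\<forall>\<^sub>F n in sequentially. (LINT y|\<nu>. tail_powr r (real n) y) < \<Delta> / (64 * b * 2 powr (r + 2))"
    by (rule order_tendstoD(2)[OF tail_powr_tendsto_0[OF \<nu>(1) r]]) (use \<Delta> b in simp)
  then obtain n1 where n1: "\<And>n. n1 \<le> n \<Longrightarrow> (LINT y|\<nu>. tail_powr r (real n) y) < \<Delta> / (64 * b * 2 powr (r + 2))"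
    by (auto simp: eventually_sequentially)
  define R where "R = real (Suc n1)"
  have R: "0 < R" by (simp add: R_def)
  have R2: "b * (2 powr (r + 2) * (LINT y|\<nu>. tail_powr r R y)) < \<Delta> / 64"
    using n1[of "Suc n1"] b by (simp add: R_def pos_less_divide_eq mult_ac)
  define c2 where "c2 = (2 * R) powr r / e2 powr (2 / r)"
  have c2: "0 < c2" using R e2 by (simp add: c2_def)
  define \<theta>1 where "\<theta>1 = \<Delta> / (64 * (b * c2 * (2 * R)))"
  have \<theta>1: "0 < \<theta>1" "b * c2 * (2 * R) * \<theta>1 = \<Delta> / 64" using \<Delta> b c2 R by (auto simp: \<theta>1_def)
  define w where "w = b * c2 * (2 * R) * \<theta>1 powr (1 - r)"
  have w: "0 < w" using b c2 R \<theta>1 by (simp add: w_def)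
  define \<theta> where "\<theta> = min (\<Delta> / (64 * b)) (\<Delta> / (64 * w))"
  have \<theta>: "0 < \<theta>" using \<Delta> b w by (simp add: \<theta>_def)
  obtain \<epsilon> c L m where c: "c \<in> borel \<rightarrow>\<^sub>M count_space UNIV" "\<And>y. c y < (L::nat)" and e: "0 < \<epsilon>" "\<epsilon> \<le> 1"
    and iD: "integrable \<mu> (K'.transport_cost \<epsilon> c m)" and Dlt: "(LINT x|\<mu>. K'.transport_cost \<epsilon> c m x) < \<theta>"
    using K'.exists_small_transport[OF \<theta>] by metis
  define D where "D = K'.transport_cost \<epsilon> c m"
  define \<zeta> where "\<zeta> = K'.target \<epsilon> c m"
  define d where "d = (LINT x|\<mu>. D x)"
  have d: "b * d < \<Delta> / 64" "w * d < \<Delta> / 64"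
  proof -
    have "d < \<Delta> / (64 * b)" "d < \<Delta> / (64 * w)" using Dlt by (auto simp: d_def D_def \<theta>_def)
    then show "b * d < \<Delta> / 64" "w * d < \<Delta> / 64" using b w by (simp_all add: pos_less_divide_eq mult_ac)
  qed
  define P where "P x = (LINT y|k x. huber R y) - (LINT y|k' x. huber R (\<zeta> x (c y)))" for x
  note kh = K.kernel_integral[unfolded \<nu>(3), OF prob_moment_integrable_huber[OF \<nu>(1) r less_imp_le[OF R]]]
  note k'h = K'.kernel_integral[unfolded \<nu>(2), OF prob_moment_integrable_huber[OF \<nu>(1) r less_imp_le[OF R]]]
  note \<zeta>h = K'.huber_target_integrable[OF c e less_imp_le[OF R] iD, folded \<zeta>_def]
  have iP: "integrable \<mu> P" unfolding P_def using kh \<zeta>h by simp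
  have P: "b * (c2 * (LINT x|\<mu>. P x)) \<le> \<Delta> / 64 + w * d"
  proof -
    \<comment> \<open>Both kernels have the same second marginal, so on average the Huber integral
      of \<open>k\<close> equals that of \<open>k'\<close>, which is close to that of its
      contraction.\<close>
    have "(LINT x|\<mu>. P x) = (LINT x|\<mu>. (LINT y|k' x. huber R y) - (LINT y|k' x. huber R (\<zeta> x (c y))))"
      unfolding P_def using kh k'h \<zeta>h by simp
    also have "\<dots> \<le> (LINT x|\<mu>. 2 * R * (\<theta>1 + \<theta>1 powr (1 - r) * D x))"
    proof (rule integral_mono)
      show "integrable \<mu> (\<lambda>x. (LINT y|k' x. huber R y) - (LINT y|k' x. huber R (\<zeta> x (c y))))" using k'h \<zeta>h by simp
      show "integrable \<mu> (\<lambda>x. 2 * R * (\<theta>1 + \<theta>1 powr (1 - r) * D x))" using iD by (simp add: D_def)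
      show "(LINT y|k' x. huber R y) - (LINT y|k' x. huber R (\<zeta> x (c y))) \<le> 2 * R * (\<theta>1 + \<theta>1 powr (1 - r) * D x)" for x
        using K'.huber_target_le[OF c e less_imp_le[OF R] \<theta>1(1), where x=x and m=m]
        unfolding \<zeta>_def D_def by linarith
    qed
    also have "\<dots> = 2 * R * (\<theta>1 + \<theta>1 powr (1 - r) * d)" using iD K.prob_space by (simp add: D_def d_def)
    finally have "b * c2 * (LINT x|\<mu>. P x) \<le> b * c2 * (2 * R * (\<theta>1 + \<theta>1 powr (1 - r) * d))"
      using b c2 by (intro mult_left_mono) auto
    also have "\<dots> = b * c2 * (2 * R) * \<theta>1 + w * d" by (simp add: w_def algebra_simps)
    finally show ?thesis using \<theta>1(2) by (simp add: mult.assoc)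
  qed
  note kt = K.kernel_integral[unfolded \<nu>(3), OF prob_moment_integrable_tail_powr[OF \<nu>(1), of R]]
  \<comment> \<open>The gain at \<open>x\<close> after all losses; a sample on which its sum is
    positive contradicts monotonicity.\<close>
  define F0 where "F0 x = C x (k x) - (g x + \<Delta> / 8 + a * max 0 (H x - T) + a * T * indicator (- E) x
      + b * (D x + e2 + c2 * P x + 2 powr (r + 2) * (LINT y|k x. tail_powr r R y)))" for x
  have iE: "integrable \<mu> (indicator (- E) :: real \<Rightarrow> real)"
    using E(1) by (intro integrable_real_indicator) (auto simp: Compl_eq_Diff_UNIV K.emeasure_eq_measure)
  have iHT: "integrable \<mu> (\<lambda>x. max 0 (H x - T))" using iH by simp
  have iF0: "integrable \<mu> F0" unfolding F0_def
    using f g iHT iE iD iP kt(1) by (simp add: D_def)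
  have F0pos: "0 < (LINT x|\<mu>. F0 x)"
  proof -
    have "(LINT x|\<mu>. F0 x) = (LINT x|\<mu>. C x (k x)) - ((LINT x|\<mu>. g x) + \<Delta> / 8 + a * (LINT x|\<mu>. max 0 (H x - T)) + a * T * K.prob (- E)
      + b * (d + e2 + c2 * (LINT x|\<mu>. P x) + 2 powr (r + 2) * (LINT y|\<nu>. tail_powr r R y)))"
      unfolding F0_def using f g iHT iE iD iP kt K.prob_space by (simp add: D_def d_def)
    also have "\<dots> = \<Delta> - (\<Delta> / 8 + a * (LINT x|\<mu>. max 0 (H x - T)) + a * T * K.prob (- E)
      + (b * d + b * e2 + b * (c2 * (LINT x|\<mu>. P x)) + b * (2 powr (r + 2) * (LINT y|\<nu>. tail_powr r R y))))"
      by (simp add: \<Delta>_def algebra_simps)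
    also have "\<dots> > 0" using T(2) E3 d e2(2) P R2 \<Delta> by linarith
    finally show ?thesis .
  qed
  \<comment> \<open>A lower bound, uniform on \<open>Z\<close>, for the margin that the factor
    \<open>1 - \<epsilon>\<close> creates in the averaged potentials.\<close>
  define \<kappa> where "\<kappa> = \<epsilon> / real (Suc m)"
  have \<kappa>: "0 < \<kappa>" using e by (simp add: \<kappa>_def)
  have gap_eq: "K'.mean_gap t = K.mean_gap t" for t by (simp add: K'.mean_gap_def K.mean_gap_def \<nu>)
  define Z where "Z = {t. \<bar>t\<bar> \<le> real (Suc m) \<and> 1 / real (Suc m) \<le> K'.mean_gap t}"
  have Zc: "compact Z"
  proof -
    have "Z = {- real (Suc m) .. real (Suc m)} \<inter> {t. 1 / real (Suc m) \<le> K'.mean_gap t}" by (auto simp: Z_def)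
    moreover have "closed {t. 1 / real (Suc m) \<le> K'.mean_gap t}"
      using K'.continuous_mean_gap by (intro closed_Collect_le continuous_intros) auto
    ultimately show ?thesis by (simp add: compact_Int_closed)
  qed
  \<comment> \<open>Potentials are 1-Lipschitz in the level, so within a ball the two of them move
    by less than \<open>\<kappa> / 4\<close> each; the \<open>\<kappa> / 2\<close> subtracted in
    \<open>F1\<close> pays for both.\<close>
  obtain Net where Net: "Net \<subseteq> Z" "finite Net" "Z \<subseteq> (\<Union>t\<in>Net. ball t (\<kappa> / 4))"
    by (rule compactE_image[OF Zc, of Z "\<lambda>t. ball t (\<kappa> / 4)"]) (use \<kappa> in auto)
  define F1 where "F1 t x = (LINT y|k x. max 0 (y - t)) - (LINT y|k' x. max 0 (\<zeta> x (c y) - t)) - \<kappa> / 2" for t x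
  note kp = K.kernel_integral[unfolded \<nu>(3), OF prob_moment_integrable_pos_part[OF \<nu>(1) r]]
  note \<zeta>p = K'.target_potential_integrable[OF c e, where m=m, folded \<zeta>_def]
  have iF1: "integrable \<mu> (F1 t)" for t unfolding F1_def using kp \<zeta>p by simp
  have F1pos: "0 < (LINT x|\<mu>. F1 t x)" if "t \<in> Z" for t
  proof -
    have ip: "integrable \<mu> (\<lambda>x. max 0 (x - t))" by (rule prob_moment_integrable_pos_part[OF K.\<mu> r])
    have "(LINT x|\<mu>. LINT y|k' x. max 0 (\<zeta> x (c y) - t)) \<le> (LINT x|\<mu>. max 0 (x - t) + (1 - \<epsilon>) * K'.potential_gap x t)"
    proof (rule integral_mono[OF \<zeta>p])
      show "integrable \<mu> (\<lambda>x. max 0 (x - t) + (1 - \<epsilon>) * K'.potential_gap x t)" using ip K'.potential_gap_integrable by simp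
      show "(LINT y|k' x. max 0 (\<zeta> x (c y) - t)) \<le> max 0 (x - t) + (1 - \<epsilon>) * K'.potential_gap x t" for x
        using K'.target_potential[OF c e, where m=m and x=x and t=t] unfolding \<zeta>_def by linarith
    qed
    also have "\<dots> = (LINT x|\<mu>. max 0 (x - t)) + (1 - \<epsilon>) * K'.mean_gap t"
      using ip K'.potential_gap_integrable K'.integral_potential_gap by simp
    also have "(LINT x|\<mu>. max 0 (x - t)) = (LINT y|\<nu>. max 0 (y - t)) - K'.mean_gap t"
      by (simp add: K'.mean_gap_def \<nu>)
    finally have "(LINT x|\<mu>. LINT y|k' x. max 0 (\<zeta> x (c y) - t)) \<le> (LINT y|\<nu>. max 0 (y - t)) - \<epsilon> * K'.mean_gap t"
      by (simp add: algebra_simps)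
    moreover have "\<kappa> \<le> \<epsilon> * K'.mean_gap t"
    proof -
      have "\<epsilon> * (1 / real (Suc m)) \<le> \<epsilon> * K'.mean_gap t" using that e by (intro mult_left_mono) (auto simp: Z_def)
      then show ?thesis by (simp add: \<kappa>_def)
    qed
    moreover have "(LINT x|\<mu>. F1 t x) = (LINT y|\<nu>. max 0 (y - t)) - (LINT x|\<mu>. LINT y|k' x. max 0 (\<zeta> x (c y) - t)) - \<kappa> / 2"
      unfolding F1_def using kp \<zeta>p K.prob_space by simp
    ultimately show ?thesis using \<kappa> by linarith
  qed
  define S' where "S' = {x \<in> S. x \<in> E \<longrightarrow> x \<in> A j}"
  have thick: "B \<inter> S' \<noteq> {}" if "B \<in> sets \<mu>" "0 < emeasure \<mu> B" for B
    unfolding S'_def by (rule K.envelope_thick[OF E(1,4) S that])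
  \<comment> \<open>One index set for all constraints: \<open>None\<close> stands for the gain,
    \<open>Some t\<close> for the domination of potentials at a level of the net.\<close>
  define F where "F = case_option F0 F1"
  obtain N and x :: "nat \<Rightarrow> real" where N: "0 < N" and x: "\<And>i. x i \<in> S'"
    and pos: "\<And>u. u \<in> insert None (Some ` Net) \<Longrightarrow> 0 < (\<Sum>i<N. F u (x i))"
  proof -
    have "\<exists>N>0. \<exists>x::nat \<Rightarrow> real. (\<forall>i. x i \<in> S') \<and> (\<forall>u\<in>insert None (Some ` Net). 0 < (\<Sum>i<N. F u (x i)))"
      by (rule K.finite_sample_positive) (use Net iF0 iF1 F0pos F1pos thick in \<open>auto simp: F_def\<close>)
    then show thesis using that by blast
  qed
  have pos0: "0 < (\<Sum>i<N. F0 (x i))" using pos[of None] by (simp add: F_def)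
  have pos1: "0 < (\<Sum>i<N. F1 t (x i))" if "t \<in> Net" for t using pos[of "Some t"] that by (simp add: F_def)
  \<comment> \<open>Off \<open>Z\<close> the inequality holds for each sample point; on
    \<open>Z\<close> it is inherited from a nearby level of the net.\<close>
  have pot: "(\<Sum>i<N. LINT y|k' (x i). max 0 (\<zeta> (x i) (c y) - t)) \<le> (\<Sum>i<N. LINT y|k (x i). max 0 (y - t))" for t
  proof (cases "t \<in> Z")
    case False
    show ?thesis
    proof (rule sum_mono)
      fix i
      have "(LINT y|k' (x i). max 0 (\<zeta> (x i) (c y) - t)) \<le> max 0 (x i - t)"
        unfolding \<zeta>_def by (rule K'.target_potential_outside[OF c e]) (use False in \<open>auto simp: Z_def\<close>)
      also have "\<dots> \<le> (LINT y|k (x i). max 0 (y - t))" using K.potential_gap_nonneg[of "x i" t] by (simp add: K.potential_gap_def)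
      finally show "(LINT y|k' (x i). max 0 (\<zeta> (x i) (c y) - t)) \<le> (LINT y|k (x i). max 0 (y - t))" .
    qed
  next
    case True
    then obtain s where s: "s \<in> Net" "\<bar>s - t\<bar> < \<kappa> / 4" using Net(3) by (auto simp: dist_real_def)
    have "F1 s (x i) \<le> (LINT y|k (x i). max 0 (y - t)) - (LINT y|k' (x i). max 0 (\<zeta> (x i) (c y) - t))" for i
    proof -
      have "\<bar>(LINT y|k (x i). max 0 (y - s)) - (LINT y|k (x i). max 0 (y - t))\<bar> \<le> \<bar>s - t\<bar>"
        by (rule K.pos_part_integral_lipschitz[OF K.k_moment])
      moreover have "(LINT y|k' (x i). max 0 (\<zeta> (x i) (c y) - t)) \<le> (LINT y|k' (x i). max 0 (\<zeta> (x i) (c y) - s) + \<bar>s - t\<bar>)"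
        unfolding \<zeta>_def
        by (intro integral_mono Bochner_Integration.integrable_add K'.integral_const_k(2)
            K'.target_integrable[OF c e, where F="\<lambda>z. max 0 (z - t)"] K'.target_integrable[OF c e, where F="\<lambda>z. max 0 (z - s)"]) auto
      moreover have "(LINT y|k' (x i). max 0 (\<zeta> (x i) (c y) - s) + \<bar>s - t\<bar>) = (LINT y|k' (x i). max 0 (\<zeta> (x i) (c y) - s)) + \<bar>s - t\<bar>"
        unfolding \<zeta>_def using K'.target_integrable[OF c e, where F="\<lambda>z. max 0 (z - s)" and m=m and x="x i"]
          K'.integral_const_k by simp
      ultimately show ?thesis using s(2) unfolding F1_def by linarith
    qed
    then have "(\<Sum>i<N. F1 s (x i)) \<le> (\<Sum>i<N. (LINT y|k (x i). max 0 (y - t)) - (LINT y|k' (x i). max 0 (\<zeta> (x i) (c y) - t)))"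
      by (rule sum_mono)
    then show ?thesis using pos1[OF s(1)] by (simp add: sum_subtractf)
  qed
  have \<zeta>mean: "(LINT y|k' z. \<zeta> z (c y)) = z" for z
    unfolding \<zeta>_def by (rule K'.target_mean[OF c e])
  have mean: "(\<Sum>i<N. LINT y|k' (x i). \<zeta> (x i) (c y)) = (\<Sum>i<N. LINT y|k (x i). y)"
    by (simp add: \<zeta>mean K.k_mean)
  obtain q \<gamma> where q: "\<And>i. i < N \<Longrightarrow> q i \<in> prob_moment r"
    and qsum: "\<And>A. A \<in> sets borel \<Longrightarrow> (\<Sum>i<N. measure (q i) A) = (\<Sum>i<N. measure (k (x i)) A)"
    and qmean: "\<And>i. i < N \<Longrightarrow> (LINT y|q i. y) = (LINT y|k' (x i). \<zeta> (x i) (c y))"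
    and \<gamma>: "\<And>i. i < N \<Longrightarrow> \<gamma> i \<in> couplings (k' (x i)) (q i)"
    and \<gamma>int: "\<And>i. i < N \<Longrightarrow> integrable (\<gamma> i) (\<lambda>z. \<bar>fst z - snd z\<bar> powr r)"
    and \<gamma>sum: "(\<Sum>i<N. LINT z|\<gamma> i. \<bar>fst z - snd z\<bar> powr r) \<le> 2 powr r * ((\<Sum>i<N. LINT y|k' (x i). \<bar>y - \<zeta> (x i) (c y)\<bar> powr r) + N * e2
     + (2 * R) powr r / e2 powr (2 / r) * (\<Sum>i<N. (LINT y|k (x i). huber R y) - (LINT y|k' (x i). huber R (\<zeta> (x i) (c y))))
     + 2 powr (r + 2) * (\<Sum>i<N. LINT y|k (x i). tail_powr r R y))"
    by (rule competitor_exists[where p="\<lambda>i. k (x i)" and p'="\<lambda>i. k' (x i)" and c=c and L=L and \<zeta>="\<lambda>i. \<zeta> (x i)" and R=R and \<epsilon>=e2 and N=N and r=r])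
      (use r N K.k_moment K'.k_moment c mean pot R e2 in auto)
  define cost where "cost i = (LINT z|\<gamma> i. \<bar>fst z - snd z\<bar> powr r)" for i
  have cost0: "0 \<le> cost i" for i by (simp add: cost_def)
  \<comment> \<open>If \<open>x i\<close> lies in \<open>E\<close> and its coupling cost is small,
    then \<open>q i\<close> is within the common radius. Otherwise the growth bound applies and is
    charged to the complement of \<open>E\<close> or to the coupling cost.\<close>
  have each: "C (x i) (q i) \<le> g (x i) + \<Delta> / 8 + a * max 0 (H (x i) - T) + a * T * indicator (- E) (x i) + a * (T / \<delta> powr r + 1) * cost i"
    if i: "i < N" for i
  proof (cases "x i \<in> E \<and> cost i < \<delta> powr r")
    case True
    have "x i \<in> A j" using x[of i] True by (simp add: S'_def)
    moreover have "wasserstein r (k' (x i)) (q i) < \<delta>"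
      using True by (intro wasserstein_less[OF \<gamma>[OF i] r \<delta>]) (simp add: cost_def)
    ultimately have "C (x i) (q i) < C (x i) (k' (x i)) + \<Delta> / 8" using q[OF i] by (simp add: A_def \<delta>_def)
    then have "C (x i) (q i) \<le> g (x i) + \<Delta> / 8" using g_ge(1)[of "x i"] by linarith
    moreover have "0 \<le> a * max 0 (H (x i) - T)" "0 \<le> a * T * indicator (- E) (x i)" "0 \<le> a * (T / \<delta> powr r + 1) * cost i"
      using a T cost0[of i] by (auto intro!: mult_nonneg_nonneg add_nonneg_nonneg)
    ultimately show ?thesis by linarith
  next
    case False
    have "(LINT y|q i. \<bar>y\<bar> powr r) \<le> 2 powr r * ((LINT y|k' (x i). \<bar>y\<bar> powr r) + cost i)"
      unfolding cost_def by (rule coupling_moment_le[OF \<gamma>[OF i] r K'.k_moment q[OF i] \<gamma>int[OF i]])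
    moreover have "1 \<le> 2 powr r" using r by (intro ge_one_powr_ge_zero) auto
    then have "1 * (1 + \<bar>x i\<bar> powr r) \<le> 2 powr r * (1 + \<bar>x i\<bar> powr r)" by (intro mult_right_mono) auto
    ultimately have "1 + \<bar>x i\<bar> powr r + (LINT y|q i. \<bar>y\<bar> powr r) \<le> 2 powr r * (H (x i) + cost i)"
      by (simp add: H_def K'.moment_bound_def distrib_left)
    then have "K * (1 + \<bar>x i\<bar> powr r + (LINT y|q i. \<bar>y\<bar> powr r)) \<le> K * (2 powr r * (H (x i) + cost i))"
      using K by (intro mult_left_mono)
    with bound[OF q[OF i], of "x i"] have 1: "C (x i) (q i) \<le> K * 2 powr r * H (x i) + K * 2 powr r * cost i"
      by (simp add: distrib_left mult_ac)
    have "b0 * 1 \<le> b0 * H (x i)" using b0 H1 by (intro mult_left_mono) auto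
    with g_ge(2)[of "x i"] have 2: "0 \<le> g (x i) + b0 * H (x i)" by linarith
    have "K * 2 powr r * H (x i) + b0 * H (x i) \<le> a * H (x i)" using H1[of "x i"] by (simp add: a_def algebra_simps)
    moreover have "K * 2 powr r * cost i \<le> a * cost i" using cost0[of i] b0 by (intro mult_right_mono) (auto simp: a_def)
    ultimately have 3: "C (x i) (q i) \<le> g (x i) + a * H (x i) + a * cost i" using 1 2 by linarith
    \<comment> \<open>At a bad index one of the two terms is at least 1; multiplied by
      \<open>T\<close> the sum pays for the moment up to the level \<open>T\<close>.\<close>
    have "1 \<le> indicator (- E) (x i) + cost i / \<delta> powr r"
    proof (cases "x i \<in> E")
      case True
      then have "\<delta> powr r \<le> cost i" using False by simp
      then show ?thesis using True \<delta> by simp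
    next
      case False
      then show ?thesis using cost0[of i] by simp
    qed
    then have "T * 1 \<le> T * (indicator (- E) (x i) + cost i / \<delta> powr r)" using T by (intro mult_left_mono) auto
    moreover have "H (x i) \<le> max 0 (H (x i) - T) + T" by auto
    ultimately have "H (x i) \<le> max 0 (H (x i) - T) + T * (indicator (- E) (x i) + cost i / \<delta> powr r)" by linarith
    then have "a * H (x i) \<le> a * (max 0 (H (x i) - T) + T * (indicator (- E) (x i) + cost i / \<delta> powr r))"
      using a by (intro mult_left_mono) auto
    then show ?thesis using 3 \<Delta> by (simp add: algebra_simps)
  qed
  have "(\<Sum>i<N. C (x i) (k (x i))) \<le> (\<Sum>i<N. C (x i) (q i))"
    by (rule mono) (use x q qsum qmean \<zeta>mean in \<open>auto simp: S'_def\<close>)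
  also have "\<dots> \<le> (\<Sum>i<N. g (x i) + \<Delta> / 8 + a * max 0 (H (x i) - T) + a * T * indicator (- E) (x i) + a * (T / \<delta> powr r + 1) * cost i)"
    by (intro sum_mono each) auto
  also have "\<dots> = (\<Sum>i<N. g (x i) + \<Delta> / 8 + a * max 0 (H (x i) - T) + a * T * indicator (- E) (x i)) + a * (T / \<delta> powr r + 1) * (\<Sum>i<N. cost i)"
    by (simp add: sum.distrib sum_distrib_left)
  also have "\<dots> \<le> (\<Sum>i<N. g (x i) + \<Delta> / 8 + a * max 0 (H (x i) - T) + a * T * indicator (- E) (x i)) + a * (T / \<delta> powr r + 1) *
     (2 powr r * ((\<Sum>i<N. D (x i)) + N * e2 + c2 * (\<Sum>i<N. P (x i)) + 2 powr (r + 2) * (\<Sum>i<N. LINT y|k (x i). tail_powr r R y)))"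
  proof -
    have "(\<Sum>i<N. cost i) \<le> 2 powr r * ((\<Sum>i<N. D (x i)) + N * e2 + c2 * (\<Sum>i<N. P (x i)) + 2 powr (r + 2) * (\<Sum>i<N. LINT y|k (x i). tail_powr r R y))"
      using \<gamma>sum by (simp add: cost_def D_def \<zeta>_def P_def c2_def K'.transport_cost_def[OF c e])
    then show ?thesis using a T \<delta> by (intro add_left_mono mult_left_mono) auto
  qed
  also have "\<dots> = (\<Sum>i<N. C (x i) (k (x i))) - (\<Sum>i<N. F0 (x i))"
    unfolding F0_def b_def[symmetric] mult.assoc[symmetric]
    by (simp add: sum.distrib sum_subtractf sum_distrib_left algebra_simps)
  finally show False using pos0 by linarith
qed

section \<open>Extended integrals and versions of kernels\<close>

lemma ext_integral_cong_AE:
  assumes "AE x in M. f x = g x" shows "ext_integral M f = ext_integral M g"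
  unfolding ext_integral_def using assms by (intro arg_cong2[where f="(-)"] arg_cong[where f=enn2ereal] nn_integral_cong_AE) auto

text \<open>The negative part of \<open>g\<close> may fail to be integrable a priori. If the
  negative part of \<open>f\<close> has infinite integral, the left side is
  \<open>- \<infinity>\<close>. Otherwise the truncated inequalities bound the integrals of the
  negative part of \<open>g\<close>, cut at \<open>n\<close>, by one constant, and monotone
  convergence removes the cut.\<close>

lemma ext_integral_le_truncated:
  fixes f g :: "'a \<Rightarrow> real"
  assumes f: "f \<in> borel_measurable M" "\<And>x. f x \<le> u x" and g: "g \<in> borel_measurable M" "\<And>x. g x \<le> u x"
    and u: "integrable M u"
    and le: "\<And>n::nat. integrable M f \<Longrightarrow> integrable M (\<lambda>x. max (g x) (- real n)) \<Longrightarrow> (LINT x|M. f x) \<le> (LINT x|M. max (g x) (- real n))"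
    and fin: "finite_measure M"
  shows "ext_integral M f \<le> ext_integral M g"
proof -
  interpret finite_measure M by (rule fin)
  note [measurable] = f(1) g(1)
  have [measurable]: "u \<in> borel_measurable M" using u by simp
  have pos: "integrable M (\<lambda>x. max 0 (h x))" if [measurable]: "h \<in> borel_measurable M" and "\<And>x. h x \<le> u x" for h
    by (rule Bochner_Integration.integrable_bound[OF u]) (use that(2) in \<open>auto simp: max_def intro!: AE_I2 order_trans[OF that(2)]\<close>)
  have e: "ennreal (h x) = ennreal (max 0 (h x))" for h :: "'a \<Rightarrow> real" and x by (simp add: max_def ennreal_neg)
  have P: "(\<integral>\<^sup>+x. ennreal (h x) \<partial>M) = ennreal (LINT x|M. max 0 (h x))" if "integrable M (\<lambda>x. max 0 (h x))" for h
    by (subst e, rule nn_integral_eq_integral[OF that]) auto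
  have fP: "integrable M (\<lambda>x. max 0 (f x))" and gP: "integrable M (\<lambda>x. max 0 (g x))" using pos f g by auto
  show ?thesis
  proof (cases "(\<integral>\<^sup>+x. ennreal (- f x) \<partial>M) = \<infinity>")
    case True
    then have "ext_integral M f = - \<infinity>" unfolding ext_integral_def P[OF fP] by (simp add: enn2ereal_ennreal)
    then show ?thesis by simp
  next
    case False
    have fN: "integrable M (\<lambda>x. max 0 (- f x))"
    proof (rule integrableI_nonneg)
      show "(\<integral>\<^sup>+x. ennreal (max 0 (- f x)) \<partial>M) < \<infinity>"
        using False by (subst e[of "\<lambda>x. - f x", symmetric]) (simp add: less_top)
    qed auto
    have fd: "f = (\<lambda>x. max 0 (f x) - max 0 (- f x))" by (auto simp: fun_eq_iff)
    have fI: "integrable M f" by (subst fd) (use fP fN in auto)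
    have fint: "(LINT x|M. f x) = (LINT x|M. max 0 (f x)) - (LINT x|M. max 0 (- f x))"
      by (subst (1) fd) (use fP fN in auto)
    have extf: "ext_integral M f = ereal (LINT x|M. f x)"
      unfolding ext_integral_def P[OF fP] P[OF fN] fint by (simp add: enn2ereal_ennreal)
    define c where "c = (LINT x|M. max 0 (g x)) - (LINT x|M. f x)"
    have trunc: "(\<integral>\<^sup>+x. ennreal (min (max 0 (- g x)) (real n)) \<partial>M) \<le> ennreal c" for n
    proof -
      have i: "integrable M (\<lambda>x. min (max 0 (- g x)) (real n))"
        by (rule integrable_const_bound[where B="real n"]) auto
      have d: "max (g x) (- real n) = max 0 (g x) - min (max 0 (- g x)) (real n)" for x by auto
      have "integrable M (\<lambda>x. max (g x) (- real n))" unfolding d using gP i by simp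
      from le[OF fI this] have "(LINT x|M. f x) \<le> (LINT x|M. max 0 (g x)) - (LINT x|M. min (max 0 (- g x)) (real n))"
        unfolding d using gP i by simp
      then have "(LINT x|M. min (max 0 (- g x)) (real n)) \<le> c" by (simp add: c_def)
      moreover have "(\<integral>\<^sup>+x. ennreal (min (max 0 (- g x)) (real n)) \<partial>M) = ennreal (LINT x|M. min (max 0 (- g x)) (real n))"
        by (rule nn_integral_eq_integral[OF i]) auto
      ultimately show ?thesis by (simp add: ennreal_leI)
    qed
    \<comment> \<open>Truncation at level 0 compares \<open>f\<close> with the positive part of
      \<open>g\<close>.\<close>
    have c0: "0 \<le> c"
      using trunc[of 0] le[of 0] gP fI by (simp add: c_def max.commute)
    have "(\<integral>\<^sup>+x. ennreal (max 0 (- g x)) \<partial>M) = (\<integral>\<^sup>+x. (SUP n. ennreal (min (max 0 (- g x)) (real n))) \<partial>M)"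
    proof (rule nn_integral_cong)
      fix x
      obtain n0 :: nat where n0: "max 0 (- g x) \<le> real n0" using real_arch_simple by blast
      have "(SUP n. ennreal (min (max 0 (- g x)) (real n))) = ennreal (max 0 (- g x))"
      proof (rule antisym)
        show "(SUP n. ennreal (min (max 0 (- g x)) (real n))) \<le> ennreal (max 0 (- g x))"
          by (rule SUP_least) (rule ennreal_leI, simp)
        have "ennreal (max 0 (- g x)) = ennreal (min (max 0 (- g x)) (real n0))" using n0 by (simp add: min_def)
        also have "\<dots> \<le> (SUP n. ennreal (min (max 0 (- g x)) (real n)))" by (rule SUP_upper) simp
        finally show "ennreal (max 0 (- g x)) \<le> (SUP n. ennreal (min (max 0 (- g x)) (real n)))" .
      qed
      then show "ennreal (max 0 (- g x)) = (SUP n. ennreal (min (max 0 (- g x)) (real n)))" ..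
    qed
    also have "\<dots> = (SUP n. \<integral>\<^sup>+x. ennreal (min (max 0 (- g x)) (real n)) \<partial>M)"
      by (rule nn_integral_monotone_convergence_SUP) (auto simp: incseq_def le_fun_def intro!: ennreal_leI)
    also have "\<dots> \<le> ennreal c" by (rule SUP_least) (rule trunc)
    finally have gN: "(\<integral>\<^sup>+x. ennreal (- g x) \<partial>M) \<le> ennreal c" by (subst e[of "\<lambda>x. - g x"])
    have "enn2ereal (\<integral>\<^sup>+x. ennreal (- g x) \<partial>M) \<le> ereal c"
      using gN c0 by (metis enn2ereal_ennreal less_eq_ennreal.rep_eq)
    then have "ereal (LINT x|M. max 0 (g x)) - ereal c \<le> ext_integral M g"
      unfolding ext_integral_def P[OF gP] by (intro ereal_minus_mono) (simp_all add: enn2ereal_ennreal)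
    moreover have "ereal (LINT x|M. max 0 (g x)) - ereal c = ereal (LINT x|M. f x)" by (simp add: c_def)
    ultimately show ?thesis using extf by simp
  qed
qed

section \<open>Disintegrations and everywhere defined versions of kernels\<close>

lemma bind_disintegration:
  assumes \<mu>: "prob_space \<mu>" "sets \<mu> = sets borel" and \<pi>: "\<pi> \<in> couplings \<mu> \<nu>" and k: "disintegration \<mu> k \<pi>"
  shows "\<mu> \<bind> k = \<nu>"
proof -
  have k': "k \<in> \<mu> \<rightarrow>\<^sub>M subprob_algebra borel" using k
    by (auto simp: disintegration_def measurable_cong_sets[OF \<mu>(2) refl] intro: measurable_prob_algebraD)
  have sp: "space \<mu> = UNIV" "space \<mu> \<noteq> {}" using sets_eq_imp_space_eq[OF \<mu>(2)] by auto
  have \<pi>D: "sets \<pi> = sets borel" "distr \<pi> borel snd = \<nu>" using \<pi> by (auto simp: couplings_def)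
  have s: "snd \<in> \<pi> \<rightarrow>\<^sub>M (borel :: real measure)"
    unfolding measurable_cong_sets[OF \<pi>D(1) refl] by (subst borel_prod[symmetric]) measurable
  show ?thesis
  proof (rule measure_eqI)
    show "sets (\<mu> \<bind> k) = sets \<nu>"
      unfolding \<pi>D(2)[symmetric] using sets_bind_measurable[OF k' sp(2)] by simp
    fix B assume "B \<in> sets (\<mu> \<bind> k)"
    then have B: "B \<in> sets borel" using sets_bind_measurable[OF k' sp(2)] by simp
    have "emeasure \<nu> B = emeasure \<pi> (UNIV \<times> B)"
      unfolding \<pi>D(2)[symmetric] using B sets_eq_imp_space_eq[OF \<pi>D(1)]
      by (subst emeasure_distr[OF s]) (auto intro!: arg_cong[where f="emeasure \<pi>"])
    also have "\<dots> = (\<integral>\<^sup>+x\<in>UNIV. emeasure (k x) B \<partial>\<mu>)"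
      using k B sets.top[of "borel :: real measure"] unfolding disintegration_def by (metis space_borel)
    also have "\<dots> = (\<integral>\<^sup>+x. emeasure (k x) B \<partial>\<mu>)" by simp
    also have "\<dots> = emeasure (\<mu> \<bind> k) B" by (rule emeasure_bind[OF sp(2) k' B, symmetric])
    finally show "emeasure (\<mu> \<bind> k) B = emeasure \<nu> B" ..
  qed
qed

text \<open>Started from \<mu> restricted to a Borel set \<open>A\<close>, both kernels yield the
  same mixture, since \<pi> determines its values. Hence the two integrals are densities of one
  measure with respect to \<mu>, and finiteness makes them equal almost everywhere.\<close>

lemma disintegration_nn_integral_eq_AE:
  assumes \<mu>: "prob_space \<mu>" "sets \<mu> = sets borel"
    and k: "disintegration \<mu> k \<pi>" and k1: "disintegration \<mu> k1 \<pi>"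
    and h[measurable]: "h \<in> borel_measurable borel" and fin: "(\<integral>\<^sup>+x. \<integral>\<^sup>+y. h y \<partial>k x \<partial>\<mu>) \<noteq> \<infinity>"
  shows "AE x in \<mu>. (\<integral>\<^sup>+y. h y \<partial>k x) = (\<integral>\<^sup>+y. h y \<partial>k1 x)"
proof -
  have m: "f \<in> \<mu> \<rightarrow>\<^sub>M M \<longleftrightarrow> f \<in> borel \<rightarrow>\<^sub>M M" for f :: "real \<Rightarrow> 'z" and M
    by (rule arg_cong[OF measurable_cong_sets]) (auto simp: \<mu>)
  have sp: "space \<mu> = UNIV" using sets_eq_imp_space_eq[OF \<mu>(2)] by auto
  have K: "\<kappa> \<in> borel \<rightarrow>\<^sub>M subprob_algebra borel" if "disintegration \<mu> \<kappa> \<pi>" for \<kappa>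
    using that by (auto simp: disintegration_def intro: measurable_prob_algebraD)
  have meas: "(\<lambda>x. \<integral>\<^sup>+y. h y \<partial>\<kappa> x) \<in> borel_measurable \<mu>" if "disintegration \<mu> \<kappa> \<pi>" for \<kappa>
    unfolding m by (rule measurable_compose[OF K[OF that] nn_integral_measurable_subprob_algebra]) simp
  have md: "f \<in> density \<mu> (indicator A) \<rightarrow>\<^sub>M M \<longleftrightarrow> f \<in> borel \<rightarrow>\<^sub>M M" for f :: "real \<Rightarrow> 'z" and M and A
    by (rule arg_cong[OF measurable_cong_sets]) (auto simp: \<mu>)
  have bindE: "emeasure (density \<mu> (indicator A) \<bind> \<kappa>) B = emeasure \<pi> (A \<times> B)"
    if "disintegration \<mu> \<kappa> \<pi>" "A \<in> sets borel" "B \<in> sets borel" for \<kappa> A B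
  proof -
    have "emeasure (density \<mu> (indicator A) \<bind> \<kappa>) B = (\<integral>\<^sup>+x. emeasure (\<kappa> x) B \<partial>density \<mu> (indicator A))"
      by (rule emeasure_bind[OF _ _ that(3)]) (use K[OF that(1)] in \<open>simp_all add: md m sp\<close>)
    also have "\<dots> = (\<integral>\<^sup>+x. indicator A x * emeasure (\<kappa> x) B \<partial>\<mu>)"
      using that(2,3) K[OF that(1)]
      by (intro nn_integral_density) (auto simp: m intro: measurable_compose[OF _ measurable_emeasure_subprob_algebra])
    also have "\<dots> = emeasure \<pi> (A \<times> B)" using that unfolding disintegration_def by (simp add: mult.commute)
    finally show ?thesis .
  qed
  have eq: "(\<integral>\<^sup>+x. indicator A x * (\<integral>\<^sup>+y. h y \<partial>k x) \<partial>\<mu>) = (\<integral>\<^sup>+x. indicator A x * (\<integral>\<^sup>+y. h y \<partial>k1 x) \<partial>\<mu>)"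
    if A: "A \<in> sets borel" for A
  proof -
    have I: "(\<integral>\<^sup>+x. indicator A x * (\<integral>\<^sup>+y. h y \<partial>\<kappa> x) \<partial>\<mu>) = (\<integral>\<^sup>+y. h y \<partial>(density \<mu> (indicator A) \<bind> \<kappa>))"
      if "disintegration \<mu> \<kappa> \<pi>" for \<kappa>
      using A meas[OF that] K[OF that]
      by (subst nn_integral_bind[where B=borel]) (auto simp: md nn_integral_density m)
    have "density \<mu> (indicator A) \<bind> k = density \<mu> (indicator A) \<bind> k1"
    proof (rule measure_eqI)
      have S: "sets (density \<mu> (indicator A) \<bind> \<kappa>) = sets borel" if "disintegration \<mu> \<kappa> \<pi>" for \<kappa>
        by (rule sets_bind_measurable) (use K[OF that] in \<open>simp_all add: md m sp\<close>)
      show "sets (density \<mu> (indicator A) \<bind> k) = sets (density \<mu> (indicator A) \<bind> k1)" using S[OF k] S[OF k1] by simp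
      fix B assume "B \<in> sets (density \<mu> (indicator A) \<bind> k)"
      then have "B \<in> sets borel" using S[OF k] by simp
      then show "emeasure (density \<mu> (indicator A) \<bind> k) B = emeasure (density \<mu> (indicator A) \<bind> k1) B"
        using bindE[OF k A] bindE[OF k1 A] by simp
    qed
    then show ?thesis using I[OF k] I[OF k1] by simp
  qed
  have "density \<mu> (\<lambda>x. \<integral>\<^sup>+y. h y \<partial>k x) = density \<mu> (\<lambda>x. \<integral>\<^sup>+y. h y \<partial>k1 x)"
    by (rule measure_eqI) (use eq meas[OF k] meas[OF k1] \<mu>(2) in \<open>auto simp: emeasure_density mult.commute\<close>)
  then show ?thesis using finite_density_unique[OF meas[OF k] meas[OF k1] AE_I2 AE_I2] fin by auto
qed

text \<open>\<open>martingale_couplings\<close> grants the martingale property to some kernel only;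
  it is transferred to the given \<open>k\<close>. On the remaining null set \<open>k x\<close> is
  replaced by the point mass at \<open>x\<close>, which has all moments and barycentre
  \<open>x\<close>.\<close>

lemma martingale_kernel_version:
  assumes r: "1 \<le> r" and \<mu>: "\<mu> \<in> prob_moment r" and \<nu>: "\<nu> \<in> prob_moment r"
    and \<pi>: "\<pi> \<in> martingale_couplings \<mu> \<nu>" and k: "disintegration \<mu> k \<pi>"
  obtains \<kappa> where "martingale_kernel r \<mu> \<kappa>" "AE x in \<mu>. \<kappa> x = k x" "\<mu> \<bind> \<kappa> = \<nu>"
proof -
  note \<mu>D = prob_momentD[OF \<mu>]
  interpret prob_space \<mu> by (rule \<mu>D)
  have m: "f \<in> \<mu> \<rightarrow>\<^sub>M M \<longleftrightarrow> f \<in> borel \<rightarrow>\<^sub>M M" for f :: "real \<Rightarrow> 'z" and M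
    by (rule arg_cong[OF measurable_cong_sets]) (auto simp: \<mu>D)
  have \<pi>c: "\<pi> \<in> couplings \<mu> \<nu>" using \<pi> by (auto simp: martingale_couplings_def)
  obtain k1 where k1: "disintegration \<mu> k1 \<pi>" "AE x in \<mu>. has_bochner_integral (k1 x) (\<lambda>y. y) x"
    using \<pi> by (auto simp: martingale_couplings_def)
  have kp[measurable]: "k \<in> borel \<rightarrow>\<^sub>M prob_algebra borel" using k by (simp add: disintegration_def)
  have ks: "k \<in> borel \<rightarrow>\<^sub>M subprob_algebra borel" by (rule measurable_prob_algebraD[OF kp])
  have k1p: "k1 \<in> borel \<rightarrow>\<^sub>M prob_algebra borel" using k1 by (simp add: disintegration_def)
  have bk: "\<mu> \<bind> k = \<nu>" by (rule bind_disintegration[OF \<mu>D(1,2) \<pi>c k])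
  have kx: "prob_space (\<kappa> x)" "sets (\<kappa> x) = sets borel" if "\<kappa> \<in> borel \<rightarrow>\<^sub>M prob_algebra borel" for \<kappa> :: "real \<Rightarrow> real measure" and x
    using measurable_space[OF that, of x] by (auto simp: space_prob_algebra)
  have AEm: "AE x in \<mu>. integrable (k x) (\<lambda>y. \<bar>y\<bar> powr r)"
    using integral_bind_kernel(1)[of k \<mu> borel "\<lambda>y. \<bar>y\<bar> powr r"] ks prob_momentD(4)[OF \<nu>] by (simp add: m bk \<mu>D)
  have fin: "(\<integral>\<^sup>+x. \<integral>\<^sup>+y. ennreal (h y) \<partial>k x \<partial>\<mu>) \<noteq> \<infinity>" if "integrable \<nu> h" "h \<in> borel_measurable borel" for h :: "real \<Rightarrow> real"
  proof -
    have "(\<integral>\<^sup>+x. \<integral>\<^sup>+y. ennreal (h y) \<partial>k x \<partial>\<mu>) = (\<integral>\<^sup>+y. ennreal (h y) \<partial>\<nu>)"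
      unfolding bk[symmetric] using ks that(2) by (subst nn_integral_bind[where B=borel]) (auto simp: m)
    also have "\<dots> \<noteq> \<infinity>" using that(1) by (simp add: real_integrable_def)
    finally show ?thesis .
  qed
  note \<nu>id = prob_moment_integrable_id[OF \<nu> r]
  \<comment> \<open>The barycentre is compared through the nonnegative integrals of the positive and
    the negative part of the identity.\<close>
  have "AE x in \<mu>. (\<integral>\<^sup>+y. ennreal y \<partial>k x) = (\<integral>\<^sup>+y. ennreal y \<partial>k1 x)"
    by (rule disintegration_nn_integral_eq_AE[OF \<mu>D(1,2) k k1(1) _ fin[OF \<nu>id]]) auto
  moreover have "AE x in \<mu>. (\<integral>\<^sup>+y. ennreal (- y) \<partial>k x) = (\<integral>\<^sup>+y. ennreal (- y) \<partial>k1 x)"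
    by (rule disintegration_nn_integral_eq_AE[OF \<mu>D(1,2) k k1(1) _ fin[OF integrable_minus[OF \<nu>id]]]) simp_all
  ultimately have AEmean: "AE x in \<mu>. k x \<in> prob_moment r \<and> (LINT y|k x. y) = x"
    using AEm k1(2)
  proof eventually_elim
    case (elim x)
    have P: "k x \<in> prob_moment r" using kx[OF kp] elim(3) by (intro prob_momentI)
    have "(LINT y|k x. y) = (LINT y|k1 x. y)"
      using real_lebesgue_integral_def[OF prob_moment_integrable_id[OF P r]] elim(1,2,4)
        real_lebesgue_integral_def[of "k1 x" "\<lambda>y. y"] by (simp add: has_bochner_integral_iff)
    then show ?case using P elim(4) by (simp add: has_bochner_integral_iff)
  qed
  define \<kappa> where "\<kappa> x = (if integrable (k x) (\<lambda>y. \<bar>y\<bar> powr r) \<and> (LINT y|k x. y) = x then k x else return borel x)" for x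
  have [measurable]: "Measurable.pred borel (\<lambda>x. integrable (k x) (\<lambda>y. \<bar>y\<bar> powr r))"
    by (rule measurable_compose[OF ks integrable_measurable_subprob_algebra]) simp
  have [measurable]: "(\<lambda>x. LINT y|k x. y) \<in> borel_measurable borel"
    by (rule measurable_compose[OF ks integral_measurable_subprob_algebra]) simp
  have \<kappa>: "\<kappa> \<in> borel \<rightarrow>\<^sub>M prob_algebra borel" unfolding \<kappa>_def[abs_def] by measurable
  have AEeq: "AE x in \<mu>. \<kappa> x = k x"
    using AEmean by eventually_elim (auto simp: \<kappa>_def dest: prob_momentD)
  have bind\<kappa>: "\<mu> \<bind> \<kappa> = \<nu>"
  proof -
    have "\<mu> \<bind> \<kappa> = \<mu> \<bind> k"
    proof (rule measure_eqI)
      have \<kappa>s: "\<kappa> \<in> \<mu> \<rightarrow>\<^sub>M subprob_algebra borel" "k \<in> \<mu> \<rightarrow>\<^sub>M subprob_algebra borel"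
        using measurable_prob_algebraD[OF \<kappa>] ks by (simp_all add: m)
      have ne: "space \<mu> \<noteq> {}" by (simp add: \<mu>D)
      show "sets (\<mu> \<bind> \<kappa>) = sets (\<mu> \<bind> k)" 
        by (simp add: sets_bind_measurable[OF \<kappa>s(1) ne] sets_bind_measurable[OF \<kappa>s(2) ne])
      fix A assume "A \<in> sets (\<mu> \<bind> \<kappa>)"
      then have A: "A \<in> sets borel" using sets_bind_measurable[OF \<kappa>s(1) ne] by simp
      show "emeasure (\<mu> \<bind> \<kappa>) A = emeasure (\<mu> \<bind> k) A"
        unfolding emeasure_bind[OF ne \<kappa>s(1) A] emeasure_bind[OF ne \<kappa>s(2) A]
        by (rule nn_integral_cong_AE) (use AEeq in eventually_elim, simp)
    qed
    then show ?thesis by (simp add: bk)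
  qed
  have \<kappa>x: "\<kappa> x \<in> prob_moment r \<and> (LINT y|\<kappa> x. y) = x" for x
  proof (cases "integrable (k x) (\<lambda>y. \<bar>y\<bar> powr r) \<and> (LINT y|k x. y) = x")
    case True
    then show ?thesis using kx[OF kp] by (auto simp: \<kappa>_def intro!: prob_momentI)
  next
    case False
    have "integrable (return borel x) (\<lambda>y::real. \<bar>y\<bar> powr r)" 
      by (rule integrableI_bounded) (simp_all add: nn_integral_return)
    then have "return borel x \<in> prob_moment r" by (intro prob_momentI) (auto intro: prob_space_return)
    then show ?thesis using False by (auto simp: \<kappa>_def integral_return)
  qed
  have "martingale_kernel r \<mu> \<kappa>"
    by unfold_locales (use r \<mu> \<kappa> \<kappa>x bind\<kappa> \<nu> in auto)
  then show thesis using that AEeq bind\<kappa> by blast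
qed

theorem theorem1p7:
  fixes r :: real
    and \<mu> \<nu> :: "real measure"
    and C :: "real \<Rightarrow> real measure \<Rightarrow> real"
    and \<Gamma> :: "(real \<times> real measure) set"
    and \<pi> :: "(real \<times> real) measure"
    and k :: "real \<Rightarrow> real measure"
  assumes "r \<ge> 1"
    and "\<mu> \<in> prob_moment r" and "\<nu> \<in> prob_moment r"
    and "convex_order \<mu> \<nu>"
    and "(\<lambda>(x, p). C x p) \<in>
           borel_measurable (borel_of (prod_topology euclidean (wasserstein_topology r)))"
    and "\<forall>x. continuous_map (wasserstein_topology r) euclidean (C x)"
    and "\<exists>K::real. \<forall>x. \<forall>p\<in>prob_moment r.
           C x p \<le> K * (1 + \<bar>x\<bar> powr r + (LINT y|p. \<bar>y\<bar> powr r))"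
    and "martingale_C_monotone r C \<Gamma>"
    and "\<pi> \<in> martingale_couplings \<mu> \<nu>"
    and "disintegration \<mu> k \<pi>"
    and "AE x in \<mu>. (x, k x) \<in> \<Gamma>"
  shows "weak_cost C \<mu> k =
           Inf {weak_cost C \<mu> k' | \<pi>' k'. \<pi>' \<in> martingale_couplings \<mu> \<nu> \<and> disintegration \<mu> k' \<pi>'}"
proof (rule antisym)
  note r = assms(1)
  show "Inf {weak_cost C \<mu> k' | \<pi>' k'. \<pi>' \<in> martingale_couplings \<mu> \<nu> \<and> disintegration \<mu> k' \<pi>'} \<le> weak_cost C \<mu> k"
    using assms(9,10) by (intro Inf_lower) blast
  obtain \<kappa> where \<kappa>: "martingale_kernel r \<mu> \<kappa>" "AE x in \<mu>. \<kappa> x = k x" "\<mu> \<bind> \<kappa> = \<nu>"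
    using martingale_kernel_version[OF assms(1-3,9,10)] by blast
  interpret K: martingale_kernel r \<mu> \<kappa> by (rule \<kappa>(1))
  obtain K0 where K0: "\<And>x p. p \<in> prob_moment r \<Longrightarrow> C x p \<le> K0 * (1 + \<bar>x\<bar> powr r + (LINT y|p. \<bar>y\<bar> powr r))"
    using assms(7) by blast
  \<comment> \<open>The absolute value makes the constant nonnegative, as the multiplication of
    inequalities by it later demands.\<close>
  have bound: "C x p \<le> \<bar>K0\<bar> * (1 + \<bar>x\<bar> powr r + (LINT y|p. \<bar>y\<bar> powr r))" if "p \<in> prob_moment r" for x p
  proof -
    have "K0 * (1 + \<bar>x\<bar> powr r + (LINT y|p. \<bar>y\<bar> powr r)) \<le> \<bar>K0\<bar> * (1 + \<bar>x\<bar> powr r + (LINT y|p. \<bar>y\<bar> powr r))"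
      by (intro mult_right_mono add_nonneg_nonneg) auto
    then show ?thesis using K0[OF that, of x] by linarith
  qed
  have cont: "continuous_map (wasserstein_topology r) euclidean (C x)" for x using assms(6) by blast
  define S where "S = {x. (x, \<kappa> x) \<in> \<Gamma>}"
  have S: "AE x in \<mu>. x \<in> S" using \<kappa>(2) assms(11) by eventually_elim (simp add: S_def)
  have mono: "(\<Sum>i<N. C (x i) (\<kappa> (x i))) \<le> (\<Sum>i<N. C (x i) (q i))"
    if "\<And>i. i < N \<Longrightarrow> x i \<in> S" "\<And>i. i < N \<Longrightarrow> q i \<in> prob_moment r"
      "\<And>A. A \<in> sets borel \<Longrightarrow> (\<Sum>i<N. measure (\<kappa> (x i)) A) = (\<Sum>i<N. measure (q i) A)"
      "\<And>i. i < N \<Longrightarrow> (LINT y|q i. y) = x i" for N :: nat and x q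
  proof -
    \<comment> \<open>Monotonicity is formulated for competitors with a finite first moment, which a
      finite r-th moment provides.\<close>
    have "q i \<in> prob_moment 1" if "i < N" for i
    proof (rule prob_momentI)
      note qi = \<open>\<And>i. i < N \<Longrightarrow> q i \<in> prob_moment r\<close>[OF that]
      show "prob_space (q i)" "sets (q i) = sets borel" using prob_momentD[OF qi] by auto
      show "integrable (q i) (\<lambda>y. \<bar>y\<bar> powr 1)"
        by (rule prob_moment_integrable[OF qi, where A=1 and B=1]) (use abs_le_one_plus_powr[OF r] in auto)
    qed
    then show ?thesis
      using assms(8) that K.k_mean unfolding martingale_C_monotone_def S_def by simp
  qed
  show "weak_cost C \<mu> k \<le> Inf {weak_cost C \<mu> k' | \<pi>' k'. \<pi>' \<in> martingale_couplings \<mu> \<nu> \<and> disintegration \<mu> k' \<pi>'}"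
  proof (rule Inf_greatest)
    fix w assume "w \<in> {weak_cost C \<mu> k' | \<pi>' k'. \<pi>' \<in> martingale_couplings \<mu> \<nu> \<and> disintegration \<mu> k' \<pi>'}"
    then obtain \<pi>' k' where k': "w = weak_cost C \<mu> k'" "\<pi>' \<in> martingale_couplings \<mu> \<nu>" "disintegration \<mu> k' \<pi>'" by blast
    obtain \<kappa>' where \<kappa>': "martingale_kernel r \<mu> \<kappa>'" "AE x in \<mu>. \<kappa>' x = k' x" "\<mu> \<bind> \<kappa>' = \<nu>"
      using martingale_kernel_version[OF assms(1-3) k'(2,3)] by blast
    interpret K': martingale_kernel r \<mu> \<kappa>' by (rule \<kappa>'(1))
    \<comment> \<open>A common integrable majorant of both costs; it makes their positive parts
      integrable.\<close>
    define u where "u x = \<bar>K0\<bar> * K.moment_bound x + \<bar>K0\<bar> * K'.moment_bound x" for x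
    have u_ge: "C x (\<kappa> x) \<le> u x" "C x (\<kappa>' x) \<le> u x" for x
    proof -
      have "0 \<le> \<bar>K0\<bar> * K.moment_bound x" "0 \<le> \<bar>K0\<bar> * K'.moment_bound x"
        using K.moment_bound_ge_1[of x] K'.moment_bound_ge_1[of x] by (auto intro!: mult_nonneg_nonneg)
      then show "C x (\<kappa> x) \<le> u x" "C x (\<kappa>' x) \<le> u x"
        using bound[OF K.k_moment, of x x] bound[OF K'.k_moment, of x x]
        unfolding u_def K.moment_bound_def K'.moment_bound_def by linarith+
    qed
    have "ext_integral \<mu> (\<lambda>x. C x (\<kappa> x)) \<le> ext_integral \<mu> (\<lambda>x. C x (\<kappa>' x))"
    proof (rule ext_integral_le_truncated[OF _ u_ge(1) _ u_ge(2)])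
      show "(\<lambda>x. C x (\<kappa> x)) \<in> borel_measurable \<mu>" "(\<lambda>x. C x (\<kappa>' x)) \<in> borel_measurable \<mu>"
        unfolding K.measurable_\<mu>_iff
        by (rule borel_measurable_cost_kernel[OF r assms(5) cont K.k K.k_moment],
            rule borel_measurable_cost_kernel[OF r assms(5) cont K'.k K'.k_moment])
      show "integrable \<mu> u" unfolding u_def using K.moment_bound_integrable K'.moment_bound_integrable by simp
      show "finite_measure \<mu>" by unfold_locales
      fix n :: nat
      assume i: "integrable \<mu> (\<lambda>x. C x (\<kappa> x))" "integrable \<mu> (\<lambda>x. max (C x (\<kappa>' x)) (- real n))"
      show "(LINT x|\<mu>. C x (\<kappa> x)) \<le> (LINT x|\<mu>. max (C x (\<kappa>' x)) (- real n))"
        by (rule kernel_cost_le_truncated[OF \<kappa>(1) \<kappa>'(1) _ cont bound _ mono S i, where ?b0.0="real n"])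
          (auto simp: \<kappa>(3) \<kappa>'(3))
    qed
    also have "ext_integral \<mu> (\<lambda>x. C x (\<kappa> x)) = weak_cost C \<mu> k"
      unfolding weak_cost_def by (rule ext_integral_cong_AE) (use \<kappa>(2) in auto)
    also have "ext_integral \<mu> (\<lambda>x. C x (\<kappa>' x)) = w"
      unfolding k'(1) weak_cost_def by (rule ext_integral_cong_AE) (use \<kappa>'(2) in auto)
    finally show "weak_cost C \<mu> k \<le> w" .
  qed
qed

end
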